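(* Let $d\ge2$, $s>0$ and $0<q\le\infty$. Then the mapping $\operatorname{tr}$ is a linear isomorphism of $RB^s_{\infty,q}(\mathbb{R}^d)$ onto $RB^s_{\infty,q}(\mathbb{R})$, with inverse $\operatorname{ext}$.
   Context: Besov spaces on $\mathbb{R}^n$: let $\varphi_0\in C_0^\infty(\mathbb{R}^n)$ with $\varphi_0(\xi)=1$ for $|\xi|\le1$ and $\varphi_0(\xi)=0$ for $|\xi|\ge 3/2$, and $\varphi_j(\xi)=\varphi_0(2^{-j}\xi)-\varphi_0(2^{-j+1}\xi)$, $j\ge1$. Then $B^s_{\infty,q}(\mathbb{R}^n)$ consists of all $f\in\mathcal{S}'(\mathbb{R}^n)$ with finite quasi-norm $\big(\sum_{j\ge0}2^{jsq}\|\mathcal{F}^{-1}[\varphi_j\mathcal{F}f]\|_{L_\infty}^q\big)^{1/q}$ (usual modification for $q=\infty$). $RE$ denotes the subset of radial elements of $E$ (invariant under all orthogonal transformations of $\mathbb{R}^n$; even functions if $n=1$), with the quasi-norm of $E$. For a radial function $f$ on $\mathbb{R}^d$, $(\operatorname{tr} f)(t)=f(t,0,\dots,0)$, $t\in\mathbb{R}$; for an even function $g$ on $\mathbb{R}$, $(\operatorname{ext} g)(x)=g(|x|)$, $x\in\mathbb{R}^d$. A linear isomorphism is a bounded linear bijection with bounded inverse. *)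

theory Defs
  imports "HOL-Analysis.Analysis" "HOL-Probability.Essential_Supremum"
begin

section \<open>Schwartz functions\<close>

definition dir_deriv :: "'a::euclidean_space \<Rightarrow> ('a \<Rightarrow> complex) \<Rightarrow> 'a \<Rightarrow> complex" where
  "dir_deriv b f = (\<lambda>x. frechet_derivative f (at x) b)"

text \<open>A list \<open>bs\<close> of basis vectors plays the role of a multi-index: \<open>iter_deriv bs f\<close> is the
  iterated partial derivative of \<open>f\<close> in the coordinate directions listed in \<open>bs\<close>.\<close>

definition iter_deriv :: "'a::euclidean_space list \<Rightarrow> ('a \<Rightarrow> complex) \<Rightarrow> 'a \<Rightarrow> complex" where
  "iter_deriv bs f = foldr dir_deriv bs f"

definition smooth :: "('a::euclidean_space \<Rightarrow> complex) \<Rightarrow> bool" where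
  "smooth f \<longleftrightarrow> (\<forall>bs x. set bs \<subseteq> Basis \<longrightarrow> iter_deriv bs f differentiable (at x))"

definition schwartz :: "('a::euclidean_space \<Rightarrow> complex) set" where
  "schwartz = {f. smooth f \<and> (\<forall>N bs. set bs \<subseteq> Basis \<longrightarrow>
     bounded (range (\<lambda>x. (1 + norm x) ^ N *\<^sub>R iter_deriv bs f x)))}"

definition schwartz_converges ::
    "(nat \<Rightarrow> 'a::euclidean_space \<Rightarrow> complex) \<Rightarrow> ('a \<Rightarrow> complex) \<Rightarrow> bool" where
  "schwartz_converges F f \<longleftrightarrow> (\<forall>N bs. set bs \<subseteq> Basis \<longrightarrow>
     uniform_limit UNIV (\<lambda>k x. (1 + norm x) ^ N *\<^sub>R iter_deriv bs (F k) x)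
                        (\<lambda>x. (1 + norm x) ^ N *\<^sub>R iter_deriv bs f x) sequentially)"

section \<open>Tempered distributions\<close>

text \<open>A tempered distribution is a continuous linear functional on \<open>schwartz\<close>; as that space is
  metrizable, sequential continuity is continuity. Functionals take the value \<open>0\<close> outside
  \<open>schwartz\<close>, so that equality of functions is equality of distributions.\<close>

definition tempered :: "(('a::euclidean_space \<Rightarrow> complex) \<Rightarrow> complex) set" where
  "tempered = {T.
     (\<forall>\<psi>. \<psi> \<notin> schwartz \<longrightarrow> T \<psi> = 0) \<and>
     (\<forall>\<psi>\<in>schwartz. \<forall>\<eta>\<in>schwartz. \<forall>a b. T (\<lambda>x. a * \<psi> x + b * \<eta> x) = a * T \<psi> + b * T \<eta>) \<and>
     (\<forall>F f. (\<forall>k. F k \<in> schwartz) \<and> f \<in> schwartz \<and> schwartz_converges F f \<longrightarrow>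
        (\<lambda>k. T (F k)) \<longlonglongrightarrow> T f)}"

definition dist_of :: "('a::euclidean_space \<Rightarrow> complex) \<Rightarrow> ('a \<Rightarrow> complex) \<Rightarrow> complex" where
  "dist_of g = (\<lambda>\<psi>. if \<psi> \<in> schwartz then LINT x|lborel. g x * \<psi> x else 0)"

definition fourier :: "('a::euclidean_space \<Rightarrow> complex) \<Rightarrow> 'a \<Rightarrow> complex" where
  "fourier \<psi> = (\<lambda>\<xi>. of_real ((2 * pi) powr (- real DIM('a) / 2)) *
     (LINT x|lborel. exp (- \<i> * of_real (x \<bullet> \<xi>)) * \<psi> x))"

definition inv_fourier :: "('a::euclidean_space \<Rightarrow> complex) \<Rightarrow> 'a \<Rightarrow> complex" where
  "inv_fourier \<psi> = (\<lambda>x. of_real ((2 * pi) powr (- real DIM('a) / 2)) *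
     (LINT \<xi>|lborel. exp (\<i> * of_real (x \<bullet> \<xi>)) * \<psi> \<xi>))"

definition dist_fourier ::
    "(('a::euclidean_space \<Rightarrow> complex) \<Rightarrow> complex) \<Rightarrow> ('a \<Rightarrow> complex) \<Rightarrow> complex" where
  "dist_fourier T = (\<lambda>\<psi>. if \<psi> \<in> schwartz then T (fourier \<psi>) else 0)"

definition dist_inv_fourier ::
    "(('a::euclidean_space \<Rightarrow> complex) \<Rightarrow> complex) \<Rightarrow> ('a \<Rightarrow> complex) \<Rightarrow> complex" where
  "dist_inv_fourier T = (\<lambda>\<psi>. if \<psi> \<in> schwartz then T (inv_fourier \<psi>) else 0)"

definition dist_mult ::
    "('a::euclidean_space \<Rightarrow> complex) \<Rightarrow> (('a \<Rightarrow> complex) \<Rightarrow> complex) \<Rightarrow> ('a \<Rightarrow> complex) \<Rightarrow> complex" where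
  "dist_mult m T = (\<lambda>\<psi>. if \<psi> \<in> schwartz then T (\<lambda>x. m x * \<psi> x) else 0)"

text \<open>The \<open>L\<^sub>\<infinity>\<close> norm of a distribution; it is \<open>\<infinity>\<close> unless the distribution is given by an
  essentially bounded function, which is then unique almost everywhere.\<close>

definition Linf_norm :: "(('a::euclidean_space \<Rightarrow> complex) \<Rightarrow> complex) \<Rightarrow> ennreal" where
  "Linf_norm T = (INF g \<in> {g \<in> borel_measurable lborel. T = dist_of g}.
     esssup lborel (\<lambda>x. ennreal (norm (g x))))"

section \<open>Besov spaces\<close>

text \<open>Compactness of the support is contained in the last condition.\<close>

definition besov_cutoff :: "('a::euclidean_space \<Rightarrow> complex) \<Rightarrow> bool" where
  "besov_cutoff \<phi> \<longleftrightarrow> smooth \<phi> \<and> (\<forall>\<xi>. norm \<xi> \<le> 1 \<longrightarrow> \<phi> \<xi> = 1) \<and> (\<forall>\<xi>. norm \<xi> \<ge> 3/2 \<longrightarrow> \<phi> \<xi> = 0)"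

definition dyadic :: "('a::euclidean_space \<Rightarrow> complex) \<Rightarrow> nat \<Rightarrow> 'a \<Rightarrow> complex" where
  "dyadic \<phi> j = (if j = 0 then \<phi>
     else (\<lambda>\<xi>. \<phi> ((2 powr (- real j)) *\<^sub>R \<xi>) - \<phi> ((2 powr (- real j + 1)) *\<^sub>R \<xi>)))"

definition ennreal_powr :: "ennreal \<Rightarrow> real \<Rightarrow> ennreal" where
  "ennreal_powr x p = (if x = \<infinity> then \<infinity> else ennreal (enn2real x powr p))"  \<comment> \<open>meant for \<open>p > 0\<close>\<close>

definition lq_norm :: "ennreal \<Rightarrow> (nat \<Rightarrow> ennreal) \<Rightarrow> ennreal" where
  "lq_norm q a = (if q = \<infinity> then (SUP j. a j)
     else ennreal_powr (\<Sum>j. ennreal_powr (a j) (enn2real q)) (1 / enn2real q))"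

text \<open>The quasi-norm of \<open>B\<^sup>s\<^sub>\<infinity>\<^sub>,\<^sub>q\<close> with respect to the cut-off function \<open>\<phi>\<close>.\<close>

definition besov_norm ::
    "('a::euclidean_space \<Rightarrow> complex) \<Rightarrow> real \<Rightarrow> ennreal \<Rightarrow> (('a \<Rightarrow> complex) \<Rightarrow> complex) \<Rightarrow> ennreal" where
  "besov_norm \<phi> s q T = lq_norm q (\<lambda>j. ennreal (2 powr (real j * s)) *
     Linf_norm (dist_inv_fourier (dist_mult (dyadic \<phi> j) (dist_fourier T))))"

definition besov ::
    "('a::euclidean_space \<Rightarrow> complex) \<Rightarrow> real \<Rightarrow> ennreal \<Rightarrow> (('a \<Rightarrow> complex) \<Rightarrow> complex) set" where
  "besov \<phi> s q = {T \<in> tempered. besov_norm \<phi> s q T < \<infinity>}"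

text \<open>On \<^typ>\<open>real\<close> the orthogonal transformations are \<open>x \<mapsto> x\<close> and \<open>x \<mapsto> -x\<close>, so that radial
  means even.\<close>

definition radial_dist :: "(('a::euclidean_space \<Rightarrow> complex) \<Rightarrow> complex) \<Rightarrow> bool" where
  "radial_dist T \<longleftrightarrow>
     (\<forall>R. orthogonal_transformation R \<longrightarrow> (\<forall>\<psi>\<in>schwartz. T (\<lambda>x. \<psi> (R x)) = T \<psi>))"

definition radial_besov ::
    "('a::euclidean_space \<Rightarrow> complex) \<Rightarrow> real \<Rightarrow> ennreal \<Rightarrow> (('a \<Rightarrow> complex) \<Rightarrow> complex) set" where
  "radial_besov \<phi> s q = {T \<in> besov \<phi> s q. radial_dist T}"

section \<open>Trace and extension\<close>

text \<open>Point values of a distribution are those of the bounded continuous function that it is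
  given by.\<close>

definition is_cont_rep ::
    "(('a::euclidean_space \<Rightarrow> complex) \<Rightarrow> complex) \<Rightarrow> ('a \<Rightarrow> complex) \<Rightarrow> bool" where
  "is_cont_rep T f \<longleftrightarrow> continuous_on UNIV f \<and> bounded (range f) \<and> T = dist_of f"

definition cont_rep :: "(('a::euclidean_space \<Rightarrow> complex) \<Rightarrow> complex) \<Rightarrow> 'a \<Rightarrow> complex" where
  "cont_rep T = (THE f. is_cont_rep T f)"

text \<open>The index \<open>i\<close> is the coordinate that is called the first one.\<close>

definition tr :: "'d::finite \<Rightarrow> ((real^'d \<Rightarrow> complex) \<Rightarrow> complex) \<Rightarrow> (real \<Rightarrow> complex) \<Rightarrow> complex" where
  "tr i T = dist_of (\<lambda>t. cont_rep T (axis i t))"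

definition ext :: "((real \<Rightarrow> complex) \<Rightarrow> complex) \<Rightarrow> (real^'d::finite \<Rightarrow> complex) \<Rightarrow> complex" where
  "ext T = dist_of (\<lambda>x. cont_rep T (norm x))"

section \<open>Linear isomorphisms of quasi-normed spaces of functionals\<close>

definition linear_map_on ::
    "('x \<Rightarrow> complex) set \<Rightarrow> (('x \<Rightarrow> complex) \<Rightarrow> 'y \<Rightarrow> complex) \<Rightarrow> bool" where
  "linear_map_on X A \<longleftrightarrow> (\<forall>S\<in>X. \<forall>T\<in>X. \<forall>a b.
     A (\<lambda>\<psi>. a * S \<psi> + b * T \<psi>) = (\<lambda>\<psi>. a * A S \<psi> + b * A T \<psi>))"

definition bounded_map_on :: "'x set \<Rightarrow> ('x \<Rightarrow> ennreal) \<Rightarrow> ('y \<Rightarrow> ennreal) \<Rightarrow> ('x \<Rightarrow> 'y) \<Rightarrow> bool" where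
  "bounded_map_on X nX nY A \<longleftrightarrow> (\<exists>C::real. \<forall>T\<in>X. nY (A T) \<le> ennreal C * nX T)"

definition linear_isomorphism ::
    "('x \<Rightarrow> complex) set \<Rightarrow> (('x \<Rightarrow> complex) \<Rightarrow> ennreal) \<Rightarrow>
     ('y \<Rightarrow> complex) set \<Rightarrow> (('y \<Rightarrow> complex) \<Rightarrow> ennreal) \<Rightarrow>
     (('x \<Rightarrow> complex) \<Rightarrow> 'y \<Rightarrow> complex) \<Rightarrow> bool" where
  "linear_isomorphism X nX Y nY A \<longleftrightarrow>
     bij_betw A X Y \<and> linear_map_on X A \<and>
     bounded_map_on X nX nY A \<and> bounded_map_on Y nY nX (inv_into X A)"

end

theory Submission
  imports Defs "HOL-Probability.Sinc_Integral"
begin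

text \<open>Every element \<open>f\<close> of \<open>B\<^sup>s\<^sub>\<infinity>\<^sub>,\<^sub>q\<close> with \<open>s > 0\<close> is a uniformly convergent series of its Littlewood--Paley
  pieces \<open>f\<^sub>j\<close>, which are smooth with \<open>n\<close>-th derivatives bounded by \<open>C\<^sub>n 2\<^sup>j\<^sup>n a\<^sub>j\<close>, where \<open>a\<^sub>j\<close> is the
  \<open>L\<^sub>\<infinity>\<close> norm of the \<open>j\<close>-th distributional piece. Conversely, restrict such a series to a line, symmetrize its
  terms and compose them with \<open>|x|\<close> in a possibly different dimension \<open>d\<close>: on radial functions the Laplacian acts as
  \<open>L g = g'' + (d - 1) g' / t\<close>, and since \<open>g'(t) / t\<close> is an average of dilates of \<open>g''\<close>, all powers of \<open>L\<close> preserve the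
  derivative bounds. As the \<open>k\<close>-th Littlewood--Paley kernel is \<open>4\<^sup>-\<^sup>k\<^sup>m \<Delta>\<^sup>m\<close> of a kernel of the same \<open>L\<^sub>1\<close> size, the
  \<open>k\<close>-th piece of the new function is at most a multiple of the sum of \<open>min (1, 4\<^sup>m\<^sup>(\<^sup>j\<^sup>-\<^sup>k\<^sup>)) a\<^sub>j\<close> over \<open>j\<close>. With
  \<open>2 m > s\<close> this is a convolution with a geometrically decaying sequence after weighting by \<open>2\<^sup>k\<^sup>s\<close>, hence bounded on \<open>\<ell>\<^sub>q\<close>
  for all \<open>q > 0\<close>. Trace and extension are the two instances of this construction.\<close>

section \<open>Calculus in the Schwartz space\<close>

text \<open>The cut-off functions are not assumed radial, so the pieces of a radial distribution
  need not be radial; only their sum is. This dictates the shape of the proof: the terms are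
  restricted to one line and replaced there by their even parts, which leaves the sum unchanged
  because the whole function is even, and each even profile is then composed with the norm, where it
  is radial whatever the piece was. Bounds on derivatives of every order are kept for each term,
  since every application of the radial Laplacian consumes two of them. The Laplacian is moved from
  the kernel to the profile in the weak sense, so that at the origin only first and second
  derivatives along coordinate lines have to be examined. Trace and extension speak about point
  values, hence continuous representatives have to be unique, and invariance of a distribution has
  to become pointwise invariance of its representative. Fourier inversion enters only up to a
  nonzero constant \<open>c\<close>, which is carried along and divided out.\<close>

lemma dir_deriv_eq: "(f has_derivative f') (at x) \<Longrightarrow> dir_deriv b f x = f' b"
  by (metis dir_deriv_def frechet_derivative_at)

lemma dir_deriv_eqI: "(f has_derivative f') (at x) \<Longrightarrow> f' b = y \<Longrightarrow> dir_deriv b f x = y"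
  by (simp add: dir_deriv_eq)

lemma frechet_derivative_worksI: "f differentiable F \<Longrightarrow> (f has_derivative frechet_derivative f F) F"
  by (simp add: frechet_derivative_works)

lemma iter_deriv_Nil [simp]: "iter_deriv [] f = f"
  and iter_deriv_Cons [simp]: "iter_deriv (b # bs) f = dir_deriv b (iter_deriv bs f)"
  and iter_deriv_snoc: "iter_deriv (bs @ [b]) f = iter_deriv bs (dir_deriv b f)"
  by (simp_all add: iter_deriv_def)

text \<open>A class of decaying differentiable functions that is closed under partial derivatives
  contains every \<open>iter_deriv bs f\<close> as soon as it contains \<open>f\<close>. Membership
  is thus shown without formulas of Leibniz type for iterated derivatives.\<close>

lemma schwartz_coinduct:
  assumes f: "f \<in> X"
    and diff: "\<And>g x. g \<in> X \<Longrightarrow> g differentiable (at x)"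
    and decay: "\<And>g N. g \<in> X \<Longrightarrow> \<exists>C. \<forall>x. (1 + norm x) ^ N * norm (g x) \<le> C"
    and deriv: "\<And>g b. g \<in> X \<Longrightarrow> b \<in> Basis \<Longrightarrow> dir_deriv b g \<in> X"
  shows "f \<in> schwartz"
proof -
  have *: "iter_deriv bs f \<in> X" if "set bs \<subseteq> Basis" for bs
    using that by (induction bs) (auto simp: f deriv)
  have "bounded (range (\<lambda>x. (1 + norm x) ^ N *\<^sub>R iter_deriv bs f x))" if bs: "set bs \<subseteq> Basis" for N bs
  proof -
    obtain C where "\<And>x. (1 + norm x) ^ N * norm (iter_deriv bs f x) \<le> C"
      using decay[OF *[OF bs]] by blast
    then show ?thesis
      unfolding bounded_iff by (auto intro!: exI[of _ C])
  qed
  then show ?thesis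
    using * diff by (auto simp: schwartz_def smooth_def)
qed

lemma schwartz_differentiable: "f \<in> schwartz \<Longrightarrow> f differentiable (at x)"
  unfolding schwartz_def smooth_def mem_Collect_eq by (metis empty_set empty_subsetI iter_deriv_Nil)

text \<open>The extra derivative is the innermost one, so it becomes the last entry of the
  list.\<close>

lemma schwartz_dir_deriv:
  assumes "f \<in> schwartz" "b \<in> Basis" shows "dir_deriv b f \<in> schwartz"
proof -
  have "iter_deriv bs (dir_deriv b f) = iter_deriv (bs @ [b]) f" for bs
    by (simp add: iter_deriv_snoc)
  moreover have "set (bs @ [b]) \<subseteq> Basis \<longleftrightarrow> set bs \<subseteq> Basis" for bs
    using assms by auto
  ultimately show ?thesis
    using assms(1) unfolding schwartz_def smooth_def mem_Collect_eq by metis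
qed

lemma schwartz_iter_deriv: "f \<in> schwartz \<Longrightarrow> set bs \<subseteq> Basis \<Longrightarrow> iter_deriv bs f \<in> schwartz"
  by (induction bs) (auto simp: schwartz_dir_deriv)

lemma schwartz_decay:
  assumes "f \<in> schwartz"
  obtains C where "C \<ge> 0" "\<And>x. (1 + norm x) ^ N * norm (f x) \<le> C"
proof -
  have "bounded (range (\<lambda>x. (1 + norm x) ^ N *\<^sub>R iter_deriv [] f x))"
    using assms unfolding schwartz_def mem_Collect_eq by (metis empty_set empty_subsetI)
  then obtain C where C: "\<And>x. norm ((1 + norm x) ^ N *\<^sub>R f x) \<le> C"
    unfolding bounded_iff by auto
  have "(1 + norm x) ^ N * norm (f x) \<le> C" for x
    using C[of x] by simp
  moreover have "C \<ge> 0"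
    using C[of 0] norm_ge_zero order_trans by blast
  ultimately show ?thesis
    using that by blast
qed

lemma schwartz_bounded:
  assumes "f \<in> schwartz"
  obtains C where "C \<ge> 0" "\<And>x. norm (f x) \<le> C"
  using schwartz_decay[OF assms, of 0] by auto

lemma one_plus_norm_pos [simp]: "1 + norm x > 0" "1 + norm x \<noteq> 0" "\<not> 1 + norm x \<le> 0"
  using norm_ge_zero[of x] by linarith+

lemma schwartz_decay_div:
  assumes "f \<in> schwartz"
  obtains C where "C \<ge> 0" "\<And>x. norm (f x) \<le> C / (1 + norm x) ^ N"
proof -
  obtain C where C: "C \<ge> 0" "\<And>x. (1 + norm x) ^ N * norm (f x) \<le> C"
    using schwartz_decay[OF assms] by blast
  then have "norm (f x) \<le> C / (1 + norm x) ^ N" for x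
    using C(2)[of x] by (simp add: pos_le_divide_eq mult.commute)
  with C(1) show ?thesis using that by blast
qed

lemma schwartz_continuous: "f \<in> schwartz \<Longrightarrow> continuous_on A f"
  by (meson continuous_at_imp_continuous_on differentiable_imp_continuous_within schwartz_differentiable)

lemma schwartz_measurable [measurable_dest]: "f \<in> schwartz \<Longrightarrow> f \<in> borel_measurable borel"
  by (intro borel_measurable_continuous_onI schwartz_continuous)

lemma frechet_derivative_sum_Basis:
  fixes f :: "'a::euclidean_space \<Rightarrow> complex"
  assumes "f differentiable (at x)"
  shows "frechet_derivative f (at x) v = (\<Sum>b\<in>Basis. (v \<bullet> b) *\<^sub>R dir_deriv b f x)"
proof -
  have lin: "linear (frechet_derivative f (at x))"
    using assms by (rule linear_frechet_derivative)
  have "frechet_derivative f (at x) v = frechet_derivative f (at x) (\<Sum>b\<in>Basis. (v \<bullet> b) *\<^sub>R b)"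
    by (simp add: euclidean_representation)
  also have "\<dots> = (\<Sum>b\<in>Basis. (v \<bullet> b) *\<^sub>R frechet_derivative f (at x) b)"
    by (simp add: linear_sum[OF lin] linear_scale[OF lin])
  finally show ?thesis by (simp add: dir_deriv_def)
qed

lemma schwartz_has_derivative:
  "f \<in> schwartz \<Longrightarrow> (f has_derivative (\<lambda>v. \<Sum>b\<in>Basis. (v \<bullet> b) *\<^sub>R dir_deriv b f x)) (at x)"
  using frechet_derivative_worksI[OF schwartz_differentiable, of f x]
  by (subst frechet_derivative_sum_Basis[symmetric]) (auto simp: schwartz_differentiable)

text \<open>The sum is the Frechet derivative of \<open>f\<close> at \<open>x\<close> applied to
  \<open>v\<close>. In this form the bound serves both as a majorant for differentiation in a
  parameter and as a Lipschitz constant with decay.\<close>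

lemma schwartz_derivative_decay:
  fixes f :: "'a::euclidean_space \<Rightarrow> complex"
  assumes "f \<in> schwartz"
  obtains C where "C \<ge> 0"
    "\<And>x v. norm (\<Sum>b\<in>Basis. (v \<bullet> b) *\<^sub>R dir_deriv b f x) \<le> C / (1 + norm x) ^ N * norm v"
proof -
  have "\<forall>b\<in>Basis. \<exists>C\<ge>0. \<forall>x. norm (dir_deriv b f x) \<le> C / (1 + norm x) ^ N"
    using schwartz_decay_div[OF schwartz_dir_deriv[OF assms]] by metis
  then obtain C where C: "\<And>b. b \<in> Basis \<Longrightarrow> C b \<ge> 0"
      "\<And>b x. b \<in> Basis \<Longrightarrow> norm (dir_deriv b f x) \<le> C b / (1 + norm x) ^ N"
    by metis
  have "norm (\<Sum>b\<in>Basis. (v \<bullet> b) *\<^sub>R dir_deriv b f x) \<le> sum C Basis / (1 + norm x) ^ N * norm v" for x v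
  proof -
    have "norm (\<Sum>b\<in>Basis. (v \<bullet> b) *\<^sub>R dir_deriv b f x) \<le> (\<Sum>b\<in>Basis. norm v * (C b / (1 + norm x) ^ N))"
    proof (rule sum_norm_le)
      fix b :: 'a assume "b \<in> Basis"
      then show "norm ((v \<bullet> b) *\<^sub>R dir_deriv b f x) \<le> norm v * (C b / (1 + norm x) ^ N)"
        unfolding norm_scaleR by (intro mult_mono C) (auto simp: Basis_le_norm)
    qed
    also have "\<dots> = sum C Basis / (1 + norm x) ^ N * norm v"
      by (simp add: sum_distrib_right sum_distrib_left sum_divide_distrib mult.commute)
    finally show ?thesis .
  qed
  moreover have "sum C Basis \<ge> 0"
    using C(1) by (simp add: sum_nonneg)
  ultimately show ?thesis using that by blast
qed

text \<open>Derivatives of products and compositions are sums of functions of the same kind. Only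
  the closure under addition is stable under \<open>dir_deriv\<close>, and this is the class to
  which coinduction applies.\<close>

inductive_set sum_span :: "('a \<Rightarrow> complex) set \<Rightarrow> ('a \<Rightarrow> complex) set" for X where
  base: "f \<in> X \<Longrightarrow> f \<in> sum_span X"
| zero: "(\<lambda>x. 0) \<in> sum_span X"
| add: "f \<in> sum_span X \<Longrightarrow> g \<in> sum_span X \<Longrightarrow> (\<lambda>x. f x + g x) \<in> sum_span X"

lemma sum_span_sum:
  "finite I \<Longrightarrow> (\<And>i. i \<in> I \<Longrightarrow> f i \<in> X) \<Longrightarrow> (\<lambda>x. \<Sum>i\<in>I. f i x) \<in> sum_span X"
  by (induction I rule: finite_induct) (simp_all add: sum_span.zero sum_span.add sum_span.base)

text \<open>Differentiability, decay and closure under derivatives pass to finite sums, so they are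
  checked on the generators alone, whose derivatives may leave \<open>X\<close> for its
  span.\<close>

lemma schwartz_coinduct_sum:
  fixes f :: "'a::euclidean_space \<Rightarrow> complex"
  assumes f: "f \<in> sum_span X"
    and diff: "\<And>g x. g \<in> X \<Longrightarrow> g differentiable (at x)"
    and decay: "\<And>g N. g \<in> X \<Longrightarrow> \<exists>C. \<forall>x. (1 + norm x) ^ N * norm (g x) \<le> C"
    and deriv: "\<And>g b. g \<in> X \<Longrightarrow> b \<in> Basis \<Longrightarrow> dir_deriv b g \<in> sum_span X"
  shows "f \<in> schwartz"
proof (rule schwartz_coinduct[OF f])
  show d: "h differentiable (at x)" if "h \<in> sum_span X" for h x
    using that by induction (simp_all add: diff)
  show "\<exists>C. \<forall>x. (1 + norm x) ^ N * norm (h x) \<le> C" if "h \<in> sum_span X" for h N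
    using that
  proof induction
    case (add f g)
    then obtain C D where C: "\<And>x. (1 + norm x) ^ N * norm (f x) \<le> C"
      and D: "\<And>x. (1 + norm x) ^ N * norm (g x) \<le> D" by metis
    have "(1 + norm x) ^ N * norm (f x + g x) \<le> C + D" for x
    proof -
      have "(1 + norm x) ^ N * norm (f x + g x) \<le> (1 + norm x) ^ N * (norm (f x) + norm (g x))"
        by (intro mult_left_mono norm_triangle_ineq) auto
      then show ?thesis using C[of x] D[of x] by (simp add: distrib_left)
    qed
    then show ?case by blast
  qed (use decay in auto)
  show "dir_deriv b h \<in> sum_span X" if "h \<in> sum_span X" and b: "b \<in> Basis" for h b
    using that(1)
  proof induction
    case zero
    show ?case by (simp add: dir_deriv_def sum_span.zero)
  next
    case (add f g)
    have "dir_deriv b (\<lambda>x. f x + g x) = (\<lambda>x. dir_deriv b f x + dir_deriv b g x)"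
    proof
      fix x
      have "((\<lambda>x. f x + g x) has_derivative
          (\<lambda>v. frechet_derivative f (at x) v + frechet_derivative g (at x) v)) (at x)"
        using add d by (intro derivative_intros frechet_derivative_worksI) auto
      then show "dir_deriv b (\<lambda>x. f x + g x) x = dir_deriv b f x + dir_deriv b g x"
        by (rule dir_deriv_eqI) (simp add: dir_deriv_def)
    qed
    then show ?case using add by (simp add: sum_span.add)
  qed (simp add: deriv b)
qed

lemma sum_span_schwartz:
  assumes "f \<in> sum_span schwartz" shows "f \<in> schwartz"
proof (rule schwartz_coinduct_sum[OF assms])
  show "\<exists>C. \<forall>x. (1 + norm x) ^ N * norm (g x) \<le> C" if "g \<in> schwartz" for g :: "'a \<Rightarrow> complex" and N
    by (rule schwartz_decay[OF that, of N]) blast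
qed (simp_all add: schwartz_differentiable schwartz_dir_deriv sum_span.base)

section \<open>Closure of the Schwartz space under algebraic operations and affine
  substitutions\<close>

lemma schwartz_0: "(\<lambda>x. 0) \<in> schwartz"
  by (rule sum_span_schwartz[OF sum_span.zero])

lemma schwartz_add: "f \<in> schwartz \<Longrightarrow> g \<in> schwartz \<Longrightarrow> (\<lambda>x. f x + g x) \<in> schwartz"
  by (rule sum_span_schwartz[OF sum_span.add[OF sum_span.base sum_span.base]])

lemma schwartz_sum: "(\<And>i. i \<in> I \<Longrightarrow> f i \<in> schwartz) \<Longrightarrow> (\<lambda>x. \<Sum>i\<in>I. f i x) \<in> schwartz"
  by (induction I rule: infinite_finite_induct) (auto intro: schwartz_0 schwartz_add)

text \<open>\<open>L\<close> is real-linear, so that complex scalar multiplication and conjugation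
  are both instances; it commutes with \<open>dir_deriv\<close> by the chain rule.\<close>

lemma schwartz_bounded_linear:
  fixes f :: "'a::euclidean_space \<Rightarrow> complex"
  assumes f: "f \<in> schwartz" and L: "bounded_linear L"
  shows "(\<lambda>x. L (f x)) \<in> schwartz"
proof (rule schwartz_coinduct)
  let ?X = "(\<lambda>f x. L (f x)) ` (schwartz :: ('a \<Rightarrow> complex) set)"
  show "(\<lambda>x. L (f x)) \<in> ?X" using f by blast
  have d: "((\<lambda>x. L (g x)) has_derivative (\<lambda>v. L (frechet_derivative g (at x) v))) (at x)"
    if "g \<in> schwartz" for g :: "'a \<Rightarrow> complex" and x
    using that by (intro bounded_linear.has_derivative[OF L] frechet_derivative_worksI schwartz_differentiable)
  show "h differentiable (at x)" if "h \<in> ?X" for h x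
    using that differentiableI[OF d] by auto
  show "\<exists>C. \<forall>x. (1 + norm x) ^ N * norm (h x) \<le> C" if h: "h \<in> ?X" for h N
  proof -
    obtain g where g: "h = (\<lambda>x. L (g x))" "g \<in> schwartz" using h by blast
    obtain C where C: "\<And>x. (1 + norm x) ^ N * norm (g x) \<le> C" using schwartz_decay[OF g(2), of N] by blast
    obtain K where K: "K > 0" "\<And>z. norm (L z) \<le> norm z * K" using bounded_linear.pos_bounded[OF L] by blast
    have "(1 + norm x) ^ N * norm (h x) \<le> (1 + norm x) ^ N * (norm (g x) * K)" for x
      unfolding g(1) by (intro mult_left_mono K) auto
    moreover have "(1 + norm x) ^ N * (norm (g x) * K) \<le> C * K" for x
      using mult_right_mono[OF C[of x], of K] K(1) by (simp add: mult.assoc)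
    ultimately show ?thesis using order_trans by blast
  qed
  show "dir_deriv c h \<in> ?X" if h: "h \<in> ?X" "c \<in> Basis" for h c
  proof -
    obtain g where g: "h = (\<lambda>x. L (g x))" "g \<in> schwartz" using h by blast
    have "dir_deriv c h = (\<lambda>x. L (dir_deriv c g x))"
      unfolding g(1) using dir_deriv_eq[OF d[OF g(2)]] by (auto simp: dir_deriv_def)
    then show ?thesis using g h schwartz_dir_deriv by blast
  qed
qed

lemma schwartz_cmult: "f \<in> schwartz \<Longrightarrow> (\<lambda>x. a * f x) \<in> schwartz"
  by (rule schwartz_bounded_linear[OF _ bounded_linear_mult_right])

lemma schwartz_cnj: "f \<in> schwartz \<Longrightarrow> (\<lambda>x. cnj (f x)) \<in> schwartz"
  by (rule schwartz_bounded_linear[OF _ bounded_linear_cnj])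

lemma schwartz_cmult_add:
  "f \<in> schwartz \<Longrightarrow> g \<in> schwartz \<Longrightarrow> (\<lambda>x. a * f x + b * g x) \<in> schwartz"
  by (intro schwartz_add schwartz_cmult)

lemma schwartz_diff: "f \<in> schwartz \<Longrightarrow> g \<in> schwartz \<Longrightarrow> (\<lambda>x. f x - g x) \<in> schwartz"
  using schwartz_cmult_add[of f g 1 "-1"] by simp

lemma dir_deriv_cmult:
  "f \<in> schwartz \<Longrightarrow> dir_deriv b (\<lambda>x. a * f x) = (\<lambda>x. a * dir_deriv b f x)"
proof
  fix x assume "f \<in> schwartz"
  then have "((\<lambda>x. a * f x) has_derivative (\<lambda>v. a * frechet_derivative f (at x) v)) (at x)"
    by (intro derivative_intros frechet_derivative_worksI schwartz_differentiable)
  then show "dir_deriv b (\<lambda>x. a * f x) x = a * dir_deriv b f x"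
    by (rule dir_deriv_eqI) (simp add: dir_deriv_def)
qed

lemma dir_deriv_mult:
  fixes f :: "'a::euclidean_space \<Rightarrow> complex"
  assumes "f differentiable (at x)" "g differentiable (at x)"
  shows "dir_deriv c (\<lambda>x. f x * g x) x = f x * dir_deriv c g x + dir_deriv c f x * g x"
proof -
  have "((\<lambda>x. f x * g x) has_derivative
      (\<lambda>v. f x * frechet_derivative g (at x) v + frechet_derivative f (at x) v * g x)) (at x)"
    using assms by (intro has_derivative_mult frechet_derivative_worksI)
  then show ?thesis by (rule dir_deriv_eqI) (simp add: dir_deriv_def)
qed

lemma schwartz_mult:
  fixes f :: "'a::euclidean_space \<Rightarrow> complex"
  assumes "f \<in> schwartz" "g \<in> schwartz"
  shows "(\<lambda>x. f x * g x) \<in> schwartz"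
proof (rule schwartz_coinduct_sum)
  let ?X = "{\<lambda>x. f x * g x |f g. f \<in> schwartz \<and> g \<in> (schwartz :: ('a \<Rightarrow> complex) set)}"
  show "(\<lambda>x. f x * g x) \<in> sum_span ?X"
    using assms by (intro sum_span.base) blast
  show "h differentiable (at x)" if "h \<in> ?X" for h x
    using that by (auto simp: schwartz_differentiable)
  show "\<exists>C. \<forall>x. (1 + norm x) ^ N * norm (h x) \<le> C" if h: "h \<in> ?X" for h N
  proof -
    obtain f g where fg: "h = (\<lambda>x. f x * g x)" "f \<in> schwartz" "g \<in> schwartz" using h by blast
    obtain C where C: "\<And>x. (1 + norm x) ^ N * norm (f x) \<le> C" "C \<ge> 0"
      using schwartz_decay[OF fg(2), of N] by blast
    obtain D where D: "\<And>x. norm (g x) \<le> D"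
      using schwartz_bounded[OF fg(3)] by blast
    have "(1 + norm x) ^ N * norm (h x) \<le> C * D" for x
      using mult_mono[OF C(1)[of x] D[of x] C(2)] by (simp add: fg(1) norm_mult mult.assoc)
    then show ?thesis by blast
  qed
  show "dir_deriv c h \<in> sum_span ?X" if h: "h \<in> ?X" and c: "c \<in> Basis" for h c
  proof -
    obtain f g where fg: "h = (\<lambda>x. f x * g x)" "f \<in> schwartz" "g \<in> schwartz" using h by blast
    have "dir_deriv c h = (\<lambda>x. f x * dir_deriv c g x + dir_deriv c f x * g x)"
      unfolding fg(1) by (intro HOL.ext dir_deriv_mult schwartz_differentiable fg)
    moreover have "(\<lambda>x. f x * dir_deriv c g x) \<in> ?X" "(\<lambda>x. dir_deriv c f x * g x) \<in> ?X"
      using fg(2,3) schwartz_dir_deriv c by blast+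
    ultimately show ?thesis by (simp only: sum_span.add sum_span.base)
  qed
qed

lemma dir_deriv_inner_mult:
  fixes f :: "'a::euclidean_space \<Rightarrow> complex"
  assumes "f differentiable (at x)"
  shows "dir_deriv c (\<lambda>x. of_real (x \<bullet> a) * f x) x = of_real (x \<bullet> a) * dir_deriv c f x + of_real (c \<bullet> a) * f x"
proof -
  have "((\<lambda>x. of_real (x \<bullet> a) * f x) has_derivative
      (\<lambda>v. of_real (x \<bullet> a) * frechet_derivative f (at x) v + of_real (v \<bullet> a) * f x)) (at x)"
    using assms by (intro has_derivative_mult frechet_derivative_worksI) (auto intro!: derivative_eq_intros)
  then show ?thesis by (rule dir_deriv_eqI) (simp add: dir_deriv_def)
qed

lemma schwartz_inner_mult:
  fixes f :: "'a::euclidean_space \<Rightarrow> complex"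
  assumes "f \<in> schwartz"
  shows "(\<lambda>x. of_real (x \<bullet> a) * f x) \<in> schwartz"
proof (rule schwartz_coinduct_sum)
  define m where "m f x = of_real (x \<bullet> a) * f x" for f :: "'a \<Rightarrow> complex" and x
  \<comment> \<open>The product rule produces a multiple of \<open>f\<close> without the linear
    factor, hence the Schwartz functions themselves join the class.\<close>
  let ?X = "m ` schwartz \<union> schwartz"
  show "(\<lambda>x. of_real (x \<bullet> a) * f x) \<in> sum_span ?X"
    using assms by (intro sum_span.base) (auto simp: m_def[abs_def])
  have "m f differentiable (at x)" if "f \<in> schwartz" for f x
  proof -
    have "(\<lambda>x. of_real (x \<bullet> a) :: complex) differentiable (at x)"
      by (rule differentiableI[of _ "\<lambda>v. of_real (v \<bullet> a)"]) (auto intro!: derivative_eq_intros)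
    then show ?thesis unfolding m_def using schwartz_differentiable[OF that] by (rule differentiable_mult)
  qed
  then show "h differentiable (at x)" if "h \<in> ?X" for h x
    using that by (auto simp: schwartz_differentiable)
  have "\<exists>C. \<forall>x. (1 + norm x) ^ N * norm (m f x) \<le> C" if f: "f \<in> schwartz" for f N
  proof -
    obtain C where C: "\<And>x. (1 + norm x) ^ Suc N * norm (f x) \<le> C"
      using schwartz_decay[OF f, of "Suc N"] by blast
    have "(1 + norm x) ^ N * norm (m f x) \<le> norm a * C" for x
    proof -
      have "\<bar>x \<bullet> a\<bar> \<le> (1 + norm x) * norm a"
        using Cauchy_Schwarz_ineq2[of x a] by (simp add: algebra_simps add_increasing)
      then have "(1 + norm x) ^ N * norm (m f x) \<le> (1 + norm x) ^ N * ((1 + norm x) * norm a * norm (f x))"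
        unfolding m_def norm_mult norm_of_real by (intro mult_left_mono mult_right_mono) auto
      also have "\<dots> = norm a * ((1 + norm x) ^ Suc N * norm (f x))"
        by (simp add: algebra_simps)
      also have "\<dots> \<le> norm a * C"
        by (intro mult_left_mono C) auto
      finally show ?thesis .
    qed
    then show ?thesis by blast
  qed
  then show "\<exists>C. \<forall>x. (1 + norm x) ^ N * norm (h x) \<le> C" if "h \<in> ?X" for h N
    using that schwartz_decay[of h N] by blast
  show "dir_deriv c h \<in> sum_span ?X" if h: "h \<in> ?X" and c: "c \<in> Basis" for h c
  proof (cases "h \<in> schwartz")
    case True
    then show ?thesis using c by (intro sum_span.base) (simp add: schwartz_dir_deriv)
  next
    case False
    then obtain f where f: "h = m f" "f \<in> schwartz" using h by blast
    have "dir_deriv c h = (\<lambda>x. m (dir_deriv c f) x + of_real (c \<bullet> a) * f x)"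
      unfolding f(1) m_def using f(2) by (intro HOL.ext dir_deriv_inner_mult schwartz_differentiable)
    moreover have "m (dir_deriv c f) \<in> ?X" "(\<lambda>x. of_real (c \<bullet> a) * f x) \<in> ?X"
      using f(2) schwartz_dir_deriv c schwartz_cmult by blast+
    ultimately show ?thesis by (simp only: sum_span.add sum_span.base)
  qed
qed

lemma has_derivative_comp_affine:
  fixes f :: "'b::euclidean_space \<Rightarrow> complex" and R :: "'a::euclidean_space \<Rightarrow> 'b"
  assumes "linear R" "f \<in> schwartz"
  shows "((\<lambda>x. f (R x + a)) has_derivative (\<lambda>v. \<Sum>b\<in>Basis. (R v \<bullet> b) *\<^sub>R dir_deriv b f (R x + a))) (at x)"
proof -
  have "((\<lambda>x. R x + a) has_derivative R) (at x)"
    using assms(1) by (auto intro!: derivative_eq_intros bounded_linear_imp_has_derivative linear_conv_bounded_linear[THEN iffD1])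
  from has_derivative_compose[OF this schwartz_has_derivative[OF assms(2)]] show ?thesis .
qed

text \<open>The lower bound on \<open>R\<close> gives
  \<open>1 + norm x \<le> L * (1 + norm (R x + a))\<close>, so decay survives the substitution. The
  chain rule produces the coefficients \<open>R b \<bullet> e\<close>, which is why the class
  carries a constant \<open>c\<close>.\<close>

lemma schwartz_comp_affine:
  fixes f :: "'b::euclidean_space \<Rightarrow> complex" and R :: "'a::euclidean_space \<Rightarrow> 'b"
  assumes f: "f \<in> schwartz" and R: "linear R" and K: "\<And>x. norm x \<le> K * norm (R x)"
  shows "(\<lambda>x. f (R x + a)) \<in> schwartz"
proof (rule schwartz_coinduct_sum)
  define m where "m c f x = c * f (R x + a)" for c and f :: "'b \<Rightarrow> complex" and x
  let ?X = "{m c f |c f. f \<in> schwartz}"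
  have "(\<lambda>x. f (R x + a)) = m 1 f" by (simp add: m_def fun_eq_iff)
  then show "(\<lambda>x. f (R x + a)) \<in> sum_span ?X"
    using f by (intro sum_span.base) blast
  have hd: "(m c f has_derivative (\<lambda>v. c * (\<Sum>b\<in>Basis. (R v \<bullet> b) *\<^sub>R dir_deriv b f (R x + a)))) (at x)"
    if "f \<in> schwartz" for c f x
    unfolding m_def[abs_def] by (intro has_derivative_mult_right has_derivative_comp_affine R that)
  show "h differentiable (at x)" if "h \<in> ?X" for h x
    using that differentiableI[OF hd] by auto
  show "\<exists>C. \<forall>x. (1 + norm x) ^ N * norm (h x) \<le> C" if h: "h \<in> ?X" for h N
  proof -
    obtain c f where cf: "h = m c f" "f \<in> schwartz" using h by blast
    define L where "L = 1 + \<bar>K\<bar> * (1 + norm a)"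
    have L: "1 + norm x \<le> L * (1 + norm (R x + a))" for x
    proof -
      have "norm (R x) \<le> norm (R x + a) + norm a"
        using norm_triangle_ineq4[of "R x + a" a] by simp
      then have "norm x \<le> \<bar>K\<bar> * (norm (R x + a) + norm a)"
        using order_trans[OF K[of x]] by (meson abs_ge_self abs_ge_zero mult_mono norm_ge_zero)
      also have "norm (R x + a) + norm a \<le> (1 + norm a) * (1 + norm (R x + a))"
        by (simp add: algebra_simps)
      finally have "norm x \<le> \<bar>K\<bar> * ((1 + norm a) * (1 + norm (R x + a)))"
        by (simp add: mult_left_mono)
      then have "1 + norm x \<le> 1 * (1 + norm (R x + a)) + \<bar>K\<bar> * ((1 + norm a) * (1 + norm (R x + a)))"
        by (intro add_mono) auto
      then show ?thesis by (simp add: L_def distrib_right mult.assoc)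
    qed
    obtain C where C: "\<And>x. (1 + norm x) ^ N * norm (f x) \<le> C"
      using schwartz_decay[OF cf(2), of N] by blast
    have "(1 + norm x) ^ N * norm (h x) \<le> norm c * (L ^ N * C)" for x
    proof -
      have "(1 + norm x) ^ N * norm (f (R x + a)) \<le> (L * (1 + norm (R x + a))) ^ N * norm (f (R x + a))"
        by (intro mult_right_mono power_mono L) auto
      also have "\<dots> = L ^ N * ((1 + norm (R x + a)) ^ N * norm (f (R x + a)))"
        by (simp add: power_mult_distrib)
      also have "\<dots> \<le> L ^ N * C"
        by (intro mult_left_mono C) (auto simp: L_def)
      finally have "norm c * ((1 + norm x) ^ N * norm (f (R x + a))) \<le> norm c * (L ^ N * C)"
        by (rule mult_left_mono) simp
      then show ?thesis by (simp add: cf(1) m_def norm_mult algebra_simps)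
    qed
    then show ?thesis by blast
  qed
  show "dir_deriv b h \<in> sum_span ?X" if h: "h \<in> ?X" "b \<in> Basis" for h b
  proof -
    obtain c f where cf: "h = m c f" "f \<in> schwartz" using h by blast
    have "dir_deriv b h = (\<lambda>x. \<Sum>e\<in>Basis. m (c * of_real (R b \<bullet> e)) (dir_deriv e f) x)"
      unfolding cf(1) using dir_deriv_eq[OF hd[OF cf(2)], of b c]
      by (simp add: m_def sum_distrib_left scaleR_conv_of_real mult_ac fun_eq_iff)
    moreover have "(\<lambda>x. \<Sum>e\<in>Basis. m (c * of_real (R b \<bullet> e)) (dir_deriv e f) x) \<in> sum_span ?X"
      using cf(2) schwartz_dir_deriv by (intro sum_span_sum) auto
    ultimately show ?thesis by simp
  qed
qed

lemma schwartz_scale: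
  fixes f :: "'a::euclidean_space \<Rightarrow> complex"
  assumes "f \<in> schwartz" "r \<noteq> 0"
  shows "(\<lambda>x. f (r *\<^sub>R x + a)) \<in> schwartz"
  by (rule schwartz_comp_affine[where K = "1 / \<bar>r\<bar>"]) (use assms in \<open>auto intro: linear_compose_scale_right\<close>)

lemma dir_deriv_scale:
  fixes f :: "'a::euclidean_space \<Rightarrow> complex"
  assumes "f \<in> schwartz"
  shows "dir_deriv b (\<lambda>x. f (r *\<^sub>R x + a)) = (\<lambda>x. of_real r * dir_deriv b f (r *\<^sub>R x + a))"
proof
  fix x
  have "dir_deriv b (\<lambda>x. f (r *\<^sub>R x + a)) x = (\<Sum>c\<in>Basis. ((r *\<^sub>R b) \<bullet> c) *\<^sub>R dir_deriv c f (r *\<^sub>R x + a))"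
    by (rule dir_deriv_eq, rule has_derivative_comp_affine) (use assms in \<open>auto intro: linear_compose_scale_right\<close>)
  also have "\<dots> = r *\<^sub>R (\<Sum>c\<in>Basis. (b \<bullet> c) *\<^sub>R dir_deriv c f (r *\<^sub>R x + a))"
    by (simp add: scaleR_sum_right)
  also have "(\<Sum>c\<in>Basis. (b \<bullet> c) *\<^sub>R dir_deriv c f (r *\<^sub>R x + a)) = dir_deriv b f (r *\<^sub>R x + a)"
    by (metis (no_types) assms dir_deriv_def frechet_derivative_sum_Basis schwartz_differentiable)
  finally show "dir_deriv b (\<lambda>x. f (r *\<^sub>R x + a)) x = of_real r * dir_deriv b f (r *\<^sub>R x + a)"
    by (simp add: scaleR_conv_of_real)
qed

section \<open>Integrals of Schwartz functions\<close>

lemma inverse_power_le_mult: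
  fixes a b k :: real
  assumes "0 < a" "0 < b" "a \<le> b * k"
  shows "1 / b ^ n \<le> k ^ n * (1 / a ^ n)"
proof -
  have "a ^ n \<le> b ^ n * k ^ n"
    using power_mono[OF assms(3), of n] assms(1) by (simp add: power_mult_distrib)
  then show ?thesis using assms by (simp add: divide_le_eq le_divide_eq mult.commute)
qed

text \<open>Comparison with the product over \<open>b\<close> of
  \<open>inverse (1 + (x \<bullet> b)\<^sup>2)\<close>, whose integral factorizes. Each coordinate
  uses one factor \<open>(1 + norm x)\<^sup>2\<close>, which explains the exponent
  \<open>2 * DIM('a)\<close>.\<close>

lemma integrable_inverse_power_norm:
  "integrable lborel (\<lambda>x::'a::euclidean_space. 1 / (1 + norm x) ^ (2 * DIM('a)))"
proof (rule Bochner_Integration.integrable_bound)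
  let ?f = "\<lambda>x::'a. \<Prod>b\<in>Basis. inverse (1 + (x \<bullet> b)\<^sup>2)"
  show "integrable lborel ?f"
  proof (rule integrableI_nonneg)
    have "integrable lborel (\<lambda>x::real. inverse (1 + x\<^sup>2))"
      using integrable_inverse_1_plus_square by (simp add: set_integrable_def)
    then have "(\<integral>\<^sup>+x. ennreal (inverse (1 + x\<^sup>2)) \<partial>(lborel :: real measure)) < \<infinity>"
      by (subst (asm) integrable_iff_bounded) auto
    then have "(\<Prod>b\<in>(Basis::'a set). (\<integral>\<^sup>+x. ennreal (inverse (1 + x\<^sup>2)) \<partial>(lborel :: real measure))) < \<infinity>"
      by (simp add: power_less_top_ennreal)
    then show "(\<integral>\<^sup>+x. ennreal (?f x) \<partial>lborel) < \<infinity>"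
      using nn_integral_lborel_prod[of "\<lambda>(b::'a) x. ennreal (inverse (1 + x\<^sup>2))"]
      by (simp add: prod_ennreal add_nonneg_nonneg)
  qed (auto intro!: prod_nonneg AE_I2)
  show "AE x in lborel. norm (1 / (1 + norm x) ^ (2 * DIM('a))) \<le> norm (?f x)"
  proof (rule AE_I2)
    fix x :: 'a
    have "1 / (1 + norm x) ^ (2 * DIM('a)) = (\<Prod>b\<in>(Basis::'a set). inverse ((1 + norm x)\<^sup>2))"
      by (simp add: power_mult divide_inverse power_inverse)
    also have "\<dots> \<le> ?f x"
    proof (intro prod_mono conjI le_imp_inverse_le)
      fix b :: 'a assume "b \<in> Basis"
      then have "\<bar>x \<bullet> b\<bar>\<^sup>2 \<le> norm x ^ 2"
        by (intro power_mono Basis_le_norm) auto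
      then show "1 + (x \<bullet> b)\<^sup>2 \<le> (1 + norm x)\<^sup>2"
        by (simp add: power2_sum add_increasing2)
    qed (auto simp: add_pos_nonneg)
    finally show "norm (1 / (1 + norm x) ^ (2 * DIM('a))) \<le> norm (?f x)"
      by (simp add: abs_prod)
  qed
qed auto

lemma schwartz_integrable:
  fixes f :: "'a::euclidean_space \<Rightarrow> complex"
  assumes "f \<in> schwartz"
  shows "integrable lborel f"
proof -
  obtain C where C: "C \<ge> 0" "\<And>x. norm (f x) \<le> C / (1 + norm x) ^ (2 * DIM('a))"
    using schwartz_decay_div[OF assms] by blast
  show ?thesis
  proof (rule Bochner_Integration.integrable_bound)
    show "integrable lborel (\<lambda>x::'a. C * (1 / (1 + norm x) ^ (2 * DIM('a))))"
      by (intro integrable_mult_right integrable_inverse_power_norm)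
    show "AE x in lborel. norm (f x) \<le> norm (C * (1 / (1 + norm x) ^ (2 * DIM('a))))"
      using C by (intro AE_I2) auto
  qed (use assms schwartz_measurable in auto)
qed

lemma integrable_bounded_mult:
  fixes f g :: "'a::euclidean_space \<Rightarrow> complex"
  assumes "g \<in> borel_measurable borel" "\<And>x. norm (g x) \<le> B" "integrable lborel f"
  shows "integrable lborel (\<lambda>x. g x * f x)"
proof (rule Bochner_Integration.integrable_bound)
  show "integrable lborel (\<lambda>x. B * norm (f x))"
    using assms(3) by auto
  have "norm (g x * f x) \<le> norm (B * norm (f x))" for x
    using assms(2)[of x] order_trans[OF norm_ge_zero assms(2)]
    by (auto simp: norm_mult abs_mult intro!: mult_right_mono)
  then show "AE x in lborel. norm (g x * f x) \<le> norm (B * norm (f x))" by auto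
qed (use assms in measurable)

lemma integrable_schwartz_mult:
  fixes f g :: "'a::euclidean_space \<Rightarrow> complex"
  assumes "g \<in> borel_measurable borel" "\<And>x. norm (g x) \<le> B" "f \<in> schwartz"
  shows "integrable lborel (\<lambda>x. g x * f x)"
  using assms by (intro integrable_bounded_mult schwartz_integrable)

lemma norm_integral_bounded_mult:
  fixes f g :: "'a::euclidean_space \<Rightarrow> complex"
  assumes "g \<in> borel_measurable borel" "\<And>x. norm (g x) \<le> B" "integrable lborel f"
  shows "norm (LINT x|lborel. g x * f x) \<le> B * (LINT x|lborel. norm (f x))"
proof -
  have "norm (LINT x|lborel. g x * f x) \<le> (LINT x|lborel. norm (g x * f x))"
    by (rule integral_norm_bound)
  also have "\<dots> \<le> (LINT x|lborel. B * norm (f x))"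
    using assms integrable_norm[OF integrable_bounded_mult[OF assms]]
    by (intro integral_mono) (auto simp: norm_mult intro!: mult_right_mono)
  finally show ?thesis by simp
qed

section \<open>Affine changes of variables and integrals depending on a parameter\<close>

lemma lborel_integral_affine:
  fixes f :: "'a::euclidean_space \<Rightarrow> 'b::{banach, second_countable_topology}"
  assumes [measurable]: "f \<in> borel_measurable borel" and "c \<noteq> 0"
  shows "(LINT x|lborel. f x) = \<bar>c\<bar> ^ DIM('a) *\<^sub>R (LINT x|lborel. f (t + c *\<^sub>R x))"
  by (subst lborel_affine[OF \<open>c \<noteq> 0\<close>, of t]) (simp add: integral_density integral_distr)

lemma lborel_integrable_affine:
  fixes f :: "'a::euclidean_space \<Rightarrow> 'b::{banach, second_countable_topology}"
  assumes f: "integrable lborel f" and "c \<noteq> 0"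
  shows "integrable lborel (\<lambda>x. f (t + c *\<^sub>R x))"
proof -
  have [measurable]: "f \<in> borel_measurable borel"
    using borel_measurable_integrable[OF f] by simp
  have "integrable lborel (\<lambda>x. \<bar>c\<bar> ^ DIM('a) *\<^sub>R f (t + c *\<^sub>R x))"
    using f by (subst (asm) lborel_affine[OF \<open>c \<noteq> 0\<close>, of t]) (simp add: integrable_density integrable_distr_eq)
  from integrable_scaleR_right[OF this, of "inverse (\<bar>c\<bar> ^ DIM('a))"] show ?thesis
    using \<open>c \<noteq> 0\<close> by simp
qed

lemma lborel_integral_translate:
  fixes f :: "'a::euclidean_space \<Rightarrow> 'b::{banach, second_countable_topology}"
  assumes "f \<in> borel_measurable borel"
  shows "(LINT x|lborel. f (x + t)) = (LINT x|lborel. f x)"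
  using lborel_integral_affine[OF assms, of 1 t] by (simp add: add.commute)

lemma lborel_integrable_translate:
  fixes f :: "'a::euclidean_space \<Rightarrow> 'b::{banach, second_countable_topology}"
  assumes "integrable lborel f"
  shows "integrable lborel (\<lambda>x. f (x + t))"
  using lborel_integrable_affine[OF assms, of 1 t] by (simp add: add.commute)

text \<open>Dominated convergence for the Frechet difference quotients along sequences tending to
  \<open>y0\<close>. The majorant \<open>w\<close> of the derivative on the unit ball around
  \<open>y0\<close> bounds these quotients by \<open>2 * w\<close>: one \<open>w\<close> comes from
  the mean value inequality, the other from the derivative at \<open>y0\<close>.\<close>

lemma has_derivative_integral_param:
  fixes f :: "'x \<Rightarrow> 'b::euclidean_space \<Rightarrow> complex"
  assumes int: "\<And>y. integrable M (\<lambda>x. f x y)"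
    and der: "\<And>x y. ((\<lambda>y. f x y) has_derivative f' x y) (at y)"
    and meas: "\<And>v. (\<lambda>x. f' x y0 v) \<in> borel_measurable M"
    and bnd: "\<And>x y v. dist y y0 < 1 \<Longrightarrow> norm (f' x y v) \<le> w x * norm v"
    and w: "integrable M w"
  shows "((\<lambda>y. LINT x|M. f x y) has_derivative (\<lambda>v. LINT x|M. f' x y0 v)) (at y0)"
proof -
  have w0: "w x \<ge> 0" for x
  proof -
    obtain b :: 'b where "norm b = 1" using norm_Basis nonempty_Basis by blast
    then show ?thesis using bnd[of y0 x b] norm_ge_zero[of "f' x y0 b"] by (simp del: norm_ge_zero)
  qed
  have lin: "linear (f' x y)" for x y
    using der has_derivative_linear by blast
  have int': "integrable M (\<lambda>x. f' x y0 v)" for v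
  proof (rule Bochner_Integration.integrable_bound)
    show "integrable M (\<lambda>x. w x * norm v)" using w by simp
    show "AE x in M. norm (f' x y0 v) \<le> norm (w x * norm v)"
      using bnd w0 by (intro AE_I2) (auto simp: abs_mult)
  qed (rule meas)
  have "linear (\<lambda>v. LINT x|M. f' x y0 v)"
    by (intro linearI) (simp_all add: linear_add[OF lin] linear_scale[OF lin] int')
  then have bl: "bounded_linear (\<lambda>v. LINT x|M. f' x y0 v)"
    by (simp add: linear_conv_bounded_linear)
  let ?q = "\<lambda>x y. (f x y - f x y0 - f' x y0 (y - y0)) /\<^sub>R norm (y - y0)"
  have lip: "norm (f x y - f x y0) \<le> w x * norm (y - y0)" if "dist y y0 < 1" for x y
  proof (rule differentiable_bound[of "ball y0 1" "f x" "f' x"])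
    show "(f x has_derivative f' x z) (at z within ball y0 1)" for z
      using der[of x z] by (rule has_derivative_at_withinI)
    show "onorm (f' x z) \<le> w x" if "z \<in> ball y0 1" for z
      using that bnd by (intro onorm_bound w0) (auto simp: dist_commute)
  qed (use that in \<open>auto simp: dist_commute\<close>)
  have qb: "norm (?q x y) \<le> 2 * w x" if "dist y y0 < 1" for x y
  proof (cases "y = y0")
    case False
    have "norm (f x y - f x y0 - f' x y0 (y - y0)) \<le> w x * norm (y - y0) + w x * norm (y - y0)"
      using norm_triangle_ineq4[of "f x y - f x y0" "f' x y0 (y - y0)"] lip[OF that, of x] bnd[of y0 x "y - y0"] by simp
    then have "norm (f x y - f x y0 - f' x y0 (y - y0)) / norm (y - y0) \<le> 2 * w x"
      using False by (simp add: divide_le_eq)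
    then show ?thesis by (simp add: divide_inverse mult.commute)
  qed (simp add: w0 linear_0[OF lin])
  have qlim: "((\<lambda>y. ?q x y) \<longlongrightarrow> 0) (at y0)" for x
    using der[of x y0] unfolding has_derivative_at_within by (simp add: algebra_simps)
  have qint: "integrable M (\<lambda>x. ?q x y)" for y
    using int int' by auto
  have "((\<lambda>y. LINT x|M. ?q x y) \<longlongrightarrow> 0) (at y0)"
    unfolding tendsto_at_iff_sequentially o_def
  proof (intro allI impI)
    fix X assume X: "\<forall>i. X i \<in> UNIV - {y0}" "X \<longlonglongrightarrow> y0"
    then obtain N where N: "\<And>n. n \<ge> N \<Longrightarrow> dist (X n) y0 < 1"
      by (metis lim_sequentially zero_less_one)
    have XN: "(\<lambda>n. X (n + N)) \<longlonglongrightarrow> y0"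
      using X(2) by (rule LIMSEQ_ignore_initial_segment)
    have "(\<lambda>n. LINT x|M. ?q x (X (n + N))) \<longlonglongrightarrow> (LINT x|M. 0)"
    proof (rule integral_dominated_convergence[where w = "\<lambda>x. 2 * w x"])
      show "AE x in M. (\<lambda>n. ?q x (X (n + N))) \<longlonglongrightarrow> 0"
        using qlim XN X(1) by (intro AE_I2) (force simp: tendsto_at_iff_sequentially o_def)
      show "(\<lambda>x. ?q x (X (n + N))) \<in> borel_measurable M" for n
        using qint by (rule borel_measurable_integrable)
      show "AE x in M. norm (?q x (X (n + N))) \<le> 2 * w x" for n
        using qb N by (intro AE_I2) auto
    qed (use w in auto)
    then show "(\<lambda>n. LINT x|M. ?q x (X n)) \<longlonglongrightarrow> 0"
      using LIMSEQ_offset[of "\<lambda>n. LINT x|M. ?q x (X n)" N 0] by simp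
  qed
  also have "(\<lambda>y. LINT x|M. ?q x y) =
      (\<lambda>y. ((LINT x|M. f x y) - (LINT x|M. f x y0) - (LINT x|M. f' x y0 (y - y0))) /\<^sub>R norm (y - y0))"
    using int int' by (intro HOL.ext) simp
  finally show ?thesis
    unfolding has_derivative_at_within using bl by simp
qed

text \<open>Convolution of \<open>g\<close> with the reflection of \<open>M\<close>, the transpose
  of convolution with \<open>M\<close>. Multipliers act on distributions by duality, so this is how
  they act on the function behind a distribution.\<close>

definition corr :: "('a::euclidean_space \<Rightarrow> complex) \<Rightarrow> ('a \<Rightarrow> complex) \<Rightarrow> 'a \<Rightarrow> complex" where
  "corr g M y = (LINT x|lborel. g x * M (x - y))"

text \<open>Peetre's inequality: a polynomial weight at \<open>x\<close> is exchanged for one at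
  \<open>x - y\<close> at the cost of a power of \<open>1 + norm y\<close>.\<close>

lemma one_plus_norm_shift:
  "1 + norm x \<le> (1 + norm (x - y)) * (1 + norm y)" for x y :: "'a::real_normed_vector"
proof -
  have "norm x \<le> norm (x - y) + norm y"
    using norm_triangle_ineq[of "x - y" y] by simp
  moreover have "0 \<le> norm (x - y) * norm y" by simp
  ultimately show ?thesis unfolding distrib_left distrib_right by linarith
qed

lemma schwartz_translate: "M \<in> schwartz \<Longrightarrow> (\<lambda>x. M (x - y)) \<in> schwartz"
  using schwartz_scale[of M 1 "- y"] by simp

lemma dir_deriv_translate: "M \<in> schwartz \<Longrightarrow> dir_deriv b (\<lambda>x. M (x - y)) = (\<lambda>x. dir_deriv b M (x - y))"
  using dir_deriv_scale[of M b 1 "- y"] by simp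

text \<open>All derivatives fall on the Schwartz kernel, so boundedness and measurability of
  \<open>g\<close> are enough. The sign comes from \<open>y\<close> entering through
  \<open>x - y\<close>.\<close>

lemma corr_has_derivative:
  fixes g M :: "'a::euclidean_space \<Rightarrow> complex"
  assumes g [measurable]: "g \<in> borel_measurable borel" and B: "\<And>x. norm (g x) \<le> B" and M: "M \<in> schwartz"
  shows "(corr g M has_derivative (\<lambda>v. - (\<Sum>b\<in>Basis. (v \<bullet> b) *\<^sub>R corr g (dir_deriv b M) y))) (at y)"
proof -
  have B0: "B \<ge> 0" using B[of 0] norm_ge_zero order_trans by blast
  obtain C where C: "C \<ge> 0"
    "\<And>x v. norm (\<Sum>b\<in>Basis. (v \<bullet> b) *\<^sub>R dir_deriv b M x) \<le> C / (1 + norm x) ^ (2 * DIM('a)) * norm v"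
    using schwartz_derivative_decay[OF M] by blast
  have [measurable]: "dir_deriv b M \<in> borel_measurable borel" if "b \<in> Basis" for b
    using schwartz_measurable schwartz_dir_deriv M that by blast
  \<comment> \<open>For \<open>z\<close> within distance \<open>1\<close> of \<open>y\<close>,
    Peetre's inequality costs a factor \<open>2\<close> in the base of the weight, hence
    \<open>2 ^ (2 * DIM('a))\<close>.\<close>
  define w where "w x = B * C * 2 ^ (2 * DIM('a)) * (1 / (1 + norm (x - y)) ^ (2 * DIM('a)))" for x :: 'a
  let ?f' = "\<lambda>x z v. g x * (\<Sum>b\<in>Basis. (- v \<bullet> b) *\<^sub>R dir_deriv b M (x - z))"
  have "((\<lambda>z. LINT x|lborel. g x * M (x - z)) has_derivative (\<lambda>v. LINT x|lborel. ?f' x y v)) (at y)"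
  proof (rule has_derivative_integral_param[where w = w])
    show "integrable lborel (\<lambda>x. g x * M (x - z))" for z
      using g B by (rule integrable_schwartz_mult) (rule schwartz_translate[OF M])
    show "((\<lambda>z. g x * M (x - z)) has_derivative ?f' x z) (at z)" for x z
    proof -
      have "((\<lambda>z. x - z) has_derivative (\<lambda>v. - v)) (at z)"
        by (auto intro!: derivative_eq_intros)
      from has_derivative_compose[OF this schwartz_has_derivative[OF M]]
      show ?thesis by (rule has_derivative_mult_right)
    qed
    show "(\<lambda>x. ?f' x y v) \<in> borel_measurable lborel" for v by measurable
    show "integrable lborel w"
      unfolding w_def using lborel_integrable_translate[OF integrable_inverse_power_norm, of "- y"]
      by (intro integrable_mult_right) simp
    show "norm (?f' x z v) \<le> w x * norm v" if z: "dist z y < 1" for x z v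
    proof -
      have "1 + norm (x - y) \<le> (1 + norm ((x - y) - (z - y))) * (1 + norm (z - y))"
        by (rule one_plus_norm_shift)
      also have "\<dots> \<le> (1 + norm (x - z)) * 2"
        using z by (intro mult_mono) (auto simp: dist_norm)
      finally have *: "1 / (1 + norm (x - z)) ^ (2 * DIM('a)) \<le> 2 ^ (2 * DIM('a)) * (1 / (1 + norm (x - y)) ^ (2 * DIM('a)))"
        by (intro inverse_power_le_mult) auto
      have "norm (?f' x z v) \<le> B * (C / (1 + norm (x - z)) ^ (2 * DIM('a)) * norm (- v))"
        unfolding norm_mult by (intro mult_mono B C B0) auto
      also have "\<dots> = B * C * (1 / (1 + norm (x - z)) ^ (2 * DIM('a))) * norm v" by simp
      also have "\<dots> \<le> B * C * (2 ^ (2 * DIM('a)) * (1 / (1 + norm (x - y)) ^ (2 * DIM('a)))) * norm v"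
        by (intro mult_right_mono mult_left_mono * mult_nonneg_nonneg B0 C) auto
      finally show ?thesis by (simp add: w_def mult.assoc)
    qed
  qed
  moreover have "(LINT x|lborel. ?f' x y v) = - (\<Sum>b\<in>Basis. (v \<bullet> b) *\<^sub>R corr g (dir_deriv b M) y)" for v
  proof -
    have i: "integrable lborel (\<lambda>x. g x * dir_deriv b M (x - y))" if "b \<in> Basis" for b
      using g B by (rule integrable_schwartz_mult) (intro schwartz_translate schwartz_dir_deriv M that)
    have "(LINT x|lborel. ?f' x y v) = (LINT x|lborel. (\<Sum>b\<in>Basis. (- v \<bullet> b) *\<^sub>R (g x * dir_deriv b M (x - y))))"
      by (simp add: sum_distrib_left)
    also have "\<dots> = (\<Sum>b\<in>Basis. (- v \<bullet> b) *\<^sub>R corr g (dir_deriv b M) y)"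
      using i by (subst Bochner_Integration.integral_sum) (auto simp: corr_def)
    finally show ?thesis by (simp add: sum_negf)
  qed
  ultimately show ?thesis unfolding corr_def[abs_def] by simp
qed

lemma corr_continuous:
  assumes "g \<in> borel_measurable borel" "\<And>x. norm (g x) \<le> B" "M \<in> schwartz"
  shows "continuous_on UNIV (corr g M)"
  using corr_has_derivative[OF assms] has_derivative_continuous continuous_at_imp_continuous_on by blast

lemma corr_bound:
  assumes "g \<in> borel_measurable borel" "\<And>x. norm (g x) \<le> B" "M \<in> schwartz"
  shows "norm (corr g M y) \<le> B * (LINT x|lborel. norm (M x))"
proof -
  have "norm (corr g M y) \<le> B * (LINT x|lborel. norm (M (x - y)))"
    unfolding corr_def using assms
    by (intro norm_integral_bounded_mult schwartz_integrable schwartz_translate)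
  also have "(LINT x|lborel. norm (M (x - y))) = (LINT x|lborel. norm (M x))"
    using lborel_integral_translate[of "\<lambda>x. norm (M x)" "- y"] schwartz_measurable[OF assms(3)] by simp
  finally show ?thesis .
qed

section \<open>Integration by parts in a coordinate direction\<close>

lemma has_vector_derivative_at_limit:
  "(f has_vector_derivative D) (at (0::real)) \<Longrightarrow> ((\<lambda>h. (f h - f 0) /\<^sub>R h) \<longlongrightarrow> D) (at 0)"
proof -
  assume "(f has_vector_derivative D) (at 0)"
  then have "((\<lambda>h. norm ((f h - f 0 - h *\<^sub>R D) /\<^sub>R \<bar>h\<bar>)) \<longlongrightarrow> 0) (at 0)"
    unfolding has_vector_derivative_def has_derivative_at_within
    by (intro tendsto_norm_zero) simp
  also have "(\<lambda>h. norm ((f h - f 0 - h *\<^sub>R D) /\<^sub>R \<bar>h\<bar>)) = (\<lambda>h. norm ((f h - f 0 - h *\<^sub>R D) /\<^sub>R h))"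
    by simp
  finally have "((\<lambda>h. (f h - f 0 - h *\<^sub>R D) /\<^sub>R h) \<longlongrightarrow> 0) (at 0)"
    by (rule tendsto_norm_zero_cancel)
  moreover have "\<forall>\<^sub>F h in at 0. (f h - f 0 - h *\<^sub>R D) /\<^sub>R h + D = (f h - f 0) /\<^sub>R h"
    using eventually_neq_at_within[of 0] by eventually_elim (simp add: scaleR_diff_right)
  ultimately show ?thesis
    using tendsto_add[of _ 0 "at 0" "\<lambda>_. D" D] by (simp add: tendsto_cong[symmetric])
qed

text \<open>The integral of a difference quotient of \<open>F \<psi>\<close> vanishes by translation invariance, so that
  dominated convergence replaces Fubini's theorem here.\<close>

lemma integration_by_parts_schwartz:
  fixes F F' \<psi> :: "'a::euclidean_space \<Rightarrow> complex"
  assumes [measurable]: "F \<in> borel_measurable borel" "F' \<in> borel_measurable borel"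
    and B: "\<And>x. norm (F x) \<le> B" and B': "\<And>x. norm (F' x) \<le> B'"
    and der: "\<And>x. ((\<lambda>t. F (x + t *\<^sub>R b)) has_vector_derivative F' x) (at 0)"
    and psi: "\<psi> \<in> schwartz" and b: "b \<in> Basis"
  shows "(LINT x|lborel. F x * dir_deriv b \<psi> x) = - (LINT x|lborel. F' x * \<psi> x)"
proof -
  let ?N = "2 * DIM('a)"
  note [measurable] = schwartz_measurable[OF psi] schwartz_measurable[OF schwartz_dir_deriv[OF psi b]]
  have B0: "B \<ge> 0" "B' \<ge> 0" using B[of 0] B'[of 0] norm_ge_zero order_trans by blast+
  define H where "H x = F x * \<psi> x" for x
  define H' where "H' x = F x * dir_deriv b \<psi> x + F' x * \<psi> x" for x
  have [measurable]: "H \<in> borel_measurable borel" "H' \<in> borel_measurable borel"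
    unfolding H_def[abs_def] H'_def[abs_def] by measurable
  obtain C where C: "C \<ge> 0" "\<And>x. norm (\<psi> x) \<le> C / (1 + norm x) ^ ?N"
    using schwartz_decay_div[OF psi] by blast
  obtain D where D: "D \<ge> 0" "\<And>x. norm (dir_deriv b \<psi> x) \<le> D / (1 + norm x) ^ ?N"
    using schwartz_decay_div[OF schwartz_dir_deriv[OF psi b]] by blast
  have dpsi: "((\<lambda>t. \<psi> (x + t *\<^sub>R b)) has_vector_derivative dir_deriv b \<psi> x) (at 0)" for x
  proof -
    have "((\<lambda>t. x + t *\<^sub>R b) has_derivative (\<lambda>t. t *\<^sub>R b)) (at 0)"
      by (auto intro!: derivative_eq_intros)
    then have "((\<lambda>t. \<psi> (x + t *\<^sub>R b)) has_derivative (\<lambda>t. frechet_derivative \<psi> (at x) (t *\<^sub>R b))) (at 0)"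
      using has_derivative_compose[of "\<lambda>t. x + t *\<^sub>R b" _ 0 UNIV \<psi>]
        frechet_derivative_worksI[OF schwartz_differentiable[OF psi]] by auto
    then show ?thesis
      unfolding has_vector_derivative_def dir_deriv_def
      by (simp add: linear_scale[OF linear_frechet_derivative[OF schwartz_differentiable[OF psi]]])
  qed
  \<comment> \<open>The hypothesis gives a derivative at the parameter \<open>0\<close> for every
    base point; moving the base point yields the derivative along the whole line, as the mean value
    inequality below requires.\<close>
  have dH: "((\<lambda>t. H (x + t *\<^sub>R b)) has_vector_derivative H' (x + s *\<^sub>R b)) (at s)" for x s
  proof -
    have "((\<lambda>t. H ((x + s *\<^sub>R b) + t *\<^sub>R b)) has_vector_derivative H' (x + s *\<^sub>R b)) (at (s - s))"
      unfolding H_def H'_def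
      using has_vector_derivative_mult[OF der[of "x + s *\<^sub>R b"] dpsi[of "x + s *\<^sub>R b"]] by simp
    moreover have "((\<lambda>t. t - s) has_vector_derivative 1) (at s)"
      by (auto intro!: derivative_eq_intros)
    ultimately show ?thesis
      using vector_diff_chain_at[of "\<lambda>t. t - s" 1 s "\<lambda>t. H ((x + s *\<^sub>R b) + t *\<^sub>R b)"]
      by (simp add: o_def scaleR_diff_left)
  qed
  have H'b: "norm (H' x) \<le> (B * D + B' * C) / (1 + norm x) ^ ?N" for x
  proof -
    have "norm (H' x) \<le> B * (D / (1 + norm x) ^ ?N) + B' * (C / (1 + norm x) ^ ?N)"
      unfolding H'_def
      by (rule order_trans[OF norm_triangle_ineq], unfold norm_mult)
        (intro add_mono mult_mono B B' C D B0 norm_ge_zero)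
    then show ?thesis by (simp add: add_divide_distrib)
  qed
  define q where "q n x = (H (x + inverse (real (Suc n)) *\<^sub>R b) - H x) /\<^sub>R inverse (real (Suc n))" for n x
  have Hint: "integrable lborel H"
    unfolding H_def[abs_def] by (rule integrable_schwartz_mult[OF _ B psi]) measurable
  have q0: "(LINT x|lborel. q n x) = 0" for n
    unfolding q_def using lborel_integrable_translate[OF Hint] Hint
    by (simp add: lborel_integral_translate)
  let ?w = "\<lambda>x::'a. (B * D + B' * C) * 2 ^ ?N * (1 / (1 + norm x) ^ ?N)"
  have "(\<lambda>n. LINT x|lborel. q n x) \<longlonglongrightarrow> (LINT x|lborel. H' x)"
  proof (rule integral_dominated_convergence[where w = ?w])
    show "integrable lborel ?w"
      by (intro integrable_mult_right integrable_inverse_power_norm)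
    show "q n \<in> borel_measurable lborel" for n
      unfolding q_def[abs_def] by measurable
    show "AE x in lborel. (\<lambda>n. q n x) \<longlonglongrightarrow> H' x"
    proof (rule AE_I2)
      fix x
      have "((\<lambda>h. (H (x + h *\<^sub>R b) - H x) /\<^sub>R h) \<longlongrightarrow> H' x) (at 0)"
        using has_vector_derivative_at_limit[OF dH[of x 0]] by simp
      then show "(\<lambda>n. q n x) \<longlonglongrightarrow> H' x"
        unfolding q_def tendsto_at_iff_sequentially o_def
        by (drule_tac spec[of _ "\<lambda>n. inverse (real (Suc n))"]) (use LIMSEQ_inverse_real_of_nat in simp)
    qed
    show "AE x in lborel. norm (q n x) \<le> ?w x" for n
    proof (rule AE_I2)
      fix x
      let ?h = "inverse (real (Suc n))"
      have h: "0 < ?h" "?h \<le> 1" by (auto simp: inverse_le_1_iff)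
      have "norm (H (x + ?h *\<^sub>R b) - H (x + 0 *\<^sub>R b)) \<le> ?w x * norm (?h - 0)"
      proof (rule differentiable_bound[of "{0..?h}" _ "\<lambda>s v. v *\<^sub>R H' (x + s *\<^sub>R b)"])
        show "((\<lambda>t. H (x + t *\<^sub>R b)) has_derivative (\<lambda>v. v *\<^sub>R H' (x + s *\<^sub>R b))) (at s within {0..?h})" for s
          using dH[of x s] unfolding has_vector_derivative_def by (rule has_derivative_at_withinI)
        fix s assume s: "s \<in> {0..?h}"
        have "1 + norm x \<le> (1 + norm (x - (- s *\<^sub>R b))) * (1 + norm (- s *\<^sub>R b))"
          by (rule one_plus_norm_shift)
        also have "\<dots> \<le> (1 + norm (x + s *\<^sub>R b)) * 2"
          using s h b by (intro mult_mono) auto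
        finally have *: "1 / (1 + norm (x + s *\<^sub>R b)) ^ ?N \<le> 2 ^ ?N * (1 / (1 + norm x) ^ ?N)"
          by (intro inverse_power_le_mult) auto
        have "norm (H' (x + s *\<^sub>R b)) \<le> (B * D + B' * C) * (1 / (1 + norm (x + s *\<^sub>R b)) ^ ?N)"
          using H'b[of "x + s *\<^sub>R b"] by simp
        also have "\<dots> \<le> (B * D + B' * C) * (2 ^ ?N * (1 / (1 + norm x) ^ ?N))"
          using B0 C(1) D(1) by (intro mult_left_mono *) auto
        finally have "norm (H' (x + s *\<^sub>R b)) \<le> ?w x" by (simp add: mult.assoc)
        then show "onorm (\<lambda>v. v *\<^sub>R H' (x + s *\<^sub>R b)) \<le> ?w x"
          by (intro onorm_le) (unfold norm_scaleR real_norm_def, subst mult.commute, rule mult_right_mono, auto)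
      qed (use h in auto)
      then have "norm (H (x + ?h *\<^sub>R b) - H x) \<le> ?w x * ?h"
        using h(1) by simp
      then have "norm (H (x + ?h *\<^sub>R b) - H x) / ?h \<le> ?w x"
        using h(1) by (simp only: pos_divide_le_eq)
      moreover have "norm (q n x) = norm (H (x + ?h *\<^sub>R b) - H x) / ?h"
        unfolding q_def norm_scaleR by (simp add: divide_inverse mult.commute)
      ultimately show "norm (q n x) \<le> ?w x" by (simp only:)
    qed
  qed measurable
  then have "(LINT x|lborel. H' x) = 0"
    using q0 by (simp add: LIMSEQ_const_iff)
  moreover have "(LINT x|lborel. H' x) = (LINT x|lborel. F x * dir_deriv b \<psi> x) + (LINT x|lborel. F' x * \<psi> x)"
    unfolding H'_def
    by (intro Bochner_Integration.integral_add integrable_schwartz_mult[OF _ B] integrable_schwartz_mult[OF _ B'])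
      (auto intro: psi schwartz_dir_deriv b)
  ultimately show ?thesis by (simp add: eq_neg_iff_add_eq_0)
qed

section \<open>The Fourier transform on the Schwartz space\<close>

lemma norm_exp_minus_i [simp]: "norm (exp (- (\<i> * complex_of_real t))) = 1"
  using norm_exp_i_times[of "- t"] by simp

lemma fourier_eq:
  "fourier \<psi> \<xi> = of_real ((2 * pi) powr (- real DIM('a) / 2)) *
     (LINT x|lborel. exp (- (\<i> * of_real (x \<bullet> \<xi>))) * \<psi> x)" for \<psi> :: "'a::euclidean_space \<Rightarrow> complex"
  by (simp add: fourier_def)

lemma inv_fourier_eq: "inv_fourier \<psi> \<xi> = fourier \<psi> (- \<xi>)"
  by (simp add: inv_fourier_def fourier_def inner_commute)

lemma fourier_cmult: "fourier (\<lambda>x. a * \<psi> x) \<xi> = a * fourier \<psi> \<xi>"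
proof -
  have "(LINT x|lborel. exp (- (\<i> * of_real (x \<bullet> \<xi>))) * (a * \<psi> x))
    = (LINT x|lborel. a * (exp (- (\<i> * of_real (x \<bullet> \<xi>))) * \<psi> x))"
    by (intro Bochner_Integration.integral_cong) auto
  then show ?thesis by (simp add: fourier_eq)
qed

lemma fourier_bound:
  fixes \<psi> :: "'a::euclidean_space \<Rightarrow> complex"
  assumes "\<psi> \<in> schwartz"
  shows "norm (fourier \<psi> \<xi>) \<le> (2 * pi) powr (- real DIM('a) / 2) * (LINT x|lborel. norm (\<psi> x))"
proof -
  have "norm (LINT x|lborel. exp (- (\<i> * of_real (x \<bullet> \<xi>))) * \<psi> x) \<le> 1 * (LINT x|lborel. norm (\<psi> x))"
    using assms by (intro norm_integral_bounded_mult schwartz_integrable) auto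
  then show ?thesis
    by (simp add: fourier_eq norm_mult mult_left_mono)
qed

lemma schwartz_norm_power_integrable:
  fixes \<psi> :: "'a::euclidean_space \<Rightarrow> complex"
  assumes "\<psi> \<in> schwartz"
  shows "integrable lborel (\<lambda>x. (1 + norm x) ^ N * norm (\<psi> x))"
proof -
  obtain C where C: "C \<ge> 0" "\<And>x. norm (\<psi> x) \<le> C / (1 + norm x) ^ (N + 2 * DIM('a))"
    using schwartz_decay_div[OF assms] by blast
  show ?thesis
  proof (rule Bochner_Integration.integrable_bound)
    show "integrable lborel (\<lambda>x::'a. C * (1 / (1 + norm x) ^ (2 * DIM('a))))"
      by (intro integrable_mult_right integrable_inverse_power_norm)
    have "norm ((1 + norm x) ^ N * norm (\<psi> x)) \<le> norm (C * (1 / (1 + norm x) ^ (2 * DIM('a))))" for x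
    proof -
      have "(1 + norm x) ^ N * norm (\<psi> x) \<le> (1 + norm x) ^ N * (C / (1 + norm x) ^ (N + 2 * DIM('a)))"
        by (intro mult_left_mono C) auto
      also have "\<dots> = C * (1 / (1 + norm x) ^ (2 * DIM('a)))"
        by (simp add: power_add)
      finally show ?thesis using C(1) by (simp add: abs_mult)
    qed
    then show "AE x in lborel. norm ((1 + norm x) ^ N * norm (\<psi> x)) \<le> norm (C * (1 / (1 + norm x) ^ (2 * DIM('a))))"
      by auto
    show "(\<lambda>x. (1 + norm x) ^ N * norm (\<psi> x)) \<in> borel_measurable lborel"
      using schwartz_measurable[OF assms] by measurable
  qed
qed

lemma has_derivative_exp_i:
  assumes "(f has_derivative f') (at x)"
  shows "((\<lambda>x. exp (- (\<i> * complex_of_real (f x)))) has_derivative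
    (\<lambda>v. exp (- (\<i> * of_real (f x))) * - (\<i> * of_real (f' v)))) (at x)"
proof -
  have "((\<lambda>x. - (\<i> * complex_of_real (f x))) has_derivative (\<lambda>v. - (\<i> * of_real (f' v)))) (at x)"
    using assms by (auto intro!: derivative_eq_intros)
  from has_derivative_compose[OF this DERIV_exp[unfolded has_field_derivative_def]] show ?thesis .
qed

lemma fourier_has_derivative:
  fixes \<psi> :: "'a::euclidean_space \<Rightarrow> complex"
  assumes psi: "\<psi> \<in> schwartz"
  shows "(fourier \<psi> has_derivative (\<lambda>v. fourier (\<lambda>x. of_real (x \<bullet> v) * (- \<i> * \<psi> x)) \<xi>)) (at \<xi>)"
proof -
  note [measurable] = schwartz_measurable[OF psi]
  let ?f' = "\<lambda>x \<xi> v. exp (- (\<i> * complex_of_real (x \<bullet> \<xi>))) * (of_real (x \<bullet> v) * (- \<i> * \<psi> x))"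
  have "((\<lambda>\<xi>. LINT x|lborel. exp (- (\<i> * of_real (x \<bullet> \<xi>))) * \<psi> x) has_derivative (\<lambda>v. LINT x|lborel. ?f' x \<xi> v)) (at \<xi>)"
  proof (rule has_derivative_integral_param[where w = "\<lambda>x. (1 + norm x) ^ 1 * norm (\<psi> x)"])
    show "integrable lborel (\<lambda>x. exp (- (\<i> * of_real (x \<bullet> \<xi>))) * \<psi> x)" for \<xi>
      by (rule integrable_schwartz_mult[where B = 1]) (auto simp: psi)
    show "integrable lborel (\<lambda>x. (1 + norm x) ^ 1 * norm (\<psi> x))"
      by (rule schwartz_norm_power_integrable[OF psi])
    show "((\<lambda>\<xi>. exp (- (\<i> * of_real (x \<bullet> \<xi>))) * \<psi> x) has_derivative ?f' x \<xi>) (at \<xi>)" for x \<xi>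
    proof -
      have "((\<lambda>\<xi>. x \<bullet> \<xi>) has_derivative (\<lambda>v. x \<bullet> v)) (at \<xi>)"
        by (auto intro!: derivative_eq_intros)
      from has_derivative_mult_left[OF has_derivative_exp_i[OF this], of "\<psi> x"] show ?thesis
        by (simp add: mult_ac)
    qed
    show "norm (?f' x \<xi> v) \<le> (1 + norm x) ^ 1 * norm (\<psi> x) * norm v" for x \<xi> v
    proof -
      have "norm (?f' x \<xi> v) = \<bar>x \<bullet> v\<bar> * norm (\<psi> x)"
        by (simp add: norm_mult)
      also have "\<dots> \<le> ((1 + norm x) * norm v) * norm (\<psi> x)"
        using Cauchy_Schwarz_ineq2[of x v] by (intro mult_right_mono) (auto simp: distrib_right intro: order_trans)
      finally show ?thesis by (simp add: mult_ac)
    qed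
  qed measurable
  from has_derivative_mult_right[OF this, of "of_real ((2 * pi) powr (- real DIM('a) / 2))"] show ?thesis
    unfolding fourier_eq[abs_def] by simp
qed

lemma dir_deriv_fourier:
  "\<psi> \<in> schwartz \<Longrightarrow> dir_deriv b (fourier \<psi>) = fourier (\<lambda>x. of_real (x \<bullet> b) * (- \<i> * \<psi> x))"
  by (rule HOL.ext, rule dir_deriv_eqI[OF fourier_has_derivative]) auto

text \<open>Integration by parts against the character
  \<open>x \<mapsto> exp (- \<i> * (x \<bullet> \<xi>))\<close>, which is bounded together with its
  derivative.\<close>

lemma inner_fourier:
  fixes \<psi> :: "'a::euclidean_space \<Rightarrow> complex"
  assumes psi: "\<psi> \<in> schwartz" and b: "b \<in> Basis"
  shows "of_real (\<xi> \<bullet> b) * fourier \<psi> \<xi> = fourier (\<lambda>x. - \<i> * dir_deriv b \<psi> x) \<xi>"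
proof -
  let ?F = "\<lambda>x. exp (- (\<i> * complex_of_real (x \<bullet> \<xi>)))"
  have "(LINT x|lborel. ?F x * dir_deriv b \<psi> x) = - (LINT x|lborel. (- \<i> * of_real (\<xi> \<bullet> b) * ?F x) * \<psi> x)"
  proof (rule integration_by_parts_schwartz[OF _ _ _ _ _ psi b])
    show "norm (?F x) \<le> 1" "norm (- \<i> * of_real (\<xi> \<bullet> b) * ?F x) \<le> \<bar>\<xi> \<bullet> b\<bar>" for x
      by (simp_all add: norm_mult)
    show "((\<lambda>t. ?F (x + t *\<^sub>R b)) has_vector_derivative - \<i> * of_real (\<xi> \<bullet> b) * ?F x) (at 0)" for x
    proof -
      have "((\<lambda>t. (x + t *\<^sub>R b) \<bullet> \<xi>) has_derivative (\<lambda>t. t * (\<xi> \<bullet> b))) (at 0)"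
        by (auto intro!: derivative_eq_intros simp: inner_commute[of b])
      from has_derivative_exp_i[OF this] show ?thesis
        unfolding has_vector_derivative_def by (simp add: scaleR_conv_of_real mult_ac)
    qed
  qed measurable
  then have "(LINT x|lborel. ?F x * dir_deriv b \<psi> x) = \<i> * of_real (\<xi> \<bullet> b) * (LINT x|lborel. ?F x * \<psi> x)"
    by (simp add: mult.assoc)
  then have "fourier (dir_deriv b \<psi>) \<xi> = \<i> * of_real (\<xi> \<bullet> b) * fourier \<psi> \<xi>"
    by (simp add: fourier_eq)
  moreover have "fourier (\<lambda>x. - \<i> * dir_deriv b \<psi> x) \<xi> = - \<i> * fourier (dir_deriv b \<psi>) \<xi>"
    by (rule fourier_cmult)
  ultimately show ?thesis by (simp add: mult.assoc)
qed

text \<open>Induction on \<open>N\<close> for all \<open>\<psi>\<close> at once: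
  \<open>norm \<xi>\<close> is at most the sum of the \<open>\<bar>\<xi> \<bullet> b\<bar>\<close>,
  and each factor \<open>\<xi> \<bullet> b\<close> is absorbed by passing from \<open>\<psi>\<close>
  to one of its derivatives.\<close>

lemma fourier_decay:
  fixes \<psi> :: "'a::euclidean_space \<Rightarrow> complex"
  assumes "\<psi> \<in> schwartz"
  shows "\<exists>C. \<forall>\<xi>. (1 + norm \<xi>) ^ N * norm (fourier \<psi> \<xi>) \<le> C"
  using assms
proof (induction N arbitrary: \<psi>)
  case 0
  then show ?case using fourier_bound[OF 0] by auto
next
  case (Suc N)
  have "\<forall>b\<in>Basis. \<exists>C. \<forall>\<xi>. (1 + norm \<xi>) ^ N * norm (fourier (\<lambda>x. - \<i> * dir_deriv b \<psi> x) \<xi>) \<le> C"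
    by (intro ballI Suc.IH schwartz_cmult schwartz_dir_deriv Suc.prems)
  then obtain C where C: "\<And>b \<xi>. b \<in> Basis \<Longrightarrow> (1 + norm \<xi>) ^ N * norm (fourier (\<lambda>x. - \<i> * dir_deriv b \<psi> x) \<xi>) \<le> C b"
    by metis
  obtain D where D: "\<And>\<xi>. (1 + norm \<xi>) ^ N * norm (fourier \<psi> \<xi>) \<le> D"
    using Suc.IH[OF Suc.prems] by blast
  have "(1 + norm \<xi>) ^ Suc N * norm (fourier \<psi> \<xi>) \<le> D + sum C Basis" for \<xi>
  proof -
    have "(1 + norm \<xi>) ^ Suc N * norm (fourier \<psi> \<xi>)
        = (1 + norm \<xi>) * ((1 + norm \<xi>) ^ N * norm (fourier \<psi> \<xi>))" by simp
    also have "\<dots> \<le> (1 + (\<Sum>b\<in>Basis. \<bar>\<xi> \<bullet> b\<bar>)) * ((1 + norm \<xi>) ^ N * norm (fourier \<psi> \<xi>))"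
      by (intro mult_right_mono add_left_mono norm_le_l1) auto
    also have "\<dots> = (1 + norm \<xi>) ^ N * norm (fourier \<psi> \<xi>) +
        (\<Sum>b\<in>Basis. (1 + norm \<xi>) ^ N * norm (of_real (\<xi> \<bullet> b) * fourier \<psi> \<xi>))"
      unfolding distrib_right sum_distrib_right by (simp add: norm_mult mult_ac)
    also have "\<dots> \<le> D + sum C Basis"
      by (intro add_mono sum_mono D) (simp only: inner_fourier[OF Suc.prems] C)
    finally show ?thesis .
  qed
  then show ?case by blast
qed

text \<open>A derivative of a transform is, up to a constant, the transform of
  \<open>x \<bullet> b\<close> times the function. So the image of the Schwartz space is closed
  under derivatives and serves itself as the coinduction class.\<close>

lemma fourier_schwartz:
  assumes "\<psi> \<in> schwartz" shows "fourier \<psi> \<in> schwartz"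
proof (rule schwartz_coinduct[where X = "fourier ` schwartz"])
  show "fourier \<psi> \<in> fourier ` schwartz" using assms by blast
  show "\<exists>C. \<forall>x. (1 + norm x) ^ N * norm (g x) \<le> C" if "g \<in> fourier ` schwartz" for g :: "'a \<Rightarrow> complex" and N
    using that fourier_decay by blast
  show "g differentiable (at x)" if "g \<in> fourier ` schwartz" for g :: "'a \<Rightarrow> complex" and x
    using that fourier_has_derivative differentiableI by blast
  show "dir_deriv b g \<in> fourier ` schwartz" if asm: "g \<in> fourier ` schwartz" "b \<in> Basis" for g and b :: 'a
  proof -
    obtain f where f: "g = fourier f" "f \<in> schwartz" using asm by blast
    have "(\<lambda>x. of_real (x \<bullet> b) * (- \<i> * f x)) \<in> schwartz"
      by (intro schwartz_inner_mult schwartz_cmult f)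
    then show ?thesis unfolding f(1) dir_deriv_fourier[OF f(2)] by blast
  qed
qed

lemma inv_fourier_schwartz: "\<psi> \<in> schwartz \<Longrightarrow> inv_fourier \<psi> \<in> schwartz"
  unfolding inv_fourier_eq[abs_def]
  using schwartz_scale[OF fourier_schwartz, of \<psi> "-1" 0] by simp

section \<open>Multipliers as convolutions, and Fourier inversion up to a constant\<close>

lemma integrable_product_lborel:
  fixes f :: "'a::euclidean_space \<Rightarrow> complex" and g :: "'b::euclidean_space \<Rightarrow> complex"
  assumes f: "integrable lborel f" and g: "integrable lborel g"
  shows "integrable (lborel \<Otimes>\<^sub>M lborel) (\<lambda>(x, y). f x * g y)"
proof (rule lborel_pair.Fubini_integrable)
  note [measurable] = borel_measurable_integrable[OF f] borel_measurable_integrable[OF g]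
  show "(\<lambda>(x, y). f x * g y) \<in> borel_measurable (lborel \<Otimes>\<^sub>M lborel)" by measurable
  show "integrable lborel (\<lambda>x. LINT y|lborel. norm (case (x, y) of (x, y) \<Rightarrow> f x * g y))"
    using f by (simp add: norm_mult integrable_norm)
  show "AE x in lborel. integrable lborel (\<lambda>y. case (x, y) of (x, y) \<Rightarrow> f x * g y)"
    using g by simp
qed

text \<open>The convolution theorem in a form that follows from Fubini's theorem alone, hence
  available before inversion: the multiplier \<open>\<kappa>\<close> acts as convolution with a
  multiple of \<open>fourier \<kappa>\<close>.\<close>

lemma fourier_mult_inv_fourier:
  fixes \<kappa> \<psi> :: "'a::euclidean_space \<Rightarrow> complex"
  assumes chi: "\<kappa> \<in> schwartz" and psi: "\<psi> \<in> schwartz"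
  shows "fourier (\<lambda>\<xi>. \<kappa> \<xi> * inv_fourier \<psi> \<xi>) x =
    (LINT y|lborel. \<psi> y * (of_real ((2 * pi) powr (- real DIM('a) / 2)) * fourier \<kappa> (x - y)))"
proof -
  note [measurable] = schwartz_measurable[OF chi] schwartz_measurable[OF psi]
  let ?k = "complex_of_real ((2 * pi) powr (- real DIM('a) / 2))"
  let ?f = "\<lambda>\<xi> y. exp (- (\<i> * complex_of_real (\<xi> \<bullet> (x - y)))) * (\<kappa> \<xi> * \<psi> y)"
  have int: "integrable (lborel \<Otimes>\<^sub>M lborel) (\<lambda>(\<xi>, y). ?f \<xi> y)"
  proof (rule Bochner_Integration.integrable_bound)
    show "integrable (lborel \<Otimes>\<^sub>M lborel) (\<lambda>(\<xi>, y). \<kappa> \<xi> * \<psi> y)"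
      by (intro integrable_product_lborel schwartz_integrable assms)
  qed (auto simp: norm_mult)
  have "fourier (\<lambda>\<xi>. \<kappa> \<xi> * inv_fourier \<psi> \<xi>) x = ?k * ?k * (LINT \<xi>|lborel. LINT y|lborel. ?f \<xi> y)"
  proof -
    have "exp (- (\<i> * complex_of_real (\<xi> \<bullet> x))) * (\<kappa> \<xi> * inv_fourier \<psi> \<xi>) = ?k * (LINT y|lborel. ?f \<xi> y)" for \<xi>
    proof -
      have "(LINT y|lborel. ?f \<xi> y)
          = (LINT y|lborel. (exp (- (\<i> * complex_of_real (\<xi> \<bullet> x))) * \<kappa> \<xi>) * (exp (- (\<i> * of_real (y \<bullet> - \<xi>))) * \<psi> y))"
        by (intro Bochner_Integration.integral_cong)
          (simp_all add: inner_diff_right algebra_simps exp_add[symmetric] inner_commute mult_exp_exp)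
      then show ?thesis by (simp add: inv_fourier_eq fourier_eq)
    qed
    then show ?thesis by (simp add: fourier_eq)
  qed
  also have "(LINT \<xi>|lborel. LINT y|lborel. ?f \<xi> y) = (LINT y|lborel. LINT \<xi>|lborel. ?f \<xi> y)"
    using lborel_pair.Fubini_integral[OF int] by simp
  also have "\<dots> = (LINT y|lborel. \<psi> y * (LINT \<xi>|lborel. exp (- (\<i> * complex_of_real (\<xi> \<bullet> (x - y)))) * \<kappa> \<xi>))"
  proof (intro Bochner_Integration.integral_cong refl)
    fix y
    have "(LINT \<xi>|lborel. ?f \<xi> y) = (LINT \<xi>|lborel. \<psi> y * (exp (- (\<i> * complex_of_real (\<xi> \<bullet> (x - y)))) * \<kappa> \<xi>))"
      by (intro Bochner_Integration.integral_cong) auto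
    then show "(LINT \<xi>|lborel. ?f \<xi> y) = \<psi> y * (LINT \<xi>|lborel. exp (- (\<i> * complex_of_real (\<xi> \<bullet> (x - y)))) * \<kappa> \<xi>)"
      by simp
  qed
  also have "?k * ?k * \<dots> = (LINT y|lborel. (?k * ?k) * (\<psi> y * (LINT \<xi>|lborel. exp (- (\<i> * complex_of_real (\<xi> \<bullet> (x - y)))) * \<kappa> \<xi>)))"
    by simp
  also have "\<dots> = (LINT y|lborel. \<psi> y * (?k * fourier \<kappa> (x - y)))"
    by (intro Bochner_Integration.integral_cong) (simp_all add: fourier_eq)
  finally show ?thesis .
qed

lemma fourier_scale:
  fixes \<kappa> :: "'a::euclidean_space \<Rightarrow> complex"
  assumes chi: "\<kappa> \<in> schwartz" and r: "r > 0"
  shows "fourier (\<lambda>\<xi>. \<kappa> (r *\<^sub>R \<xi>)) z = of_real (inverse r ^ DIM('a)) * fourier \<kappa> (z /\<^sub>R r)"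
proof -
  note [measurable] = schwartz_measurable[OF chi]
  let ?f = "\<lambda>u. exp (- (\<i> * complex_of_real (u \<bullet> (z /\<^sub>R r)))) * \<kappa> u"
  have "(LINT u|lborel. ?f u) = \<bar>r\<bar> ^ DIM('a) *\<^sub>R (LINT u|lborel. ?f (0 + r *\<^sub>R u))"
    by (rule lborel_integral_affine) (use r in auto)
  also have "(\<lambda>u. ?f (0 + r *\<^sub>R u)) = (\<lambda>u. exp (- (\<i> * complex_of_real (u \<bullet> z))) * \<kappa> (r *\<^sub>R u))"
  proof -
    have "(r *\<^sub>R u) \<bullet> (z /\<^sub>R r) = u \<bullet> z" for u using r by simp
    then show ?thesis by (simp only: add_0_left)
  qed
  finally show ?thesis
    using r by (simp add: fourier_eq scaleR_conv_of_real power_inverse)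
qed

text \<open>The substitution \<open>y = x - r *\<^sub>R z\<close> moves the dilation into the
  argument of \<open>\<psi>\<close> and leaves a fixed kernel, which displays an approximate
  identity as \<open>r\<close> tends to \<open>0\<close>.\<close>

lemma fourier_mult_inv_fourier_scaled:
  fixes \<kappa> \<psi> :: "'a::euclidean_space \<Rightarrow> complex"
  assumes chi: "\<kappa> \<in> schwartz" and psi: "\<psi> \<in> schwartz" and r: "r > 0"
  shows "fourier (\<lambda>\<xi>. \<kappa> (r *\<^sub>R \<xi>) * inv_fourier \<psi> \<xi>) x =
    (LINT z|lborel. \<psi> (x - r *\<^sub>R z) * (of_real ((2 * pi) powr (- real DIM('a) / 2)) * fourier \<kappa> z))"
proof -
  note [measurable] = schwartz_measurable[OF psi] schwartz_measurable[OF fourier_schwartz[OF chi]]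
  let ?k = "complex_of_real ((2 * pi) powr (- real DIM('a) / 2))"
  let ?f = "\<lambda>y. \<psi> y * (?k * (of_real (inverse r ^ DIM('a)) * fourier \<kappa> ((x - y) /\<^sub>R r)))"
  have "(\<lambda>\<xi>. \<kappa> (r *\<^sub>R \<xi>)) \<in> schwartz"
    using schwartz_scale[OF chi, of r 0] r by simp
  then have "fourier (\<lambda>\<xi>. \<kappa> (r *\<^sub>R \<xi>) * inv_fourier \<psi> \<xi>) x = (LINT y|lborel. ?f y)"
    by (simp add: fourier_mult_inv_fourier[OF _ psi] fourier_scale[OF chi r])
  also have "\<dots> = \<bar>- r\<bar> ^ DIM('a) *\<^sub>R (LINT z|lborel. ?f (x + (- r) *\<^sub>R z))"
    by (rule lborel_integral_affine) (use r in auto)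
  also have "\<dots> = (LINT z|lborel. of_real (r ^ DIM('a)) * ?f (x + (- r) *\<^sub>R z))"
    using r by (simp add: scaleR_conv_of_real)
  also have "\<dots> = (LINT z|lborel. \<psi> (x - r *\<^sub>R z) * (?k * fourier \<kappa> z))"
    using r by (intro Bochner_Integration.integral_cong) (simp_all add: power_inverse)
  finally show ?thesis .
qed

lemma tendsto_integral_approx:
  fixes f K :: "'a::euclidean_space \<Rightarrow> complex"
  assumes f: "continuous_on UNIV f" and B: "\<And>x. norm (f x) \<le> B" and K: "integrable lborel K"
    and r: "r \<longlonglongrightarrow> 0"
  shows "(\<lambda>n. LINT z|lborel. f (x + r n *\<^sub>R z) * K z) \<longlonglongrightarrow> f x * (LINT z|lborel. K z)"
proof -
  have [measurable]: "f \<in> borel_measurable borel"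
    using f by (rule borel_measurable_continuous_onI)
  note [measurable] = borel_measurable_integrable[OF K]
  have "(\<lambda>n. LINT z|lborel. f (x + r n *\<^sub>R z) * K z) \<longlonglongrightarrow> (LINT z|lborel. f x * K z)"
  proof (rule integral_dominated_convergence[where w = "\<lambda>z. B * norm (K z)"])
    show "AE z in lborel. (\<lambda>n. f (x + r n *\<^sub>R z) * K z) \<longlonglongrightarrow> f x * K z"
    proof (rule AE_I2)
      fix z
      have "(\<lambda>n. x + r n *\<^sub>R z) \<longlonglongrightarrow> x + 0 *\<^sub>R z"
        by (intro tendsto_intros r)
      then have "(\<lambda>n. f (x + r n *\<^sub>R z)) \<longlonglongrightarrow> f x"
        using f by (intro isCont_tendsto_compose[of x f]) (auto simp: continuous_on_eq_continuous_at)
      then show "(\<lambda>n. f (x + r n *\<^sub>R z) * K z) \<longlonglongrightarrow> f x * K z"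
        by (intro tendsto_intros)
    qed
    show "AE z in lborel. norm (f (x + r n *\<^sub>R z) * K z) \<le> B * norm (K z)" for n
      by (intro AE_I2) (auto simp: norm_mult intro!: mult_right_mono B)
  qed (use K in auto)
  then show ?thesis by simp
qed

text \<open>The transform of \<open>\<kappa> (r *\<^sub>R \<xi>) * inv_fourier \<psi> \<xi>\<close>
  is computed in two ways as \<open>r\<close> tends to \<open>0\<close>: on the frequency side the
  cut-off tends to \<open>\<kappa> 0\<close>, on the space side its kernel concentrates at
  \<open>x\<close>. No explicit Gaussian is involved, so the mass on the right stays an unevaluated
  constant.\<close>

lemma fourier_inversion_aux:
  fixes \<kappa> \<psi> :: "'a::euclidean_space \<Rightarrow> complex"
  assumes chi: "\<kappa> \<in> schwartz" and psi: "\<psi> \<in> schwartz"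
  shows "\<kappa> 0 * fourier (inv_fourier \<psi>) x =
    \<psi> x * (LINT z|lborel. of_real ((2 * pi) powr (- real DIM('a) / 2)) * fourier \<kappa> z)"
proof -
  let ?k = "complex_of_real ((2 * pi) powr (- real DIM('a) / 2))"
  note [measurable] = schwartz_measurable[OF chi] schwartz_measurable[OF inv_fourier_schwartz[OF psi]]
  define r :: "nat \<Rightarrow> real" where "r n = inverse (real (Suc n))" for n
  have r: "r \<longlonglongrightarrow> 0" "\<And>n. r n > 0"
    unfolding r_def using LIMSEQ_inverse_real_of_nat by (assumption, simp)
  obtain B where B: "\<And>x. norm (\<kappa> x) \<le> B" using schwartz_bounded[OF chi] by blast
  obtain D where D: "\<And>x. norm (\<psi> x) \<le> D" using schwartz_bounded[OF psi] by blast
  let ?S = "\<lambda>n. fourier (\<lambda>\<xi>. \<kappa> (r n *\<^sub>R \<xi>) * inv_fourier \<psi> \<xi>) x"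
  let ?h = "\<lambda>\<xi>. exp (- (\<i> * complex_of_real (\<xi> \<bullet> x))) * inv_fourier \<psi> \<xi>"
  have h: "integrable lborel ?h"
    by (rule integrable_schwartz_mult[where B = 1]) (auto intro: inv_fourier_schwartz psi)
  have "(\<lambda>n. LINT \<xi>|lborel. \<kappa> (0 + r n *\<^sub>R \<xi>) * ?h \<xi>) \<longlonglongrightarrow> \<kappa> 0 * (LINT \<xi>|lborel. ?h \<xi>)"
    by (rule tendsto_integral_approx[OF schwartz_continuous[OF chi] B h r(1)])
  from tendsto_mult_left[OF this, of ?k] have "?S \<longlonglongrightarrow> \<kappa> 0 * fourier (inv_fourier \<psi>) x"
    by (simp add: fourier_eq[abs_def] mult_ac)
  moreover have "?S \<longlonglongrightarrow> \<psi> x * (LINT z|lborel. ?k * fourier \<kappa> z)"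
  proof -
    have "(\<lambda>n. LINT z|lborel. \<psi> (x + (- r n) *\<^sub>R z) * (?k * fourier \<kappa> z)) \<longlonglongrightarrow> \<psi> x * (LINT z|lborel. ?k * fourier \<kappa> z)"
      by (rule tendsto_integral_approx[OF schwartz_continuous[OF psi] D])
        (use r(1) in \<open>auto intro!: schwartz_integrable schwartz_cmult fourier_schwartz chi tendsto_eq_intros\<close>)
    then show ?thesis
      by (simp add: fourier_mult_inv_fourier_scaled[OF chi psi r(2)])
  qed
  ultimately show ?thesis by (rule LIMSEQ_unique)
qed

lemma schwartz_eq_0_if_integral_norm2:
  fixes \<psi> :: "'a::euclidean_space \<Rightarrow> complex"
  assumes psi: "\<psi> \<in> schwartz" and 0: "(LINT x|lborel. \<psi> x * cnj (\<psi> x)) = 0"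
  shows "\<psi> x = 0"
proof -
  have "complex_of_real (LINT x|lborel. (norm (\<psi> x))\<^sup>2) = (LINT x|lborel. \<psi> x * cnj (\<psi> x))"
    by (simp add: complex_norm_square[symmetric] del: of_real_power flip: integral_complex_of_real of_real_power)
  then have "(LINT x|lborel. (norm (\<psi> x))\<^sup>2) = 0"
    using 0 by (simp del: integral_complex_of_real)
  moreover have "integrable lborel (\<lambda>x. (norm (\<psi> x))\<^sup>2)"
    using integrable_norm[OF schwartz_integrable[OF schwartz_mult[OF psi psi]]]
    by (simp add: norm_mult power2_eq_square)
  ultimately have "AE x in lborel. (norm (\<psi> x))\<^sup>2 = 0"
    by (subst (asm) integral_nonneg_eq_0_iff_AE) auto
  then have "AE x in lborel. x \<notin> {x. \<psi> x \<noteq> 0}" by simp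
  moreover have op: "open {x. \<psi> x \<noteq> 0}"
    using schwartz_continuous[OF psi, of UNIV] by (auto intro!: open_Collect_neq)
  ultimately have "{x. \<psi> x \<noteq> 0} \<in> null_sets lborel"
    by (subst AE_iff_null_sets) auto
  then have "negligible {x. \<psi> x \<noteq> 0}"
    by (simp add: negligible_iff_null_sets null_sets_completionI)
  then show ?thesis
    using open_not_negligible[OF op] by auto
qed

lemma fourier_cnj:
  fixes \<psi> :: "'a::euclidean_space \<Rightarrow> complex"
  shows "fourier (\<lambda>x. cnj (\<psi> x)) \<xi> = cnj (fourier \<psi> (- \<xi>))"
proof -
  have "(LINT x|lborel. exp (- (\<i> * of_real (x \<bullet> \<xi>))) * cnj (\<psi> x))
      = (LINT x|lborel. cnj (exp (- (\<i> * of_real (x \<bullet> (- \<xi>)))) * \<psi> x))"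
    by (intro Bochner_Integration.integral_cong) (simp_all add: exp_cnj)
  also have "\<dots> = cnj (LINT x|lborel. exp (- (\<i> * of_real (x \<bullet> (- \<xi>)))) * \<psi> x)"
    by (rule Bochner_Integration.integral_cnj)
  finally show ?thesis unfolding fourier_eq by simp
qed

text \<open>The value of \<open>c\<close> is \<open>1\<close>, but only \<open>c \<noteq> 0\<close> is relevant here.\<close>

lemma fourier_inversion:
  fixes \<kappa> :: "'a::euclidean_space \<Rightarrow> complex"
  assumes chi: "\<kappa> \<in> schwartz" and chi0: "\<kappa> 0 = 1"
  obtains c where "c \<noteq> 0"
    "\<And>\<psi> x. \<psi> \<in> schwartz \<Longrightarrow> fourier (inv_fourier \<psi>) x = c * \<psi> (x::'a)"
    "\<And>\<psi> x. \<psi> \<in> schwartz \<Longrightarrow> inv_fourier (fourier \<psi>) x = c * \<psi> (x::'a)"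
    "\<And>\<kappa>. \<kappa> \<in> schwartz \<Longrightarrow> (LINT z|lborel. of_real ((2 * pi) powr (- real DIM('a) / 2)) * fourier \<kappa> z) = c * \<kappa> (0::'a)"
proof -
  let ?k = "complex_of_real ((2 * pi) powr (- real DIM('a) / 2))"
  define c where "c = (LINT z|lborel. ?k * fourier \<kappa> z)"
  have inv: "fourier (inv_fourier \<psi>) x = c * \<psi> x" if "\<psi> \<in> schwartz" for \<psi> and x :: 'a
    using fourier_inversion_aux[OF chi that, of x] chi0 by (simp add: c_def mult.commute)
  have inv2: "inv_fourier (fourier \<psi>) x = c * \<psi> x" if psi: "\<psi> \<in> schwartz" for \<psi> and x :: 'a
  proof -
    have refl: "fourier (\<lambda>\<xi>. \<eta> (- \<xi>)) z = fourier \<eta> (- z)" if "\<eta> \<in> schwartz" for \<eta> :: "'a \<Rightarrow> complex" and z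
    proof -
      note [measurable] = schwartz_measurable[OF that]
      show ?thesis
        unfolding fourier_eq
        using lborel_integral_affine[of "\<lambda>u. exp (- (\<i> * complex_of_real (u \<bullet> (- z)))) * \<eta> u" "-1" 0] by simp
    qed
    have "inv_fourier (fourier \<psi>) x = fourier (\<lambda>\<xi>. fourier \<psi> (- \<xi>)) x"
      by (simp add: inv_fourier_eq refl fourier_schwartz psi)
    also have "\<dots> = fourier (inv_fourier \<psi>) x"
      by (simp add: inv_fourier_eq[abs_def])
    finally show ?thesis using inv[OF psi] by simp
  qed
  have mass: "(LINT z|lborel. ?k * fourier \<eta> z) = c * \<eta> 0" if "\<eta> \<in> schwartz" for \<eta> :: "'a \<Rightarrow> complex"
    using fourier_inversion_aux[OF that chi, of 0] inv[OF chi] chi0 by (simp add: mult.commute)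
  \<comment> \<open>If \<open>c\<close> were \<open>0\<close>, the transform of
    \<open>cnj (inv_fourier \<psi>)\<close> would vanish; the convolution formula at
    \<open>0\<close> then makes the integral of the squared modulus of
    \<open>inv_fourier \<psi>\<close> vanish, for every Schwartz function
    \<open>\<psi>\<close>.\<close>
  have "c \<noteq> 0"
  proof
    assume c: "c = 0"
    have van: "inv_fourier \<psi> x = 0" if psi: "\<psi> \<in> schwartz" for \<psi> and x :: 'a
    proof -
      let ?g = "\<lambda>\<xi>. cnj (inv_fourier \<psi> \<xi>)"
      have g: "?g \<in> schwartz" by (intro schwartz_cnj inv_fourier_schwartz psi)
      have "fourier ?g y = 0" for y
        by (subst fourier_cnj) (simp only: inv[OF psi] c mult_zero_left complex_cnj_zero)
      then have "fourier (\<lambda>\<xi>. ?g \<xi> * inv_fourier \<psi> \<xi>) 0 = 0"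
        by (simp add: fourier_mult_inv_fourier[OF g psi])
      then have "(LINT x|lborel. inv_fourier \<psi> x * cnj (inv_fourier \<psi> x)) = 0"
        by (simp add: fourier_eq mult.commute)
      then show ?thesis
        by (rule schwartz_eq_0_if_integral_norm2[OF inv_fourier_schwartz[OF psi]])
    qed
    \<comment> \<open>Applied to the squared modulus of \<open>\<kappa>\<close>, whose inverse
      transform at \<open>0\<close> is a positive multiple of its integral; this contradicts
      \<open>\<kappa> 0 = 1\<close>.\<close>
    have "(\<lambda>x. \<kappa> x * cnj (\<kappa> x)) \<in> schwartz"
      by (intro schwartz_mult schwartz_cnj chi)
    from van[OF this, of 0] have "(LINT x|lborel. \<kappa> x * cnj (\<kappa> x)) = 0"
      by (simp add: inv_fourier_def)
    then have "\<kappa> 0 = 0" by (rule schwartz_eq_0_if_integral_norm2[OF chi])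
    then show False using chi0 by simp
  qed
  with inv inv2 mass show ?thesis using that by blast
qed

section \<open>Bounded functions as tempered distributions\<close>

lemma iter_deriv_eq_0_open:
  assumes "open U" "\<And>x. x \<in> U \<Longrightarrow> f x = 0" "x \<in> U"
  shows "iter_deriv bs f x = 0"
  using assms(3)
proof (induction bs arbitrary: x)
  case Nil
  then show ?case using assms by simp
next
  case (Cons b bs)
  have "((\<lambda>x. 0) has_derivative (\<lambda>v. 0)) (at x)" by simp
  then have "(iter_deriv bs f has_derivative (\<lambda>v. 0)) (at x)"
    using Cons by (rule_tac has_derivative_transform_within_open[OF _ assms(1)]) auto
  then show ?case by (simp add: dir_deriv_eq)
qed

text \<open>Weighted derivatives are continuous, hence bounded on the ball of radius
  \<open>2\<close>. A point outside it lies in the open complement of the ball of radius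
  \<open>3/2\<close>, where \<open>\<phi>\<close> and therefore all its derivatives vanish.\<close>

lemma besov_cutoff_schwartz:
  fixes \<phi> :: "'a::euclidean_space \<Rightarrow> complex"
  assumes "besov_cutoff \<phi>"
  shows "\<phi> \<in> schwartz"
proof -
  have sm: "smooth \<phi>" using assms by (simp add: besov_cutoff_def)
  have "bounded (range (\<lambda>x. (1 + norm x) ^ N *\<^sub>R iter_deriv bs \<phi> x))" if bs: "set bs \<subseteq> Basis" for N bs
  proof -
    let ?f = "\<lambda>x. (1 + norm x) ^ N *\<^sub>R iter_deriv bs \<phi> x"
    have cont: "continuous_on (cball 0 2) (iter_deriv bs \<phi>)"
      using sm bs unfolding smooth_def
      by (intro continuous_at_imp_continuous_on ballI differentiable_imp_continuous_within) auto
    have "compact (?f ` cball 0 2)"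
      by (intro compact_continuous_image continuous_intros cont) auto
    moreover have "?f x \<in> insert 0 (?f ` cball 0 2)" for x
    proof (cases "norm x \<le> 2")
      case False
      have "iter_deriv bs \<phi> x = 0"
      proof (rule iter_deriv_eq_0_open[of "- cball 0 (3/2)"])
        show "\<phi> y = 0" if "y \<in> - cball 0 (3 / 2)" for y
          using assms that by (auto simp: besov_cutoff_def)
      qed (use False in auto)
      then show ?thesis by simp
    qed auto
    ultimately show ?thesis
      by (meson bounded_insert bounded_subset compact_imp_bounded image_subsetI)
  qed
  with sm show ?thesis by (simp add: schwartz_def)
qed

lemma besov_cutoff_0: "besov_cutoff \<phi> \<Longrightarrow> \<phi> 0 = 1"
  by (simp add: besov_cutoff_def)

lemma dyadic_schwartz:
  fixes \<phi> :: "'a::euclidean_space \<Rightarrow> complex"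
  assumes "besov_cutoff \<phi>"
  shows "dyadic \<phi> j \<in> schwartz"
proof -
  have "(\<lambda>\<xi>. \<phi> (2 powr a *\<^sub>R \<xi>)) \<in> schwartz" for a
    using schwartz_scale[OF besov_cutoff_schwartz[OF assms], of "2 powr a" 0] by simp
  then show ?thesis
    unfolding dyadic_def by (auto intro: besov_cutoff_schwartz assms schwartz_diff)
qed

lemma sum_dyadic: "(\<Sum>j\<le>n. dyadic \<phi> j \<xi>) = \<phi> (2 powr (- real n) *\<^sub>R \<xi>)"
proof (induction n)
  case (Suc n)
  have "dyadic \<phi> (Suc n) \<xi> = \<phi> (2 powr (- real (Suc n)) *\<^sub>R \<xi>) - \<phi> (2 powr (- real n) *\<^sub>R \<xi>)"
    by (simp add: dyadic_def)
  then show ?case using Suc by simp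
qed (simp add: dyadic_def)

text \<open>Testing \<open>T\<close> on bumps that concentrate at \<open>y\<close> recovers the
  value at \<open>y\<close> of any bounded continuous representative. The bump is the squared
  modulus of \<open>\<kappa>\<close>, which has nonzero integral because
  \<open>\<kappa> 0 = 1\<close>.\<close>

lemma cont_rep_unique:
  fixes \<kappa> :: "'a::euclidean_space \<Rightarrow> complex" and T :: "('a \<Rightarrow> complex) \<Rightarrow> complex"
  assumes kap: "\<kappa> \<in> schwartz" "\<kappa> 0 = 1"
    and f: "is_cont_rep T f" and g: "is_cont_rep T g"
  shows "f = g"
proof
  fix y :: 'a
  define \<rho> where "\<rho> x = \<kappa> x * cnj (\<kappa> x)" for x
  have rho: "\<rho> \<in> schwartz"
    unfolding \<rho>_def[abs_def] by (intro schwartz_mult schwartz_cnj kap)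
  note [measurable] = schwartz_measurable[OF rho]
  have nz: "(LINT x|lborel. \<rho> x) \<noteq> 0"
    using schwartz_eq_0_if_integral_norm2[OF kap(1), of 0] kap(2) by (auto simp: \<rho>_def)
  define r :: "nat \<Rightarrow> real" where "r n = inverse (real (Suc n))" for n
  have r: "r \<longlonglongrightarrow> 0" "\<And>n. r n > 0"
    unfolding r_def using LIMSEQ_inverse_real_of_nat by (assumption, simp)
  have lim: "(\<lambda>n. inverse (r n ^ DIM('a)) *\<^sub>R T (\<lambda>x. \<rho> (inverse (r n) *\<^sub>R x + - (inverse (r n) *\<^sub>R y))))
      \<longlonglongrightarrow> h y * (LINT z|lborel. \<rho> z)" if h: "is_cont_rep T h" for h
  proof -
    have c: "continuous_on UNIV h" and bd: "bounded (range h)" and T: "T = dist_of h"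
      using h by (auto simp: is_cont_rep_def)
    have [measurable]: "h \<in> borel_measurable borel"
      using c by (rule borel_measurable_continuous_onI)
    obtain B where B: "\<And>x. norm (h x) \<le> B" using bd by (auto simp: bounded_iff)
    have "inverse (r n ^ DIM('a)) *\<^sub>R T (\<lambda>x. \<rho> (inverse (r n) *\<^sub>R x + - (inverse (r n) *\<^sub>R y)))
        = (LINT z|lborel. h (y + r n *\<^sub>R z) * \<rho> z)" for n
    proof -
      have "(\<lambda>x. \<rho> (inverse (r n) *\<^sub>R x + - (inverse (r n) *\<^sub>R y))) \<in> schwartz"
        using r(2)[of n] by (intro schwartz_scale rho) auto
      then have "T (\<lambda>x. \<rho> (inverse (r n) *\<^sub>R x + - (inverse (r n) *\<^sub>R y)))
          = (LINT x|lborel. h x * \<rho> (inverse (r n) *\<^sub>R x + - (inverse (r n) *\<^sub>R y)))"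
        by (simp add: T dist_of_def)
      also have "\<dots> = \<bar>r n\<bar> ^ DIM('a) *\<^sub>R (LINT z|lborel. h (y + r n *\<^sub>R z) * \<rho> (inverse (r n) *\<^sub>R (y + r n *\<^sub>R z) + - (inverse (r n) *\<^sub>R y)))"
        by (rule lborel_integral_affine) (use r(2)[of n] in auto)
      finally show ?thesis using r(2)[of n] by (simp add: scaleR_add_right)
    qed
    then show ?thesis
      using tendsto_integral_approx[OF c B schwartz_integrable[OF rho] r(1), of y] by simp
  qed
  from LIMSEQ_unique[OF lim[OF f] lim[OF g]] nz show "f y = g y" by simp
qed

lemma dist_of_tempered:
  fixes g :: "'a::euclidean_space \<Rightarrow> complex"
  assumes g [measurable]: "g \<in> borel_measurable borel" and B: "\<And>x. norm (g x) \<le> B"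
  shows "dist_of g \<in> tempered"
  unfolding tempered_def
proof (intro CollectI conjI ballI allI impI)
  show "dist_of g \<psi> = 0" if "\<psi> \<notin> schwartz" for \<psi> using that by (simp add: dist_of_def)
next
  fix \<psi> \<eta> :: "'a \<Rightarrow> complex" and a b assume s: "\<psi> \<in> schwartz" "\<eta> \<in> schwartz"
  have "(LINT x|lborel. g x * (a * \<psi> x + b * \<eta> x)) = (LINT x|lborel. a * (g x * \<psi> x) + b * (g x * \<eta> x))"
    by (intro Bochner_Integration.integral_cong) (auto simp: algebra_simps)
  also have "\<dots> = a * (LINT x|lborel. g x * \<psi> x) + b * (LINT x|lborel. g x * \<eta> x)"
    using integrable_schwartz_mult[OF g B] s by simp
  finally show "dist_of g (\<lambda>x. a * \<psi> x + b * \<eta> x) = a * dist_of g \<psi> + b * dist_of g \<eta>"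
    using s by (simp add: dist_of_def schwartz_cmult_add)
next
  fix F :: "nat \<Rightarrow> 'a \<Rightarrow> complex" and f
  assume "(\<forall>k. F k \<in> schwartz) \<and> f \<in> schwartz \<and> schwartz_converges F f"
  then have F: "\<And>k. F k \<in> schwartz" and f: "f \<in> schwartz" and conv: "schwartz_converges F f" by auto
  have B0: "B \<ge> 0" using B[of 0] norm_ge_zero order_trans by blast
  define J where "J = (LINT x|lborel. 1 / (1 + norm (x::'a)) ^ (2 * DIM('a)))"
  have J: "J \<ge> 0" unfolding J_def by (intro integral_nonneg_AE) auto
  have ul: "uniform_limit UNIV (\<lambda>k x. (1 + norm x) ^ (2 * DIM('a)) *\<^sub>R F k x)
                        (\<lambda>x. (1 + norm x) ^ (2 * DIM('a)) *\<^sub>R f x) sequentially"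
    using conv[unfolded schwartz_converges_def, rule_format, of "[]"] by simp
  show "(\<lambda>k. dist_of g (F k)) \<longlonglongrightarrow> dist_of g f"
  proof (rule tendstoI)
    fix e :: real assume e: "e > 0"
    \<comment> \<open>The summand \<open>1\<close> keeps the denominator positive when
      \<open>B * J\<close> is \<open>0\<close>.\<close>
    define d where "d = e / (B * J + 1)"
    have BJ: "B * J + 1 > 0" using B0 J by (simp add: add_nonneg_pos)
    then have d: "d > 0" using e by (simp add: d_def)
    from uniform_limitD[OF ul d] show "\<forall>\<^sub>F k in sequentially. dist (dist_of g (F k)) (dist_of g f) < e"
    proof eventually_elim
      case (elim k)
      have "norm (F k x - f x) \<le> d * (1 / (1 + norm x) ^ (2 * DIM('a)))" for x
      proof -
        have "norm ((1 + norm x) ^ (2 * DIM('a)) *\<^sub>R (F k x - f x)) < d"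
          using elim by (simp add: dist_norm scaleR_diff_right)
        then have "(1 + norm x) ^ (2 * DIM('a)) * norm (F k x - f x) \<le> d" by simp
        then show ?thesis by (simp add: pos_le_divide_eq mult.commute)
      qed
      note bnd = this
      have sch: "(\<lambda>x. F k x - f x) \<in> schwartz" by (intro schwartz_diff F f)
      have "dist_of g (F k) - dist_of g f = (LINT x|lborel. g x * (F k x - f x))"
        using integrable_schwartz_mult[OF g B] F f by (simp add: dist_of_def right_diff_distrib)
      also have "norm \<dots> \<le> B * (LINT x|lborel. norm (F k x - f x))"
        by (intro norm_integral_bounded_mult g B schwartz_integrable sch)
      also have "\<dots> \<le> B * (LINT x|lborel. d * (1 / (1 + norm (x::'a)) ^ (2 * DIM('a))))"
      proof (rule mult_left_mono[OF _ B0], rule Bochner_Integration.integral_mono)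
        show "integrable lborel (\<lambda>x. norm (F k x - f x))"
          using schwartz_integrable[OF sch] by (rule integrable_norm)
        show "integrable lborel (\<lambda>x::'a. d * (1 / (1 + norm x) ^ (2 * DIM('a))))"
          by (intro integrable_mult_right integrable_inverse_power_norm)
      qed (rule bnd)
      also have "\<dots> = d * (B * J)"
        unfolding J_def by (subst integral_mult_right_zero) (rule mult.left_commute)
      also have "\<dots> < d * (B * J + 1)" using d by simp
      also have "\<dots> = e" using BJ by (simp add: d_def)
      finally show ?case by (simp add: dist_norm)
    qed
  qed
qed

text \<open>Fubini's theorem transfers the smoothing from the test function to \<open>F\<close>;
  this turns a multiplier defined by duality into an operation on functions.\<close>

lemma fubini_corr:
  fixes F \<psi> K :: "'a::euclidean_space \<Rightarrow> complex"
  assumes F [measurable]: "F \<in> borel_measurable borel" and B: "\<And>x. norm (F x) \<le> B"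
    and psi: "\<psi> \<in> schwartz" and K: "K \<in> schwartz"
  shows "(LINT x|lborel. F x * (LINT y|lborel. \<psi> y * K (x - y))) = (LINT y|lborel. corr F K y * \<psi> y)"
proof -
  note [measurable] = schwartz_measurable[OF psi] schwartz_measurable[OF K]
  have B0: "B \<ge> 0" using B[of 0] norm_ge_zero order_trans by blast
  have 1: "integrable (lborel \<Otimes>\<^sub>M lborel) (\<lambda>(y, x). \<psi> y * K (x - y))"
  proof (rule lborel_pair.Fubini_integrable)
    show "(\<lambda>(y, x). \<psi> y * K (x - y)) \<in> borel_measurable (lborel \<Otimes>\<^sub>M lborel)" by measurable
    have "(LINT x|lborel. norm (K (x - y))) = (LINT x|lborel. norm (K x))" for y
      using lborel_integral_translate[of "\<lambda>x. norm (K x)" "- y"] by simp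
    then show "integrable lborel (\<lambda>y. LINT x|lborel. norm (case (y, x) of (y, x) \<Rightarrow> \<psi> y * K (x - y)))"
      using schwartz_integrable[OF psi] by (simp add: norm_mult integrable_norm)
    show "AE y in lborel. integrable lborel (\<lambda>x. case (y, x) of (y, x) \<Rightarrow> \<psi> y * K (x - y))"
      using schwartz_integrable[OF schwartz_translate[OF K]] by simp
  qed
  have 2: "integrable (lborel \<Otimes>\<^sub>M lborel) (\<lambda>(y, x). F x * (\<psi> y * K (x - y)))"
  proof (rule Bochner_Integration.integrable_bound)
    show "integrable (lborel \<Otimes>\<^sub>M lborel) (\<lambda>p. B *\<^sub>R (case p of (y, x) \<Rightarrow> \<psi> y * K (x - y)))"
      using 1 by (intro integrable_scaleR_right)
  qed (use B B0 in \<open>auto simp: norm_mult intro!: AE_I2 mult_right_mono\<close>)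
  have "(LINT x|lborel. F x * (LINT y|lborel. \<psi> y * K (x - y))) = (LINT x|lborel. LINT y|lborel. F x * (\<psi> y * K (x - y)))"
    by simp
  also have "\<dots> = (LINT y|lborel. LINT x|lborel. F x * (\<psi> y * K (x - y)))"
    using lborel_pair.Fubini_integral[OF 2] by simp
  also have "\<dots> = (LINT y|lborel. corr F K y * \<psi> y)"
  proof (intro Bochner_Integration.integral_cong refl)
    fix y
    have "(LINT x|lborel. F x * (\<psi> y * K (x - y))) = (LINT x|lborel. (F x * K (x - y)) * \<psi> y)"
      by (intro Bochner_Integration.integral_cong) auto
    then show "(LINT x|lborel. F x * (\<psi> y * K (x - y))) = corr F K y * \<psi> y"
      by (simp add: corr_def)
  qed
  finally show ?thesis .
qed

section \<open>The supremum norm of a distribution\<close>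

lemma dist_of_cong_AE:
  assumes [measurable]: "f \<in> borel_measurable borel" "g \<in> borel_measurable borel" and "AE x in lborel. f x = g x"
  shows "dist_of f = dist_of g"
proof
  fix \<psi> show "dist_of f \<psi> = dist_of g \<psi>"
  proof (cases "\<psi> \<in> schwartz")
    case True
    note [measurable] = schwartz_measurable[OF True]
    show ?thesis unfolding dist_of_def using assms(3)
      by (auto intro!: integral_cong_AE)
  qed (simp add: dist_of_def)
qed

text \<open>Values above the essential supremum occur on a null set only and are replaced by
  \<open>0\<close>, so an almost everywhere bound becomes a bound everywhere.\<close>

lemma Linf_norm_rep:
  fixes T :: "('a::euclidean_space \<Rightarrow> complex) \<Rightarrow> complex"
  assumes g: "g \<in> borel_measurable lborel" "T = dist_of g"
    and fin: "esssup lborel (\<lambda>x. ennreal (norm (g x))) < \<infinity>"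
  obtains h where "h \<in> borel_measurable borel" "T = dist_of h"
    "\<And>x. norm (h x) \<le> enn2real (esssup lborel (\<lambda>x. ennreal (norm (g x))))"
proof -
  define e where "e = enn2real (esssup lborel (\<lambda>x. ennreal (norm (g x))))"
  have [measurable]: "g \<in> borel_measurable borel" using g by simp
  have e: "esssup lborel (\<lambda>x. ennreal (norm (g x))) = ennreal e" "e \<ge> 0"
    using fin by (auto simp: e_def)
  define h where "h x = (if norm (g x) \<le> e then g x else 0)" for x
  have [measurable]: "h \<in> borel_measurable borel" unfolding h_def[abs_def] by measurable
  have "AE x in lborel. ennreal (norm (g x)) \<le> ennreal e"
    using esssup_AE[of "\<lambda>x. ennreal (norm (g x))" lborel] by (simp add: e)
  then have "AE x in lborel. g x = h x"
    by eventually_elim (use e in \<open>simp add: h_def\<close>)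
  then have "T = dist_of h" unfolding g(2) by (intro dist_of_cong_AE) auto
  moreover have "norm (h x) \<le> e" for x using e by (simp add: h_def)
  ultimately show ?thesis using that[of h] unfolding e_def by simp
qed

lemma Linf_norm_finite_rep:
  fixes T :: "('a::euclidean_space \<Rightarrow> complex) \<Rightarrow> complex"
  assumes "Linf_norm T < \<infinity>"
  obtains g B where "g \<in> borel_measurable borel" "T = dist_of g" "\<And>x. norm (g x) \<le> B"
proof -
  obtain g where "g \<in> borel_measurable lborel" "T = dist_of g" "esssup lborel (\<lambda>x. ennreal (norm (g x))) < \<infinity>"
    using assms unfolding Linf_norm_def INF_less_iff by auto
  from Linf_norm_rep[OF this] that show ?thesis by metis
qed

text \<open>Each representative with finite essential supremum gives the bound with its own
  supremum; after division by the integral of \<open>norm (\<psi> x)\<close> the left side is a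
  lower bound of all these suprema, hence of their infimum. A vanishing integral is handled with any
  one representative.\<close>

lemma Linf_norm_bound:
  fixes T :: "('a::euclidean_space \<Rightarrow> complex) \<Rightarrow> complex"
  assumes fin: "Linf_norm T < \<infinity>" and psi: "\<psi> \<in> schwartz"
  shows "norm (T \<psi>) \<le> enn2real (Linf_norm T) * (LINT x|lborel. norm (\<psi> x))"
proof -
  let ?I = "LINT x|lborel. norm (\<psi> x)"
  have bd: "norm (T \<psi>) \<le> enn2real (esssup lborel (\<lambda>x. ennreal (norm (g x)))) * ?I"
    if g: "g \<in> borel_measurable lborel" "T = dist_of g" "esssup lborel (\<lambda>x. ennreal (norm (g x))) < \<infinity>" for g
  proof -
    obtain h where h: "h \<in> borel_measurable borel" "T = dist_of h"
      "\<And>x. norm (h x) \<le> enn2real (esssup lborel (\<lambda>x. ennreal (norm (g x))))"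
      using Linf_norm_rep[OF g] by blast
    show ?thesis
      using norm_integral_bounded_mult[OF h(1,3) schwartz_integrable[OF psi]] psi by (simp add: h(2) dist_of_def)
  qed
  have I0: "?I \<ge> 0" by simp
  show ?thesis
  proof (cases "?I = 0")
    case True
    obtain g where "g \<in> borel_measurable lborel" "T = dist_of g" "esssup lborel (\<lambda>x. ennreal (norm (g x))) < \<infinity>"
      using fin unfolding Linf_norm_def INF_less_iff by auto
    from bd[OF this] True show ?thesis by simp
  next
    case False
    with I0 have I: "?I > 0" by linarith
    have "ennreal (norm (T \<psi>) / ?I) \<le> Linf_norm T"
      unfolding Linf_norm_def
    proof (rule INF_greatest)
      fix g assume g: "g \<in> {g \<in> borel_measurable lborel. T = dist_of g}"
      show "ennreal (norm (T \<psi>) / ?I) \<le> esssup lborel (\<lambda>x. ennreal (norm (g x)))"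
      proof (cases "esssup lborel (\<lambda>x. ennreal (norm (g x))) < \<infinity>")
        case True
        then have "norm (T \<psi>) / ?I \<le> enn2real (esssup lborel (\<lambda>x. ennreal (norm (g x))))"
          using bd[of g] g I by (simp add: pos_divide_le_eq)
        then show ?thesis using True by (metis ennreal_enn2real ennreal_leI infinity_ennreal_def)
      next
        case False
        then have "esssup lborel (\<lambda>x. ennreal (norm (g x))) = top"
          by (simp add: less_top[symmetric])
        then show ?thesis by simp
      qed
    qed
    then have "norm (T \<psi>) / ?I \<le> enn2real (Linf_norm T)"
      using fin I by (metis enn2real_ennreal enn2real_mono divide_nonneg_pos infinity_ennreal_def norm_ge_zero)
    then show ?thesis using I by (simp add: pos_divide_le_eq)
  qed
qed

lemma Linf_norm_dist_of_le:
  assumes [measurable]: "g \<in> borel_measurable borel" and "\<And>x. norm (g x) \<le> B"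
  shows "Linf_norm (dist_of g) \<le> ennreal B"
proof -
  have "Linf_norm (dist_of g) \<le> esssup lborel (\<lambda>x. ennreal (norm (g x)))"
    unfolding Linf_norm_def by (rule INF_lower) auto
  also have "\<dots> \<le> ennreal B"
    using assms(2) by (intro esssup_I AE_I2 ennreal_leI) auto
  finally show ?thesis .
qed

lemma sums_integral_schwartz:
  fixes F :: "nat \<Rightarrow> 'a::euclidean_space \<Rightarrow> complex"
  assumes [measurable]: "\<And>j. F j \<in> borel_measurable borel"
    and Fbd: "\<And>j x. norm (F j x) \<le> A j" and sa: "summable A"
    and Fsums: "\<And>x. (\<lambda>j. F j x) sums f x" and psi: "\<psi> \<in> schwartz"
  shows "(\<lambda>j. LINT y|lborel. F j y * \<psi> y) sums (LINT y|lborel. f y * \<psi> y)"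
proof -
  have "(\<lambda>j. LINT y|lborel. F j y * \<psi> y) sums (LINT y|lborel. (\<Sum>j. F j y * \<psi> y))"
  proof (rule sums_integral)
    show "integrable lborel (\<lambda>y. F j y * \<psi> y)" for j
      by (rule integrable_schwartz_mult[OF _ Fbd psi]) measurable
    show "AE y in lborel. summable (\<lambda>j. norm (F j y * \<psi> y))"
    proof (rule AE_I2)
      fix y show "summable (\<lambda>j. norm (F j y * \<psi> y))"
        using summable_mult2[OF sa, of "norm (\<psi> y)"]
        by (rule summable_comparison_test') (auto simp: norm_mult intro!: mult_right_mono Fbd)
    qed
    show "summable (\<lambda>j. LINT y|lborel. norm (F j y * \<psi> y))"
    proof (rule summable_comparison_test'[OF summable_mult2[OF sa, of "LINT y|lborel. norm (\<psi> y)"]])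
      fix j :: nat
      have "(LINT y|lborel. norm (F j y * \<psi> y)) \<le> (LINT y|lborel. A j * norm (\<psi> y))"
      proof (rule Bochner_Integration.integral_mono)
        show "integrable lborel (\<lambda>y. norm (F j y * \<psi> y))"
          by (intro integrable_norm integrable_schwartz_mult[OF _ Fbd psi]) measurable
        show "integrable lborel (\<lambda>y. A j * norm (\<psi> y))"
          using schwartz_integrable[OF psi] by (intro integrable_mult_right integrable_norm)
      qed (auto simp: norm_mult intro!: mult_right_mono Fbd)
      then show "norm (LINT y|lborel. norm (F j y * \<psi> y)) \<le> A j * (LINT y|lborel. norm (\<psi> y))"
        by (simp add: integral_nonneg_AE)
    qed
  qed
  also have "(\<lambda>y. \<Sum>j. F j y * \<psi> y) = (\<lambda>y. f y * \<psi> y)"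
    using sums_mult2[OF Fsums] by (auto simp: fun_eq_iff sums_iff)
  finally show ?thesis .
qed

section \<open>Littlewood--Paley pieces\<close>

text \<open>On the frequency side a derivative is multiplication by a multiple of
  \<open>\<xi> \<bullet> b\<close>, which commutes with multiplication by
  \<open>\<kappa>\<close>.\<close>

lemma dir_deriv_fourier_mult_inv_fourier:
  fixes \<kappa> \<psi> :: "'a::euclidean_space \<Rightarrow> complex"
  assumes kap: "\<kappa> \<in> schwartz" and psi: "\<psi> \<in> schwartz" and b: "b \<in> Basis"
  shows "dir_deriv b (fourier (\<lambda>\<xi>. \<kappa> \<xi> * inv_fourier \<psi> \<xi>)) = fourier (\<lambda>\<xi>. \<kappa> \<xi> * inv_fourier (dir_deriv b \<psi>) \<xi>)"
proof -
  have "(\<lambda>\<xi>. \<kappa> \<xi> * inv_fourier \<psi> \<xi>) \<in> schwartz"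
    by (intro schwartz_mult inv_fourier_schwartz kap psi)
  moreover have "of_real (\<xi> \<bullet> b) * (- \<i> * (\<kappa> \<xi> * inv_fourier \<psi> \<xi>)) = \<kappa> \<xi> * inv_fourier (dir_deriv b \<psi>) \<xi>" for \<xi>
  proof -
    have "of_real ((- \<xi>) \<bullet> b) * fourier \<psi> (- \<xi>) = - \<i> * fourier (dir_deriv b \<psi>) (- \<xi>)"
      by (simp only: inner_fourier[OF psi b] fourier_cmult)
    then have "\<i> * (of_real (\<xi> \<bullet> b) * inv_fourier \<psi> \<xi>) = \<i> * (\<i> * inv_fourier (dir_deriv b \<psi>) \<xi>)"
      by (simp add: inv_fourier_eq)
    then have "- \<i> * (of_real (\<xi> \<bullet> b) * inv_fourier \<psi> \<xi>) = inv_fourier (dir_deriv b \<psi>) \<xi>"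
      by simp
    then have "\<kappa> \<xi> * (- \<i> * (of_real (\<xi> \<bullet> b) * inv_fourier \<psi> \<xi>)) = \<kappa> \<xi> * inv_fourier (dir_deriv b \<psi>) \<xi>"
      by (rule arg_cong)
    then show ?thesis by (simp only: mult_ac)
  qed
  ultimately show ?thesis
    by (simp only: dir_deriv_fourier)
qed

lemma iter_deriv_fourier_mult_inv_fourier:
  fixes \<kappa> \<psi> :: "'a::euclidean_space \<Rightarrow> complex"
  assumes "\<kappa> \<in> schwartz" "\<psi> \<in> schwartz" "set bs \<subseteq> Basis"
  shows "iter_deriv bs (fourier (\<lambda>\<xi>. \<kappa> \<xi> * inv_fourier \<psi> \<xi>)) = fourier (\<lambda>\<xi>. \<kappa> \<xi> * inv_fourier (iter_deriv bs \<psi>) \<xi>)"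
  using assms(3) by (induction bs) (auto simp: dir_deriv_fourier_mult_inv_fourier assms schwartz_iter_deriv)

lemma iter_deriv_cmult:
  assumes "f \<in> schwartz" "set bs \<subseteq> Basis"
  shows "iter_deriv bs (\<lambda>x. a * f x) = (\<lambda>x. a * iter_deriv bs f x)"
  using assms(2) by (induction bs) (auto simp: dir_deriv_cmult schwartz_iter_deriv assms)

text \<open>Mean value inequality on the segment from \<open>x - z\<close> to \<open>x\<close>: its
  points \<open>y\<close> satisfy \<open>norm (x - y) \<le> norm z\<close>, so Peetre's inequality
  compares the weights at \<open>y\<close> and \<open>x\<close> at the cost of
  \<open>(1 + norm z) ^ N\<close>.\<close>

lemma schwartz_lipschitz_decay:
  fixes \<eta> :: "'a::euclidean_space \<Rightarrow> complex"
  assumes eta: "\<eta> \<in> schwartz"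
  obtains C where "C \<ge> 0"
    "\<And>x z. (1 + norm x) ^ N * norm (\<eta> (x - z) - \<eta> x) \<le> C * norm z * (1 + norm z) ^ N"
proof -
  obtain C where C: "C \<ge> 0"
    "\<And>x v. norm (\<Sum>b\<in>Basis. (v \<bullet> b) *\<^sub>R dir_deriv b \<eta> x) \<le> C / (1 + norm x) ^ N * norm v"
    using schwartz_derivative_decay[OF eta] by blast
  have "(1 + norm x) ^ N * norm (\<eta> (x - z) - \<eta> x) \<le> C * norm z * (1 + norm z) ^ N" for x z
  proof -
    let ?B = "C * ((1 + norm z) ^ N * (1 / (1 + norm x) ^ N))"
    have "norm (\<eta> (x - z) - \<eta> x) \<le> ?B * norm ((x - z) - x)"
    proof (rule differentiable_bound[of "closed_segment (x - z) x"])
      show "(\<eta> has_derivative (\<lambda>v. \<Sum>b\<in>Basis. (v \<bullet> b) *\<^sub>R dir_deriv b \<eta> y)) (at y within closed_segment (x - z) x)" for y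
        using schwartz_has_derivative[OF eta] by (rule has_derivative_at_withinI)
      fix y assume y: "y \<in> closed_segment (x - z) x"
      have "norm (x - y) \<le> norm (x - z - x)"
        using segment_bound(2)[OF y] by (simp add: norm_minus_commute)
      then have "1 + norm x \<le> (1 + norm y) * (1 + norm z)"
        using one_plus_norm_shift[of x "x - y"]
        by (intro order_trans[OF one_plus_norm_shift[of x "x - y"]] mult_mono) auto
      then have "1 / (1 + norm y) ^ N \<le> (1 + norm z) ^ N * (1 / (1 + norm x) ^ N)"
        by (intro inverse_power_le_mult) auto
      from mult_left_mono[OF this C(1)] have "C / (1 + norm y) ^ N \<le> ?B" by simp
      then show "onorm (\<lambda>v. \<Sum>b\<in>Basis. (v \<bullet> b) *\<^sub>R dir_deriv b \<eta> y) \<le> ?B"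
        using C(2)[of _ y] by (intro onorm_le) (meson mult_right_mono norm_ge_zero order_trans)
    qed auto
    then have "(1 + norm x) ^ N * norm (\<eta> (x - z) - \<eta> x) \<le> (1 + norm x) ^ N * (?B * norm z)"
      by (intro mult_left_mono) auto
    then show ?thesis by (simp add: mult_ac)
  qed
  with C(1) show ?thesis using that by blast
qed

text \<open>A tempered distribution is continuous for convergence of all weighted derivatives, so
  the approximate identity has to converge in that sense. Derivatives pass onto
  \<open>\<psi>\<close>, and the error is the integral of
  \<open>(\<eta> (x - r n *\<^sub>R z) - \<eta> x) * K z\<close>, which even with the weight is of
  order \<open>r n\<close> uniformly in \<open>x\<close>.\<close>

lemma multiplier_schwartz_converges:
  fixes \<kappa> \<psi> :: "'a::euclidean_space \<Rightarrow> complex"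
  assumes kap: "\<kappa> \<in> schwartz" and psi: "\<psi> \<in> schwartz"
    and c: "(LINT z|lborel. of_real ((2 * pi) powr (- real DIM('a) / 2)) * fourier \<kappa> z) = c"
    and r: "\<And>n. 0 < r n" "\<And>n. r n \<le> 1" "r \<longlonglongrightarrow> 0"
  shows "schwartz_converges (\<lambda>n. fourier (\<lambda>\<xi>. \<kappa> (r n *\<^sub>R \<xi>) * inv_fourier \<psi> \<xi>)) (\<lambda>x. c * \<psi> x)"
  unfolding schwartz_converges_def
proof (intro allI impI)
  fix N and bs :: "'a list" assume bs: "set bs \<subseteq> Basis"
  define \<eta> where "\<eta> = iter_deriv bs \<psi>"
  have eta: "\<eta> \<in> schwartz" unfolding \<eta>_def by (intro schwartz_iter_deriv psi bs)
  define K where "K z = complex_of_real ((2 * pi) powr (- real DIM('a) / 2)) * fourier \<kappa> z" for z :: 'a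
  have K: "K \<in> schwartz" unfolding K_def[abs_def] by (intro schwartz_cmult fourier_schwartz kap)
  note [measurable] = schwartz_measurable[OF eta] schwartz_measurable[OF K]
  obtain C where C: "C \<ge> 0"
    "\<And>x z. (1 + norm x) ^ N * norm (\<eta> (x - z) - \<eta> x) \<le> C * norm z * (1 + norm z) ^ N"
    using schwartz_lipschitz_decay[OF eta] by blast
  define J where "J = (LINT z|lborel. (1 + norm z) ^ Suc N * norm (K z))"
  have J: "J \<ge> 0" unfolding J_def by (intro integral_nonneg_AE) auto
  have kr: "(\<lambda>\<xi>. \<kappa> (r n *\<^sub>R \<xi>)) \<in> schwartz" for n
    using schwartz_scale[OF kap, of "r n" 0] r(1)[of n] by simp
  obtain B where B: "\<And>x. norm (\<eta> x) \<le> B" using schwartz_bounded[OF eta] by blast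
  have int: "integrable lborel (\<lambda>z. \<eta> (x - r n *\<^sub>R z) * K z)" for x n
    by (rule integrable_schwartz_mult[OF _ B K]) measurable
  have bound: "norm ((1 + norm x) ^ N *\<^sub>R iter_deriv bs (fourier (\<lambda>\<xi>. \<kappa> (r n *\<^sub>R \<xi>) * inv_fourier \<psi> \<xi>)) x
      - (1 + norm x) ^ N *\<^sub>R iter_deriv bs (\<lambda>x. c * \<psi> x) x) \<le> r n * (C * J)" for n x
  proof -
    have "iter_deriv bs (fourier (\<lambda>\<xi>. \<kappa> (r n *\<^sub>R \<xi>) * inv_fourier \<psi> \<xi>)) x = (LINT z|lborel. \<eta> (x - r n *\<^sub>R z) * K z)"
      unfolding iter_deriv_fourier_mult_inv_fourier[OF kr psi bs] \<eta>_def[symmetric]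
      by (simp add: fourier_mult_inv_fourier_scaled[OF kap eta r(1)] K_def)
    moreover have "iter_deriv bs (\<lambda>x. c * \<psi> x) x = (LINT z|lborel. \<eta> x * K z)"
      using c by (simp add: iter_deriv_cmult[OF psi bs] \<eta>_def K_def)
    ultimately have "(1 + norm x) ^ N *\<^sub>R iter_deriv bs (fourier (\<lambda>\<xi>. \<kappa> (r n *\<^sub>R \<xi>) * inv_fourier \<psi> \<xi>)) x
      - (1 + norm x) ^ N *\<^sub>R iter_deriv bs (\<lambda>x. c * \<psi> x) x
      = (1 + norm x) ^ N *\<^sub>R (LINT z|lborel. (\<eta> (x - r n *\<^sub>R z) - \<eta> x) * K z)"
      using int schwartz_integrable[OF K] by (simp add: left_diff_distrib scaleR_diff_right)
    also have "\<dots> = (LINT z|lborel. (1 + norm x) ^ N *\<^sub>R ((\<eta> (x - r n *\<^sub>R z) - \<eta> x) * K z))"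
      by simp
    also have "norm \<dots> \<le> (LINT z|lborel. (r n * C) * ((1 + norm z) ^ Suc N * norm (K z)))"
    proof (rule Bochner_Integration.integral_norm_bound_integral)
      show "integrable lborel (\<lambda>z. (1 + norm x) ^ N *\<^sub>R ((\<eta> (x - r n *\<^sub>R z) - \<eta> x) * K z))"
        using int schwartz_integrable[OF K] by (simp add: left_diff_distrib)
      show "integrable lborel (\<lambda>z. (r n * C) * ((1 + norm z) ^ Suc N * norm (K z)))"
        by (intro integrable_mult_right schwartz_norm_power_integrable K)
      fix z
      have "(1 + norm x) ^ N * norm (\<eta> (x - r n *\<^sub>R z) - \<eta> x) \<le> C * norm (r n *\<^sub>R z) * (1 + norm (r n *\<^sub>R z)) ^ N"
        by (rule C)
      also have "\<dots> \<le> C * (r n * (1 + norm z)) * (1 + norm z) ^ N"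
        using r(1,2)[of n] C(1) mult_right_mono[OF r(2)[of n] norm_ge_zero[of z]]
        by (intro mult_mono mult_left_mono power_mono) auto
      finally have "(1 + norm x) ^ N * norm (\<eta> (x - r n *\<^sub>R z) - \<eta> x) * norm (K z) \<le> C * (r n * (1 + norm z)) * (1 + norm z) ^ N * norm (K z)"
        by (rule mult_right_mono) simp
      then show "norm ((1 + norm x) ^ N *\<^sub>R ((\<eta> (x - r n *\<^sub>R z) - \<eta> x) * K z)) \<le> (r n * C) * ((1 + norm z) ^ Suc N * norm (K z))"
        by (simp add: norm_mult mult_ac)
    qed
    also have "\<dots> = r n * (C * J)" by (simp add: J_def)
    finally show ?thesis .
  qed
  show "uniform_limit UNIV (\<lambda>n x. (1 + norm x) ^ N *\<^sub>R iter_deriv bs (fourier (\<lambda>\<xi>. \<kappa> (r n *\<^sub>R \<xi>) * inv_fourier \<psi> \<xi>)) x)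
    (\<lambda>x. (1 + norm x) ^ N *\<^sub>R iter_deriv bs (\<lambda>x. c * \<psi> x) x) sequentially"
  proof (rule uniform_limitI)
    fix e :: real assume "e > 0"
    have "(\<lambda>n. r n * (C * J)) \<longlonglongrightarrow> 0 * (C * J)"
      by (intro tendsto_intros r)
    then have "\<forall>\<^sub>F n in sequentially. r n * (C * J) < e"
      using \<open>e > 0\<close> order_tendstoD(2) by fastforce
    then show "\<forall>\<^sub>F n in sequentially. \<forall>x\<in>UNIV. dist ((1 + norm x) ^ N *\<^sub>R iter_deriv bs (fourier (\<lambda>\<xi>. \<kappa> (r n *\<^sub>R \<xi>) * inv_fourier \<psi> \<xi>)) x)
        ((1 + norm x) ^ N *\<^sub>R iter_deriv bs (\<lambda>x. c * \<psi> x) x) < e"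
      by eventually_elim (auto simp: dist_norm intro: le_less_trans[OF bound])
  qed
qed

definition besov_piece ::
    "('a::euclidean_space \<Rightarrow> complex) \<Rightarrow> nat \<Rightarrow> (('a \<Rightarrow> complex) \<Rightarrow> complex) \<Rightarrow> ('a \<Rightarrow> complex) \<Rightarrow> complex" where
  "besov_piece \<phi> j T = dist_inv_fourier (dist_mult (dyadic \<phi> j) (dist_fourier T))"

lemma besov_piece_eq:
  assumes "besov_cutoff \<phi>" "\<psi> \<in> schwartz"
  shows "besov_piece \<phi> j T \<psi> = T (fourier (\<lambda>\<xi>. dyadic \<phi> j \<xi> * inv_fourier \<psi> \<xi>))"
  using assms schwartz_mult[OF dyadic_schwartz[OF assms(1)] inv_fourier_schwartz[OF assms(2)]]
  by (simp add: besov_piece_def dist_inv_fourier_def dist_mult_def dist_fourier_def inv_fourier_schwartz)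

lemma besov_piece_notin: "\<psi> \<notin> schwartz \<Longrightarrow> besov_piece \<phi> j T \<psi> = 0"
  by (simp add: besov_piece_def dist_inv_fourier_def)

lemma tempered_linear:
  "T \<in> tempered \<Longrightarrow> \<psi> \<in> schwartz \<Longrightarrow> \<eta> \<in> schwartz \<Longrightarrow> T (\<lambda>x. a * \<psi> x + b * \<eta> x) = a * T \<psi> + b * T \<eta>"
  by (simp add: tempered_def)

lemma tempered_cmult: "T \<in> tempered \<Longrightarrow> \<psi> \<in> schwartz \<Longrightarrow> T (\<lambda>x. a * \<psi> x) = a * T \<psi>"
  using tempered_linear[of T \<psi> \<psi> a 0] by simp

lemma tempered_0: "T \<in> tempered \<Longrightarrow> T (\<lambda>x. 0) = 0"
  using tempered_cmult[OF _ schwartz_0, of T 0] by simp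

lemma tempered_add: "T \<in> tempered \<Longrightarrow> \<psi> \<in> schwartz \<Longrightarrow> \<eta> \<in> schwartz \<Longrightarrow> T (\<lambda>x. \<psi> x + \<eta> x) = T \<psi> + T \<eta>"
  using tempered_linear[of T \<psi> \<eta> 1 1] by simp

lemma tempered_sum:
  assumes "T \<in> tempered" "finite I" "\<And>i. i \<in> I \<Longrightarrow> f i \<in> schwartz"
  shows "T (\<lambda>x. \<Sum>i\<in>I. f i x) = (\<Sum>i\<in>I. T (f i))"
  using assms(2,3)
proof (induction I rule: finite_induct)
  case (insert i I)
  have "T (\<lambda>x. f i x + (\<Sum>j\<in>I. f j x)) = T (f i) + T (\<lambda>x. \<Sum>j\<in>I. f j x)"
    using insert by (intro tempered_add assms(1) schwartz_sum) auto
  then show ?case using insert by simp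
qed (simp add: tempered_0[OF assms(1)])

lemma tempered_continuous:
  "T \<in> tempered \<Longrightarrow> (\<And>k. F k \<in> schwartz) \<Longrightarrow> f \<in> schwartz \<Longrightarrow> schwartz_converges F f \<Longrightarrow> (\<lambda>k. T (F k)) \<longlonglongrightarrow> T f"
  by (simp add: tempered_def)

lemma fourier_sum:
  assumes "finite I" "\<And>i. i \<in> I \<Longrightarrow> f i \<in> schwartz"
  shows "fourier (\<lambda>x. \<Sum>i\<in>I. f i x) \<xi> = (\<Sum>i\<in>I. fourier (f i) \<xi>)"
proof -
  have "integrable lborel (\<lambda>x. exp (- (\<i> * of_real (x \<bullet> \<xi>))) * f i x)" if "i \<in> I" for i
    by (rule integrable_schwartz_mult[where B = 1]) (auto intro: assms that)
  then show ?thesis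
    by (simp add: fourier_eq sum_distrib_left)
qed

text \<open>The partial sums telescope to the single multiplier
  \<open>\<phi> (r n *\<^sub>R \<xi>)\<close> with \<open>r n = 2 powr (- n)\<close>, an approximate
  identity up to its mass \<open>c\<close>.\<close>

lemma besov_pieces_tendsto:
  fixes \<phi> :: "'a::euclidean_space \<Rightarrow> complex"
  assumes phi: "besov_cutoff \<phi>" and T: "T \<in> tempered" and psi: "\<psi> \<in> schwartz"
    and c: "(LINT z|lborel. of_real ((2 * pi) powr (- real DIM('a) / 2)) * fourier \<phi> z) = c"
  shows "(\<lambda>n. \<Sum>j\<le>n. besov_piece \<phi> j T \<psi>) \<longlonglongrightarrow> c * T \<psi>"
proof -
  define r :: "nat \<Rightarrow> real" where "r n = 2 powr (- real n)" for n
  have r: "0 < r n" "r n \<le> 1" for n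
    using powr_mono[of "- real n" 0 2] by (auto simp: r_def)
  have "r = (\<lambda>n. (1/2) ^ n)"
    by (simp add: r_def fun_eq_iff powr_minus powr_realpow power_one_over inverse_eq_divide)
  then have r0: "r \<longlonglongrightarrow> 0" by (simp add: LIMSEQ_power_zero)
  have s: "(\<lambda>\<xi>. dyadic \<phi> j \<xi> * inv_fourier \<psi> \<xi>) \<in> schwartz" for j
    by (intro schwartz_mult dyadic_schwartz phi inv_fourier_schwartz psi)
  have "(\<Sum>j\<le>n. besov_piece \<phi> j T \<psi>) = T (fourier (\<lambda>\<xi>. \<phi> (r n *\<^sub>R \<xi>) * inv_fourier \<psi> \<xi>))" for n
  proof -
    have "(\<Sum>j\<le>n. besov_piece \<phi> j T \<psi>) = T (\<lambda>x. \<Sum>j\<le>n. fourier (\<lambda>\<xi>. dyadic \<phi> j \<xi> * inv_fourier \<psi> \<xi>) x)"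
      by (subst tempered_sum[OF T]) (auto simp: besov_piece_eq[OF phi psi] fourier_schwartz s)
    also have "(\<lambda>x. \<Sum>j\<le>n. fourier (\<lambda>\<xi>. dyadic \<phi> j \<xi> * inv_fourier \<psi> \<xi>) x)
        = fourier (\<lambda>\<xi>. \<Sum>j\<le>n. dyadic \<phi> j \<xi> * inv_fourier \<psi> \<xi>)"
      by (rule HOL.ext, subst fourier_sum) (auto simp: s)
    also have "(\<lambda>\<xi>. \<Sum>j\<le>n. dyadic \<phi> j \<xi> * inv_fourier \<psi> \<xi>) = (\<lambda>\<xi>. \<phi> (r n *\<^sub>R \<xi>) * inv_fourier \<psi> \<xi>)"
      by (simp add: sum_distrib_right[symmetric] sum_dyadic r_def)
    finally show ?thesis .
  qed
  moreover have "(\<lambda>n. T (fourier (\<lambda>\<xi>. \<phi> (r n *\<^sub>R \<xi>) * inv_fourier \<psi> \<xi>))) \<longlonglongrightarrow> T (\<lambda>x. c * \<psi> x)"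
  proof (rule tempered_continuous[OF T])
    show "fourier (\<lambda>\<xi>. \<phi> (r k *\<^sub>R \<xi>) * inv_fourier \<psi> \<xi>) \<in> schwartz" for k
      using schwartz_scale[OF besov_cutoff_schwartz[OF phi], of "r k" 0] r(1)[of k]
      by (intro fourier_schwartz schwartz_mult inv_fourier_schwartz psi) auto
    show "schwartz_converges (\<lambda>n. fourier (\<lambda>\<xi>. \<phi> (r n *\<^sub>R \<xi>) * inv_fourier \<psi> \<xi>)) (\<lambda>x. c * \<psi> x)"
      by (rule multiplier_schwartz_converges) (use besov_cutoff_schwartz[OF phi] psi c r r0 in auto)
  qed (intro schwartz_cmult psi)
  ultimately show ?thesis by (simp add: tempered_cmult[OF T psi])
qed

lemma iter_deriv_replicate_scale:
  fixes M :: "'a::euclidean_space \<Rightarrow> complex"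
  assumes M: "M \<in> schwartz" and b: "b \<in> Basis" and r: "r \<noteq> 0"
  shows "iter_deriv (replicate n b) (\<lambda>x. M (r *\<^sub>R x + a)) = (\<lambda>x. of_real (r ^ n) * iter_deriv (replicate n b) M (r *\<^sub>R x + a))"
proof (induction n)
  case (Suc n)
  have N: "iter_deriv (replicate n b) M \<in> schwartz"
    using b by (intro schwartz_iter_deriv M) auto
  show ?case
    using Suc r by (simp add: dir_deriv_cmult schwartz_scale N dir_deriv_scale[OF N] mult_ac)
qed simp

text \<open>\<open>dyadic \<phi> j\<close> vanishes for \<open>norm \<xi> \<ge> 3/2 * 2 ^ j\<close>,
  while the widened cut-off is \<open>1\<close> up to \<open>2 * 2 ^ j\<close>. This is the source
  of the reproducing formula for the pieces.\<close>

lemma dyadic_mult_cutoff: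
  fixes \<phi> :: "'a::euclidean_space \<Rightarrow> complex"
  assumes phi: "besov_cutoff \<phi>"
  shows "dyadic \<phi> j \<xi> * \<phi> ((1/2) *\<^sub>R (inverse (2 ^ j) *\<^sub>R \<xi>)) = dyadic \<phi> j \<xi>"
proof (cases "norm \<xi> \<le> 2 * 2 ^ j")
  case True
  then have "norm ((1/2) *\<^sub>R (inverse (2 ^ j) *\<^sub>R \<xi>)) \<le> 1"
    by (simp add: field_simps)
  then have "\<phi> ((1/2) *\<^sub>R (inverse (2 ^ j) *\<^sub>R \<xi>)) = 1"
    using phi unfolding besov_cutoff_def by blast
  then show ?thesis by simp
next
  case False
  have 0: "\<phi> (a *\<^sub>R \<xi>) = 0" if "a \<ge> inverse (2 ^ j)" for a
  proof -
    have "3/2 * 2 ^ j \<le> norm \<xi>" using False zero_le_power[of "2::real" j] by linarith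
    then have "3/2 \<le> inverse (2 ^ j) * norm \<xi>" by (simp add: field_simps)
    also have "\<dots> \<le> a * norm \<xi>" using that by (intro mult_right_mono) auto
    finally have "norm (a *\<^sub>R \<xi>) \<ge> 3/2"
      using order_trans[OF _ that, of 0] by simp
    then show ?thesis using phi unfolding besov_cutoff_def by blast
  qed
  have "inverse (2 ^ j) = 2 powr (- real j)" by (simp add: powr_minus powr_realpow)
  moreover have "inverse (2 ^ j) \<le> 2 powr (- real j + 1)" unfolding calculation by simp
  ultimately have "\<phi> (2 powr (- real j) *\<^sub>R \<xi>) = 0" "\<phi> (2 powr (- real j + 1) *\<^sub>R \<xi>) = 0"
    using 0 by auto
  then have "dyadic \<phi> j \<xi> = 0" by (cases "j = 0") (simp_all add: dyadic_def)
  then show ?thesis by simp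
qed

text \<open>A piece is at first known only as a bounded measurable function. Since a widened cut-off
  reproduces it, it is also a correlation with a Schwartz kernel dilated by \<open>2 ^ j\<close>,
  hence smooth, and each derivative costs a factor \<open>2 ^ j\<close> in the integral of the
  modulus of the kernel. \<open>C\<close> is fixed before \<open>T\<close>, which makes the later
  estimates uniform.\<close>

lemma besov_analysis:
  fixes \<phi> :: "'a::euclidean_space \<Rightarrow> complex"
  assumes phi: "besov_cutoff \<phi>" and b: "b \<in> Basis"
  obtains C :: "nat \<Rightarrow> real" where "\<And>T. T \<in> tempered \<Longrightarrow> (\<And>j. Linf_norm (besov_piece \<phi> j T) < \<infinity>) \<Longrightarrow>
      summable (\<lambda>j. enn2real (Linf_norm (besov_piece \<phi> j T))) \<Longrightarrow>
      \<exists>f G. is_cont_rep T f \<and> (\<forall>j n t. (G j n has_vector_derivative G j (Suc n) t) (at t)) \<and>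
        (\<forall>j n t. norm (G j n t) \<le> C n * 2 ^ (j * n) * enn2real (Linf_norm (besov_piece \<phi> j T))) \<and>
        (\<forall>t. (\<lambda>j. G j 0 t) sums f (t *\<^sub>R b))"
proof -
  let ?k = "complex_of_real ((2 * pi) powr (- real DIM('a) / 2))"
  note phiS = besov_cutoff_schwartz[OF phi]
  obtain c where c0: "c \<noteq> 0"
    and inv: "\<And>\<psi> x. \<psi> \<in> schwartz \<Longrightarrow> fourier (inv_fourier \<psi>) x = c * \<psi> (x::'a)"
    and inv2: "\<And>\<psi> x. \<psi> \<in> schwartz \<Longrightarrow> inv_fourier (fourier \<psi>) x = c * \<psi> (x::'a)"
    and mass: "\<And>\<kappa>. \<kappa> \<in> schwartz \<Longrightarrow> (LINT z|lborel. ?k * fourier \<kappa> z) = c * \<kappa> (0::'a)"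
    using fourier_inversion[OF phiS besov_cutoff_0[OF phi]] by blast
  define \<kappa> where "\<kappa> \<xi> = \<phi> ((1/2) *\<^sub>R \<xi>)" for \<xi>
  have kap: "\<kappa> \<in> schwartz"
    unfolding \<kappa>_def[abs_def] using schwartz_scale[OF phiS, of "1/2" 0] by simp
  define M where "M z = ?k * fourier \<kappa> z" for z
  have M: "M \<in> schwartz" unfolding M_def[abs_def] by (intro schwartz_cmult fourier_schwartz kap)
  \<comment> \<open>The kernel of the multiplier
    \<open>\<kappa> (inverse (2 ^ j) *\<^sub>R \<xi>)\<close>; the factor in front preserves the
    integral of the modulus of \<open>M\<close>.\<close>
  define M' where "M' j z = of_real (2 ^ (j * DIM('a))) * M (2 ^ j *\<^sub>R z)" for j :: nat and z
  have M': "M' j \<in> schwartz" for j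
    unfolding M'_def[abs_def] using schwartz_scale[OF M, of "2 ^ j" 0] by (intro schwartz_cmult) simp
  define D where "D n = iter_deriv (replicate n b) M" for n
  have D: "D n \<in> schwartz" for n unfolding D_def using b by (intro schwartz_iter_deriv M) auto
  define D' where "D' j n = iter_deriv (replicate n b) (M' j)" for j n
  have D': "D' j n \<in> schwartz" for j n unfolding D'_def using b by (intro schwartz_iter_deriv M') auto
  have D'_eq: "D' j n = (\<lambda>z. of_real (2 ^ (j * DIM('a)) * 2 ^ (j * n)) * D n (2 ^ j *\<^sub>R z))" for j n
  proof -
    have "M' j = (\<lambda>z. of_real (2 ^ (j * DIM('a))) * M (2 ^ j *\<^sub>R z + 0))"
      by (simp add: M'_def fun_eq_iff)
    then have "D' j n = (\<lambda>z. of_real (2 ^ (j * DIM('a))) * iter_deriv (replicate n b) (\<lambda>z. M (2 ^ j *\<^sub>R z + 0)) z)"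
      unfolding D'_def using b by (simp only:) (rule iter_deriv_cmult, rule schwartz_scale, auto simp: M)
    then show ?thesis
      by (simp add: iter_deriv_replicate_scale[OF M b, of "2 ^ j" n 0, simplified] D_def power_mult mult.assoc)
  qed
  have D'_int: "(LINT z|lborel. norm (D' j n z)) = 2 ^ (j * n) * (LINT z|lborel. norm (D n z))" for j n
  proof -
    have [measurable]: "D n \<in> borel_measurable borel" using schwartz_measurable[OF D] .
    have "(LINT z|lborel. norm (D n z)) = \<bar>2 ^ j\<bar> ^ DIM('a) *\<^sub>R (LINT z|lborel. norm (D n (0 + 2 ^ j *\<^sub>R z)))"
      by (rule lborel_integral_affine) auto
    moreover have "norm (D' j n z) = 2 ^ (j * DIM('a)) * 2 ^ (j * n) * norm (D n (2 ^ j *\<^sub>R z))" for z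
      by (simp add: D'_eq norm_mult norm_power)
    ultimately show ?thesis by (simp add: power_mult[symmetric])
  qed
  define Q where "Q j \<psi> = fourier (\<lambda>\<xi>. \<kappa> (inverse (2 ^ j) *\<^sub>R \<xi>) * inv_fourier \<psi> \<xi>)" for j :: nat and \<psi>
  have kapj: "(\<lambda>\<xi>. \<kappa> (inverse (2 ^ j) *\<^sub>R \<xi>)) \<in> schwartz" for j :: nat
    using schwartz_scale[OF kap, of "inverse (2 ^ j)" 0] by simp
  have Q: "Q j \<psi> \<in> schwartz" if "\<psi> \<in> schwartz" for j \<psi>
    unfolding Q_def by (intro fourier_schwartz schwartz_mult kapj inv_fourier_schwartz that)
  have Q_eq: "Q j \<psi> x = (LINT y|lborel. \<psi> y * M' j (x - y))" if "\<psi> \<in> schwartz" for j \<psi> x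
    unfolding Q_def fourier_mult_inv_fourier[OF kapj that]
    by (simp add: fourier_scale[OF kap] M'_def M_def power_mult mult_ac)
  define C where "C n = norm (inverse c ^ 2) * (LINT z|lborel. norm (D n z))" for n
  show ?thesis
  proof (rule that[of C])
    fix T assume T: "T \<in> tempered" and fin: "\<And>j. Linf_norm (besov_piece \<phi> j T) < \<infinity>"
      and summ: "summable (\<lambda>j. enn2real (Linf_norm (besov_piece \<phi> j T)))"
    define a where "a j = enn2real (Linf_norm (besov_piece \<phi> j T))" for j
    define P where "P j = besov_piece \<phi> j T" for j
    \<comment> \<open>The widened cut-off is absorbed by \<open>dyadic \<phi> j\<close>; the factor
      \<open>c\<close> remains because \<open>inv_fourier\<close> undoes \<open>fourier\<close> only
      up to that constant.\<close>
    have PQ: "P j (Q j \<psi>) = c * P j \<psi>" if psi: "\<psi> \<in> schwartz" for j \<psi>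
    proof -
      have "dyadic \<phi> j \<xi> * inv_fourier (Q j \<psi>) \<xi> = c * (dyadic \<phi> j \<xi> * inv_fourier \<psi> \<xi>)" for \<xi>
      proof -
        have "inv_fourier (Q j \<psi>) \<xi> = c * (\<kappa> (inverse (2 ^ j) *\<^sub>R \<xi>) * inv_fourier \<psi> \<xi>)"
          unfolding Q_def by (rule inv2) (intro schwartz_mult kapj inv_fourier_schwartz psi)
        then have "dyadic \<phi> j \<xi> * inv_fourier (Q j \<psi>) \<xi>
            = c * ((dyadic \<phi> j \<xi> * \<kappa> (inverse (2 ^ j) *\<^sub>R \<xi>)) * inv_fourier \<psi> \<xi>)"
          by (simp add: mult_ac)
        then show ?thesis by (simp only: \<kappa>_def dyadic_mult_cutoff[OF phi])
      qed
      then have "P j (Q j \<psi>) = T (fourier (\<lambda>\<xi>. c * (dyadic \<phi> j \<xi> * inv_fourier \<psi> \<xi>)))"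
        by (simp only: P_def besov_piece_eq[OF phi Q[OF psi]])
      also have "fourier (\<lambda>\<xi>. c * (dyadic \<phi> j \<xi> * inv_fourier \<psi> \<xi>)) = (\<lambda>x. c * fourier (\<lambda>\<xi>. dyadic \<phi> j \<xi> * inv_fourier \<psi> \<xi>) x)"
        by (rule HOL.ext) (rule fourier_cmult)
      also have "T \<dots> = c * P j \<psi>"
        by (simp add: tempered_cmult[OF T] P_def besov_piece_eq[OF phi psi] fourier_schwartz
            schwartz_mult dyadic_schwartz phi inv_fourier_schwartz psi)
      finally show ?thesis .
    qed
    have "\<exists>g B. g \<in> borel_measurable borel \<and> P j = dist_of g \<and> (\<forall>x. norm (g x) \<le> B)" for j
      using Linf_norm_finite_rep[OF fin] unfolding P_def by metis
    then obtain g B where g: "\<And>j. g j \<in> borel_measurable borel" and Pg: "\<And>j. P j = dist_of (g j)"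
      and B: "\<And>j x. norm (g j x) \<le> B j" by metis
    have corr_P: "corr (g j) N y = P j (\<lambda>x. N (x - y))" if "N \<in> schwartz" for j N y
      using schwartz_translate[OF that] by (simp add: Pg dist_of_def corr_def)
    \<comment> \<open>The bound \<open>B j\<close> of the chosen representative may exceed the
      \<open>Linf_norm\<close>; reading the correlation as \<open>P j\<close> applied to translates
      of the kernel gives the factor \<open>a j\<close> instead.\<close>
    have corr_bd: "norm (corr (g j) N y) \<le> a j * (LINT z|lborel. norm (N z))" if N: "N \<in> schwartz" for j N y
    proof -
      have "norm (P j (\<lambda>x. N (x - y))) \<le> a j * (LINT x|lborel. norm (N (x - y)))"
        unfolding a_def P_def by (intro Linf_norm_bound fin schwartz_translate N)
      also have "(LINT x|lborel. norm (N (x - y))) = (LINT x|lborel. norm (N x))"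
        using lborel_integral_translate[of "\<lambda>x. norm (N x)" "- y"] schwartz_measurable[OF N] by simp
      finally show ?thesis by (simp add: corr_P[OF N])
    qed
    \<comment> \<open>One factor \<open>inverse c\<close> comes from
      \<open>P j (Q j \<psi>) = c * P j \<psi>\<close>, the other from the pieces summing to
      \<open>c * T \<psi>\<close>. The sign in \<open>G\<close> below cancels the minus that each
      derivative of \<open>corr\<close> produces.\<close>
    define F where "F j y = inverse c ^ 2 * corr (g j) (M' j) y" for j y
    define G where "G j n t = inverse c ^ 2 * ((-1) ^ n * corr (g j) (D' j n) (t *\<^sub>R b))" for j n t
    have FG: "F j (t *\<^sub>R b) = G j 0 t" for j t
      by (simp add: F_def G_def D'_def)
    have Fcont: "continuous_on UNIV (F j)" for j
      unfolding F_def[abs_def] by (intro continuous_intros corr_continuous[OF g B M'])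
    have [measurable]: "F j \<in> borel_measurable borel" for j
      using Fcont by (rule borel_measurable_continuous_onI)
    have Fbd: "norm (F j y) \<le> C 0 * a j" for j y
    proof -
      have "norm (F j y) \<le> norm (inverse c ^ 2) * (a j * (LINT z|lborel. norm (M' j z)))"
        unfolding F_def norm_mult by (intro mult_left_mono corr_bd M') auto
      also have "(LINT z|lborel. norm (M' j z)) = (LINT z|lborel. norm (D 0 z))"
        using D'_int[of j 0] by (simp add: D'_def)
      finally show ?thesis by (simp add: C_def mult_ac)
    qed
    have C0: "C 0 \<ge> 0" unfolding C_def by simp
    have a0: "a j \<ge> 0" for j by (simp add: a_def)
    have sa: "summable (\<lambda>j. C 0 * a j)" using summ unfolding a_def by (rule summable_mult)
    define f where "f y = (\<Sum>j. F j y)" for y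
    have Fsums: "(\<lambda>j. F j y) sums f y" for y
      unfolding f_def
      by (intro summable_sums summable_norm_cancel[OF summable_comparison_test'[OF sa]]) (simp add: Fbd)
    have ul: "uniform_limit UNIV (\<lambda>n y. \<Sum>j<n. F j y) f sequentially"
      unfolding f_def[abs_def] by (rule Weierstrass_m_test[OF Fbd sa])
    have fcont: "continuous_on UNIV f"
      by (rule uniform_limit_theorem[OF _ ul])
        (auto intro!: always_eventually continuous_on_sum continuous_on_subset[OF Fcont])
    have fbd: "norm (f y) \<le> (\<Sum>j. C 0 * a j)" for y
    proof -
      have "summable (\<lambda>j. norm (F j y))"
        by (rule summable_comparison_test'[OF sa]) (simp add: Fbd)
      then show ?thesis unfolding f_def
        by (intro order_trans[OF summable_norm] suminf_le sa Fbd) auto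
    qed
    have Tf: "T = dist_of f"
    proof
      fix \<psi>
      show "T \<psi> = dist_of f \<psi>"
      proof (cases "\<psi> \<in> schwartz")
        case False
        then show ?thesis using T by (simp add: tempered_def dist_of_def)
      next
        case psi: True
        have P_F: "P j \<psi> = c * (LINT y|lborel. F j y * \<psi> y)" for j
        proof -
          have "c * P j \<psi> = (LINT x|lborel. g j x * (LINT y|lborel. \<psi> y * M' j (x - y)))"
            using PQ[OF psi, of j] Q[OF psi, of j] by (simp add: Pg dist_of_def Q_eq[OF psi])
          also have "\<dots> = (LINT y|lborel. corr (g j) (M' j) y * \<psi> y)"
            by (rule fubini_corr[OF g B psi M'])
          also have "\<dots> = (LINT y|lborel. c ^ 2 * (F j y * \<psi> y))"
            using c0 by (intro Bochner_Integration.integral_cong) (auto simp: F_def power_inverse)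
          finally have "c * P j \<psi> = c * (c * (LINT y|lborel. F j y * \<psi> y))"
            by (simp add: power2_eq_square mult.assoc)
          then show ?thesis using c0 by simp
        qed
        have "(\<lambda>n. \<Sum>j\<le>n. P j \<psi>) \<longlonglongrightarrow> c * T \<psi>"
          unfolding P_def by (rule besov_pieces_tendsto[OF phi T psi]) (use mass[OF phiS] besov_cutoff_0[OF phi] in simp)
        then have "(\<lambda>j. P j \<psi>) sums (c * T \<psi>)"
          by (simp add: sums_def_le)
        then have "(\<lambda>j. inverse c * P j \<psi>) sums (inverse c * (c * T \<psi>))"
          by (rule sums_mult)
        then have 1: "(\<lambda>j. LINT y|lborel. F j y * \<psi> y) sums T \<psi>"
          using c0 by (simp add: P_F mult.assoc[symmetric])
        have "(\<lambda>j. LINT y|lborel. F j y * \<psi> y) sums (LINT y|lborel. f y * \<psi> y)"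
          by (rule sums_integral_schwartz[OF _ Fbd sa Fsums psi]) measurable
        from sums_unique2[OF 1 this] psi show ?thesis by (simp add: dist_of_def)
      qed
    qed
    have "is_cont_rep T f"
      unfolding is_cont_rep_def bounded_iff using fcont fbd Tf by auto
    moreover have "(G j n has_vector_derivative G j (Suc n) t) (at t)" for j n t
    proof -
      have "((\<lambda>t. t *\<^sub>R b) has_derivative (\<lambda>s. s *\<^sub>R b)) (at t)"
        by (auto intro!: derivative_eq_intros)
      from has_derivative_compose[OF this corr_has_derivative[OF g B D']]
      have "((\<lambda>t. corr (g j) (D' j n) (t *\<^sub>R b)) has_derivative
          (\<lambda>s. - (\<Sum>e\<in>Basis. ((s *\<^sub>R b) \<bullet> e) *\<^sub>R corr (g j) (dir_deriv e (D' j n)) (t *\<^sub>R b)))) (at t)" .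
      also have "(\<lambda>s. - (\<Sum>e\<in>Basis. ((s *\<^sub>R b) \<bullet> e) *\<^sub>R corr (g j) (dir_deriv e (D' j n)) (t *\<^sub>R b)))
          = (\<lambda>s. s *\<^sub>R (- corr (g j) (D' j (Suc n)) (t *\<^sub>R b)))"
      proof
        fix s
        have "(\<Sum>e\<in>Basis. ((s *\<^sub>R b) \<bullet> e) *\<^sub>R corr (g j) (dir_deriv e (D' j n)) (t *\<^sub>R b))
            = (\<Sum>e\<in>Basis. if e = b then s *\<^sub>R corr (g j) (dir_deriv e (D' j n)) (t *\<^sub>R b) else 0)"
          using b by (intro sum.cong) (auto simp: inner_Basis)
        also have "\<dots> = s *\<^sub>R corr (g j) (D' j (Suc n)) (t *\<^sub>R b)"
          using b by (simp add: D'_def)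
        finally show "- (\<Sum>e\<in>Basis. ((s *\<^sub>R b) \<bullet> e) *\<^sub>R corr (g j) (dir_deriv e (D' j n)) (t *\<^sub>R b))
          = s *\<^sub>R (- corr (g j) (D' j (Suc n)) (t *\<^sub>R b))" by simp
      qed
      finally have "((\<lambda>t. corr (g j) (D' j n) (t *\<^sub>R b)) has_vector_derivative - corr (g j) (D' j (Suc n)) (t *\<^sub>R b)) (at t)"
        by (simp add: has_vector_derivative_def)
      then have "((\<lambda>t. (inverse c ^ 2 * (-1) ^ n) * corr (g j) (D' j n) (t *\<^sub>R b)) has_vector_derivative
          (inverse c ^ 2 * (-1) ^ n) * (- corr (g j) (D' j (Suc n)) (t *\<^sub>R b))) (at t)"
        by (rule has_vector_derivative_mult_right)
      then show ?thesis by (simp add: G_def[abs_def] mult.assoc)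
    qed
    moreover have "norm (G j n t) \<le> C n * 2 ^ (j * n) * a j" for j n t
    proof -
      have "norm (G j n t) = norm (inverse c ^ 2) * norm (corr (g j) (D' j n) (t *\<^sub>R b))"
        by (simp add: G_def norm_mult norm_power)
      also have "\<dots> \<le> norm (inverse c ^ 2) * (a j * (2 ^ (j * n) * (LINT z|lborel. norm (D n z))))"
        unfolding D'_int[symmetric] by (intro mult_left_mono corr_bd D') auto
      finally show ?thesis by (simp add: C_def mult_ac)
    qed
    moreover have "(\<lambda>j. G j 0 t) sums f (t *\<^sub>R b)" for t
      using Fsums[of "t *\<^sub>R b"] by (simp add: FG)
    ultimately show "\<exists>f G. is_cont_rep T f \<and> (\<forall>j n t. (G j n has_vector_derivative G j (Suc n) t) (at t)) \<and>
        (\<forall>j n t. norm (G j n t) \<le> C n * 2 ^ (j * n) * enn2real (Linf_norm (besov_piece \<phi> j T))) \<and>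
        (\<forall>t. (\<lambda>j. G j 0 t) sums f (t *\<^sub>R b))"
      unfolding a_def by blast
  qed
qed

section \<open>The Laplacian of radial functions\<close>

text \<open>A smooth function on the line is represented by the sequence of its derivatives.\<close>

definition deriv_seq :: "(nat \<Rightarrow> real \<Rightarrow> complex) \<Rightarrow> bool" where
  "deriv_seq G \<longleftrightarrow> (\<forall>n t. (G n has_vector_derivative G (Suc n) t) (at t))"

lemma deriv_seqD: "deriv_seq G \<Longrightarrow> (G n has_vector_derivative G (Suc n) t) (at t)"
  by (simp add: deriv_seq_def)

lemma deriv_seq_continuous: "deriv_seq G \<Longrightarrow> continuous_on A (G n)"
  by (meson continuous_at_imp_continuous_on deriv_seqD has_vector_derivative_continuous)

lemma deriv_seq_measurable: "deriv_seq G \<Longrightarrow> G n \<in> borel_measurable borel"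
  by (intro borel_measurable_continuous_onI deriv_seq_continuous)

text \<open>With \<open>n = 0\<close> and \<open>f = g''\<close>, where \<open>g' 0 = 0\<close>,
  this is \<open>g' t / t\<close> written without a singularity at \<open>0\<close>. Each derivative
  in \<open>t\<close> brings out a factor \<open>u\<close>, so the \<open>n\<close>-th derivative of
  \<open>g' t / t\<close> is the average with weight \<open>u ^ n\<close> of the derivative of
  \<open>g\<close> of order \<open>n + 2\<close>.\<close>

definition dilation_avg :: "nat \<Rightarrow> (real \<Rightarrow> complex) \<Rightarrow> real \<Rightarrow> complex" where
  "dilation_avg n f t = (LINT u|lborel. indicator {0..1} u *\<^sub>R (u ^ n *\<^sub>R f (t * u)))"

lemma integrable_indicator_unit: "integrable lborel (\<lambda>u. indicator {0..1::real} u * B :: real)"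
  by (intro integrable_mult_left) (simp add: integrable_real_indicator)

lemma norm_dilation_avg_integrand:
  fixes f :: "real \<Rightarrow> complex"
  assumes "\<And>t. norm (f t) \<le> B"
  shows "norm (indicator {0..1} u *\<^sub>R (u ^ n *\<^sub>R f (t * u))) \<le> indicator {0..1} u * B"
proof (cases "u \<in> {0..1}")
  case True
  then have "u ^ n * norm (f (t * u)) \<le> 1 * B"
    by (intro mult_mono assms power_le_one) auto
  then show ?thesis using True by simp
qed auto

lemma integrable_dilation_avg:
  fixes f :: "real \<Rightarrow> complex"
  assumes [measurable]: "f \<in> borel_measurable borel" and B: "\<And>t. norm (f t) \<le> B"
  shows "integrable lborel (\<lambda>u. indicator {0..1} u *\<^sub>R (u ^ n *\<^sub>R f (t * u)))"
  by (rule Bochner_Integration.integrable_bound[OF integrable_indicator_unit[of B]])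
    (use order_trans[OF norm_dilation_avg_integrand[of f B, OF B] abs_ge_self] in auto)

lemma dilation_avg_bound:
  assumes "f \<in> borel_measurable borel" and B: "\<And>t. norm (f t) \<le> B"
  shows "norm (dilation_avg n f t) \<le> B"
proof -
  have "norm (dilation_avg n f t) \<le> (LINT u|lborel. indicator {0..1::real} u * B)"
    unfolding dilation_avg_def
    by (rule Bochner_Integration.integral_norm_bound_integral[OF integrable_dilation_avg[OF assms]
        integrable_indicator_unit norm_dilation_avg_integrand[of f B, OF B]])
  then show ?thesis by simp
qed

lemma dilation_avg_derivative:
  assumes G: "deriv_seq G" and B: "\<And>n t. norm (G n t) \<le> B n"
  shows "(dilation_avg n (G m) has_vector_derivative dilation_avg (Suc n) (G (Suc m)) t) (at t)"
proof -
  have [measurable]: "G n \<in> borel_measurable borel" for n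
    using deriv_seq_measurable[OF G] .
  let ?f' = "\<lambda>u t v. v *\<^sub>R (indicator {0..1} u *\<^sub>R (u ^ Suc n *\<^sub>R G (Suc m) (t * u)))"
  have "((\<lambda>t. LINT u|lborel. indicator {0..1} u *\<^sub>R (u ^ n *\<^sub>R G m (t * u))) has_derivative
      (\<lambda>v. LINT u|lborel. ?f' u t v)) (at t)"
  proof (rule has_derivative_integral_param[where w = "\<lambda>u. indicator {0..1::real} u * B (Suc m)"])
    show "integrable lborel (\<lambda>u. indicator {0..1} u *\<^sub>R (u ^ n *\<^sub>R G m (t * u)))" for t
      by (rule integrable_dilation_avg[OF _ B]) measurable
    show "integrable lborel (\<lambda>u. indicator {0..1::real} u * B (Suc m))"
      by (rule integrable_indicator_unit)
    show "((\<lambda>t. indicator {0..1} u *\<^sub>R (u ^ n *\<^sub>R G m (t * u))) has_derivative ?f' u t) (at t)" for u t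
    proof -
      have "((\<lambda>t. t * u) has_vector_derivative u) (at t)"
        by (auto intro!: derivative_eq_intros simp: has_vector_derivative_def)
      from vector_diff_chain_at[OF this deriv_seqD[OF G, of m]]
      have "((\<lambda>t. G m (t * u)) has_derivative (\<lambda>v. v *\<^sub>R (u *\<^sub>R G (Suc m) (t * u)))) (at t)"
        by (simp add: o_def has_vector_derivative_def)
      from has_derivative_scaleR_right[OF has_derivative_scaleR_right[OF this, of "u ^ n"], of "indicator {0..1} u"]
      show ?thesis by (simp add: mult_ac)
    qed
    show "norm (?f' u s v) \<le> indicator {0..1} u * B (Suc m) * norm v" for u s v
      using mult_right_mono[OF norm_dilation_avg_integrand[of "G (Suc m)" "B (Suc m)" u "Suc n" s, OF B] norm_ge_zero[of v]]
      by (simp only: norm_scaleR[of v] real_norm_def mult.commute)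
  qed measurable
  then show ?thesis
    unfolding integral_scaleR_right has_vector_derivative_def dilation_avg_def[abs_def] .
qed

text \<open>The fundamental theorem of calculus for \<open>\<lambda>u. G 1 (t * u)\<close> on the
  unit interval. The product form covers \<open>t = 0\<close> as well.\<close>

lemma dilation_avg_second_derivative:
  assumes G: "deriv_seq G" and 0: "G 1 0 = 0"
  shows "of_real t * dilation_avg 0 (G 2) t = G 1 t"
proof -
  have "(LINT u|lborel. indicator {0..1} u *\<^sub>R (t *\<^sub>R G 2 (t * u))) = G 1 (t * 1) - G 1 (t * 0)"
  proof (rule integral_FTC_atLeastAtMost)
    show "((\<lambda>u. G 1 (t * u)) has_vector_derivative t *\<^sub>R G 2 (t * u)) (at u within {0..1})" for u
    proof -
      have "((\<lambda>u. t * u) has_vector_derivative t) (at u)"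
        by (auto intro!: derivative_eq_intros simp: has_vector_derivative_def)
      from vector_diff_chain_at[OF this deriv_seqD[OF G, of 1]] show ?thesis
        by (simp add: o_def numeral_2_eq_2 has_vector_derivative_at_within)
    qed
    show "continuous_on {0..1} (\<lambda>u. t *\<^sub>R G 2 (t * u))"
      by (intro continuous_intros continuous_on_compose2[OF deriv_seq_continuous[OF G, of UNIV 2]]) auto
  qed simp
  moreover have "(LINT u|lborel. indicator {0..1} u *\<^sub>R (t *\<^sub>R G 2 (t * u))) = t *\<^sub>R dilation_avg 0 (G 2) t"
    unfolding dilation_avg_def by (subst integral_scaleR_right[symmetric]) (simp add: mult.commute)
  ultimately show ?thesis using 0 by (simp add: scaleR_conv_of_real)
qed

text \<open>The operator acts on whole derivative sequences, the index \<open>n\<close> denoting the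
  \<open>n\<close>-th derivative of \<open>g'' + (d - 1) * g' / t\<close>, so that it can be
  iterated with control of all orders.\<close>

definition radial_laplacian :: "nat \<Rightarrow> (nat \<Rightarrow> real \<Rightarrow> complex) \<Rightarrow> nat \<Rightarrow> real \<Rightarrow> complex" where
  "radial_laplacian d G n t = of_nat (d - 1) * dilation_avg n (G (n + 2)) t + G (n + 2) t"

lemma radial_laplacian_deriv_seq:
  assumes G: "deriv_seq G" and B: "\<And>n t. norm (G n t) \<le> B n"
  shows "deriv_seq (radial_laplacian d G)"
  unfolding deriv_seq_def radial_laplacian_def[abs_def]
  using dilation_avg_derivative[OF assms] deriv_seqD[OF G]
  by (auto intro!: has_vector_derivative_add has_vector_derivative_mult_right)

text \<open>Averaging over dilations does not increase the supremum, so each of the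
  \<open>d - 1\<close> copies of \<open>g' / t\<close> costs no more than \<open>g''\<close>
  itself.\<close>

lemma radial_laplacian_bound:
  assumes G: "deriv_seq G" and B: "\<And>n t. norm (G n t) \<le> B n" and d: "d \<ge> 1"
  shows "norm (radial_laplacian d G n t) \<le> d * B (n + 2)"
proof -
  have "norm (radial_laplacian d G n t) \<le> real (d - 1) * norm (dilation_avg n (G (n + 2)) t) + norm (G (n + 2) t)"
    unfolding radial_laplacian_def by (rule order_trans[OF norm_triangle_ineq]) (simp add: norm_mult)
  also have "\<dots> \<le> real (d - 1) * B (n + 2) + B (n + 2)"
    by (intro add_mono mult_left_mono dilation_avg_bound deriv_seq_measurable G B) auto
  also have "\<dots> = d * B (n + 2)" using d by (simp add: of_nat_diff algebra_simps)
  finally show ?thesis .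
qed

lemma deriv_seq_reflect:
  assumes G: "deriv_seq G" and s: "\<And>t. G n (- t) = s * G n t"
  shows "G (Suc n) (- t) = - s * G (Suc n) t"
proof -
  have "((\<lambda>t. - t) has_vector_derivative - 1) (at t)"
    by (auto intro!: derivative_eq_intros)
  from vector_diff_chain_at[OF this deriv_seqD[OF G, of n "- t"]]
  have "((\<lambda>t. s * G n t) has_vector_derivative - G (Suc n) (- t)) (at t)"
    by (simp add: o_def s)
  moreover have "((\<lambda>t. s * G n t) has_vector_derivative s * G (Suc n) t) (at t)"
    by (intro has_vector_derivative_mult_right deriv_seqD G)
  ultimately have "- G (Suc n) (- t) = s * G (Suc n) t"
    by (rule vector_derivative_unique_at)
  then show ?thesis by (simp add: minus_equation_iff[of "G (Suc n) (- t)"])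
qed

lemma deriv_seq_even:
  assumes G: "deriv_seq G" and even: "\<And>t. G 0 (- t) = G 0 t"
  shows "G 1 (- t) = - G 1 t" "G 2 (- t) = G 2 t" "G 1 0 = 0"
proof -
  have 1: "G 1 (- t) = - G 1 t" for t
    using deriv_seq_reflect[OF G, of 0 1] even by simp
  show "G 1 (- t) = - G 1 t" by (rule 1)
  show "G 2 (- t) = G 2 t"
    using deriv_seq_reflect[OF G, of 1 "-1"] 1 by (simp add: numeral_2_eq_2)
  show "G 1 0 = 0" using 1[of 0] by simp
qed

lemma radial_laplacian_even:
  assumes G: "deriv_seq G" and even: "\<And>t. G 0 (- t) = G 0 t"
  shows "radial_laplacian d G 0 (- t) = radial_laplacian d G 0 t"
proof -
  note e = deriv_seq_even[OF assms]
  have "dilation_avg 0 (G 2) (- t) = dilation_avg 0 (G 2) t"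
    unfolding dilation_avg_def using e(2)[of "t * _"] by simp
  then show ?thesis using e(2)[of t] by (simp add: radial_laplacian_def numeral_2_eq_2)
qed

lemma radial_line_derivative:
  fixes x b :: "'a::euclidean_space"
  assumes "x \<noteq> 0" and f: "(f has_vector_derivative f') (at (norm x))"
  shows "((\<lambda>t. f (norm (x + t *\<^sub>R b))) has_vector_derivative ((x \<bullet> b) / norm x) *\<^sub>R f') (at 0)"
proof -
  have "((\<lambda>t. x + t *\<^sub>R b) has_derivative (\<lambda>t. t *\<^sub>R b)) (at 0)"
    by (auto intro!: derivative_eq_intros)
  moreover have "(norm has_derivative (\<lambda>h. h \<bullet> sgn x)) (at (x + 0 *\<^sub>R b))"
    using has_derivative_norm[OF assms(1)] by simp
  ultimately have "((\<lambda>t. norm (x + t *\<^sub>R b)) has_derivative (\<lambda>t. (t *\<^sub>R b) \<bullet> sgn x)) (at 0)"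
    by (rule has_derivative_compose)
  moreover have "(\<lambda>t. (t *\<^sub>R b) \<bullet> sgn x) = (\<lambda>t. t *\<^sub>R ((x \<bullet> b) / norm x))"
    by (simp add: sgn_div_norm inner_commute divide_inverse mult_ac fun_eq_iff)
  ultimately have "((\<lambda>t. norm (x + t *\<^sub>R b)) has_vector_derivative (x \<bullet> b) / norm x) (at 0)"
    by (simp add: has_vector_derivative_def)
  from vector_diff_chain_at[OF this, of f f'] f show ?thesis by (simp add: o_def)
qed

section \<open>The weak Laplacian of a radial function\<close>

definition laplacian :: "('a::euclidean_space \<Rightarrow> complex) \<Rightarrow> 'a \<Rightarrow> complex" where
  "laplacian \<psi> x = (\<Sum>b\<in>Basis. dir_deriv b (dir_deriv b \<psi>) x)"

lemma laplacian_schwartz: "\<psi> \<in> schwartz \<Longrightarrow> laplacian \<psi> \<in> schwartz"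
  unfolding laplacian_def[abs_def] by (intro schwartz_sum schwartz_dir_deriv)

lemma laplacian_translate: "\<psi> \<in> schwartz \<Longrightarrow> laplacian (\<lambda>x. \<psi> (x - y)) = (\<lambda>x. laplacian \<psi> (x - y))"
  unfolding laplacian_def[abs_def]
  by (intro HOL.ext sum.cong refl) (simp add: dir_deriv_translate schwartz_dir_deriv)

text \<open>Two integrations by parts in each coordinate, with line derivatives of
  \<open>G 0 (norm x)\<close> that are valid at every point including the origin. With
  \<open>r = norm x\<close> and \<open>h = g' / r\<close> the second derivatives are
  \<open>h + (x \<bullet> b)\<^sup>2 / r * h'\<close>; they add up to
  \<open>DIM('a) * h + r * h'\<close>, and \<open>r * h' = g'' - h\<close>.\<close>

lemma radial_weak_laplacian:
  fixes \<psi> :: "'a::euclidean_space \<Rightarrow> complex"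
  assumes G: "deriv_seq G" and even: "\<And>t. G 0 (- t) = G 0 t" and B: "\<And>n t. norm (G n t) \<le> B n"
    and psi: "\<psi> \<in> schwartz"
  shows "(LINT x|lborel. G 0 (norm x) * laplacian \<psi> x)
    = (LINT x|lborel. radial_laplacian DIM('a) G 0 (norm x) * \<psi> x)"
proof -
  note e = deriv_seq_even[OF G even]
  have [measurable]: "G n \<in> borel_measurable borel" for n
    using deriv_seq_measurable[OF G] .
  define h where "h = dilation_avg 0 (G 2)"
  define h' where "h' = dilation_avg 1 (G 3)"
  have h: "(h has_vector_derivative h' t) (at t)" for t
    unfolding h_def h'_def using dilation_avg_derivative[OF G B, of 0 2 t] by (simp add: eval_nat_numeral)
  have h3: "(h' has_vector_derivative dilation_avg 2 (G 4) t) (at t)" for t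
    unfolding h'_def using dilation_avg_derivative[OF G B, of 1 3 t] by (simp add: eval_nat_numeral)
  have [measurable]: "h \<in> borel_measurable borel" "h' \<in> borel_measurable borel"
    using h h3 by (auto intro!: borel_measurable_continuous_onI continuous_at_imp_continuous_on
        has_vector_derivative_continuous)
  have th: "of_real t * h t = G 1 t" for t
    unfolding h_def by (rule dilation_avg_second_derivative[OF G e(3)])
  \<comment> \<open>Obtained by differentiating \<open>t * h t = G 1 t\<close>. It keeps
    \<open>norm x * h' (norm x)\<close> bounded although the factor \<open>norm x\<close> is
    not.\<close>
  have th': "of_real t * h' t = G 2 t - h t" for t
  proof -
    have "((\<lambda>t. of_real t) has_vector_derivative (1::complex)) (at t)"
      using bounded_linear.has_vector_derivative[OF bounded_linear_of_real has_vector_derivative_id] by simp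
    from has_vector_derivative_mult[OF this h[of t]]
    have "(G 1 has_vector_derivative of_real t * h' t + 1 * h t) (at t)"
      by (simp add: th)
    from vector_derivative_unique_at[OF this deriv_seqD[OF G]] show ?thesis
      by (simp add: numeral_2_eq_2 algebra_simps)
  qed
  have hb: "norm (h t) \<le> B 2" for t
    unfolding h_def by (rule dilation_avg_bound[OF _ B]) measurable
  let ?F = "\<lambda>x::'a. G 0 (norm x)"
  define F1 where "F1 b x = of_real (x \<bullet> b) * h (norm x)" for b x :: 'a
  \<comment> \<open>At \<open>x = 0\<close> the quotient is \<open>0\<close> by convention, so
    \<open>F2 b 0\<close> is \<open>h 0\<close>, which is the correct value
    \<open>G 2 0\<close>.\<close>
  define F2 where "F2 b x = h (norm x) + of_real ((x \<bullet> b)\<^sup>2 / norm x) * h' (norm x)" for b x :: 'a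
  have [measurable]: "F1 b \<in> borel_measurable borel" "F2 b \<in> borel_measurable borel" for b
    unfolding F1_def[abs_def] F2_def[abs_def] by measurable
  have F1b: "norm (F1 b x) \<le> B 1" if b: "b \<in> Basis" for b x
  proof -
    have "norm (F1 b x) \<le> norm x * norm (h (norm x))"
      unfolding F1_def norm_mult using Basis_le_norm[OF b, of x] by (intro mult_right_mono) auto
    also have "\<dots> = norm (G 1 (norm x))" unfolding th[symmetric] by (simp add: norm_mult)
    finally show ?thesis using B[of 1 "norm x"] by linarith
  qed
  have F2b: "norm (F2 b x) \<le> B 2 + (B 2 + B 2)" if b: "b \<in> Basis" for b x
  proof -
    have "(x \<bullet> b)\<^sup>2 \<le> norm x * norm x"
      using power_mono[OF Basis_le_norm[OF b, of x], of 2] by (simp add: power2_eq_square)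
    then have "\<bar>(x \<bullet> b)\<^sup>2 / norm x\<bar> \<le> norm x"
      by (cases "x = 0") (simp_all add: divide_le_eq)
    then have "norm (of_real ((x \<bullet> b)\<^sup>2 / norm x) * h' (norm x)) \<le> norm x * norm (h' (norm x))"
      unfolding norm_mult norm_of_real by (intro mult_right_mono) auto
    also have "\<dots> = norm (G 2 (norm x) - h (norm x))" unfolding th'[symmetric] by (simp add: norm_mult)
    also have "\<dots> \<le> B 2 + B 2"
      by (rule order_trans[OF norm_triangle_ineq4]) (intro add_mono B hb)
    finally show ?thesis
      unfolding F2_def using hb[of "norm x"] by (intro order_trans[OF norm_triangle_ineq]) linarith
  qed
  have d1: "((\<lambda>t. ?F (x + t *\<^sub>R b)) has_vector_derivative F1 b x) (at 0)" if b: "b \<in> Basis" for b x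
  proof (cases "x = 0")
    case True
    \<comment> \<open>Evenness replaces \<open>norm (t *\<^sub>R b) = \<bar>t\<bar>\<close> by
      \<open>t\<close>, so the kink of the norm at the origin disappears.\<close>
    have "(\<lambda>t. ?F (x + t *\<^sub>R b)) = G 0"
      using True b even by (auto simp: abs_if)
    then show ?thesis using True deriv_seqD[OF G, of 0 0] e(3) by (simp add: F1_def)
  next
    case False
    have "((x \<bullet> b) / norm x) *\<^sub>R G 1 (norm x) = F1 b x"
      using False unfolding th[symmetric] by (simp add: F1_def scaleR_conv_of_real)
    then show ?thesis
      using radial_line_derivative[OF False deriv_seqD[OF G, of 0 "norm x"], of b] by simp
  qed
  have d2: "((\<lambda>t. F1 b (x + t *\<^sub>R b)) has_vector_derivative F2 b x) (at 0)" if b: "b \<in> Basis" for b x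
  proof (cases "x = 0")
    case True
    have "F1 b (t *\<^sub>R b) = G 1 t" for t
    proof (cases "t \<ge> 0")
      case True
      then show ?thesis using b th[of t] by (simp add: F1_def)
    next
      case False
      then show ?thesis using b th[of "- t"] e(1)[of t] by (simp add: F1_def)
    qed
    moreover have "G 2 0 = h 0" using th'[of 0] by simp
    ultimately show ?thesis using True deriv_seqD[OF G, of 1 0] by (simp add: F2_def numeral_2_eq_2)
  next
    case False
    have "((\<lambda>t. (x + t *\<^sub>R b) \<bullet> b) has_vector_derivative 1) (at 0)"
      using b by (auto intro!: derivative_eq_intros simp: inner_add_left has_vector_derivative_def)
    then have "((\<lambda>t. complex_of_real ((x + t *\<^sub>R b) \<bullet> b)) has_vector_derivative of_real 1) (at 0)"
      by (rule bounded_linear.has_vector_derivative[OF bounded_linear_of_real])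
    from has_vector_derivative_mult[OF this radial_line_derivative[OF False h, of b]]
    show ?thesis unfolding F1_def F2_def
      by (simp add: scaleR_conv_of_real power2_eq_square mult_ac add.commute)
  qed
  have F: "norm (?F x) \<le> B 0" for x by (rule B)
  have one: "(LINT x|lborel. ?F x * dir_deriv b (dir_deriv b \<psi>) x) = (LINT x|lborel. F2 b x * \<psi> x)" if b: "b \<in> Basis" for b
  proof -
    have "(LINT x|lborel. ?F x * dir_deriv b (dir_deriv b \<psi>) x) = - (LINT x|lborel. F1 b x * dir_deriv b \<psi> x)"
      by (rule integration_by_parts_schwartz[OF _ _ F F1b[OF b] d1[OF b] schwartz_dir_deriv[OF psi b] b]) measurable
    also have "(LINT x|lborel. F1 b x * dir_deriv b \<psi> x) = - (LINT x|lborel. F2 b x * \<psi> x)"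
      by (rule integration_by_parts_schwartz[OF _ _ F1b[OF b] F2b[OF b] d2[OF b] psi b]) measurable
    finally show ?thesis by simp
  qed
  have "(LINT x|lborel. ?F x * laplacian \<psi> x) = (LINT x|lborel. (\<Sum>b\<in>Basis. ?F x * dir_deriv b (dir_deriv b \<psi>) x))"
    by (simp add: laplacian_def sum_distrib_left)
  also have "\<dots> = (\<Sum>b\<in>Basis. LINT x|lborel. ?F x * dir_deriv b (dir_deriv b \<psi>) x)"
    by (intro Bochner_Integration.integral_sum integrable_schwartz_mult[OF _ F] schwartz_dir_deriv psi) measurable
  also have "\<dots> = (\<Sum>b\<in>Basis. LINT x|lborel. F2 b x * \<psi> x)"
    by (intro sum.cong refl one)
  also have "\<dots> = (LINT x|lborel. (\<Sum>b\<in>Basis. F2 b x * \<psi> x))"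
    by (intro Bochner_Integration.integral_sum[symmetric] integrable_schwartz_mult[OF _ F2b] psi) measurable
  also have "\<dots> = (LINT x|lborel. radial_laplacian DIM('a) G 0 (norm x) * \<psi> x)"
  proof (intro Bochner_Integration.integral_cong refl)
    fix x :: 'a
    have "(\<Sum>b\<in>Basis. (x \<bullet> b)\<^sup>2 / norm x) = norm x"
    proof -
      have "(\<Sum>b\<in>Basis. (x \<bullet> b)\<^sup>2) = norm x * norm x"
        unfolding norm_eq_sqrt_inner real_sqrt_mult_self
        by (subst euclidean_inner) (simp add: power2_eq_square sum_nonneg)
      then show ?thesis by (simp add: sum_divide_distrib[symmetric])
    qed
    then have "(\<Sum>b\<in>Basis. F2 b x) = of_nat DIM('a) * h (norm x) + of_real (norm x) * h' (norm x)"
      unfolding F2_def sum.distrib sum_distrib_right[symmetric] of_real_sum[symmetric] by simp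
    also have "\<dots> = radial_laplacian DIM('a) G 0 (norm x)"
      using DIM_positive[where 'a = 'a]
      by (simp add: th' radial_laplacian_def h_def of_nat_diff Suc_leI left_diff_distrib numeral_2_eq_2)
    finally show "(\<Sum>b\<in>Basis. F2 b x * \<psi> x) = radial_laplacian DIM('a) G 0 (norm x) * \<psi> x"
      by (simp add: sum_distrib_right[symmetric])
  qed
  finally show ?thesis .
qed

text \<open>Regularity, evenness and bounds are carried together because the weak identity for the
  next application requires all three.\<close>

lemma radial_laplacian_iterate:
  assumes "deriv_seq G" "\<And>t. G 0 (- t) = G 0 t" "\<And>n t. norm (G n t) \<le> B n" "d \<ge> 1"
  shows "deriv_seq ((radial_laplacian d ^^ m) G) \<and>
    (\<forall>t. (radial_laplacian d ^^ m) G 0 (- t) = (radial_laplacian d ^^ m) G 0 t) \<and>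
    (\<forall>n t. norm ((radial_laplacian d ^^ m) G n t) \<le> real d ^ m * B (n + 2 * m))"
proof (induction m)
  case (Suc m)
  let ?H = "(radial_laplacian d ^^ m) G"
  have H: "deriv_seq ?H" "\<And>t. ?H 0 (- t) = ?H 0 t" "\<And>n t. norm (?H n t) \<le> real d ^ m * B (n + 2 * m)"
    using Suc by auto
  show ?case
    using radial_laplacian_deriv_seq[OF H(1,3)] radial_laplacian_even[OF H(1,2)]
      radial_laplacian_bound[OF H(1,3) assms(4)] by (simp add: mult.assoc)
qed (use assms in auto)

lemma radial_weak_laplacian_iterate:
  fixes \<psi> :: "'a::euclidean_space \<Rightarrow> complex"
  assumes G: "deriv_seq G" "\<And>t. G 0 (- t) = G 0 t" "\<And>n t. norm (G n t) \<le> B n"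
    and psi: "\<psi> \<in> schwartz"
  shows "(LINT x|lborel. G 0 (norm x) * (laplacian ^^ m) \<psi> x)
    = (LINT x|lborel. (radial_laplacian DIM('a) ^^ m) G 0 (norm x) * \<psi> x)"
  using psi
proof (induction m arbitrary: \<psi>)
  case (Suc m)
  let ?H = "(radial_laplacian DIM('a) ^^ m) G"
  have H: "deriv_seq ?H" "\<And>t. ?H 0 (- t) = ?H 0 t" "\<And>n t. norm (?H n t) \<le> real DIM('a) ^ m * B (n + 2 * m)"
    using radial_laplacian_iterate[OF G, of "DIM('a)" m] DIM_positive[where 'a = 'a] by (auto simp: Suc_leI)
  have "(laplacian ^^ Suc m) \<psi> = (laplacian ^^ m) (laplacian \<psi>)"
    by (simp add: funpow_swap1)
  then show ?case
    using Suc.IH[OF laplacian_schwartz[OF Suc.prems]] radial_weak_laplacian[OF H Suc.prems] by simp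
qed simp

section \<open>High frequency pieces of radial functions\<close>

lemma of_real_inner_self:
  "complex_of_real (x \<bullet> x) * c = (\<Sum>e\<in>Basis. of_real (x \<bullet> e) * (of_real (x \<bullet> e) * c))" for x :: "'a::euclidean_space"
proof -
  have "complex_of_real (x \<bullet> x) = of_real (\<Sum>e\<in>Basis. (x \<bullet> e) * (x \<bullet> e))"
    by (rule arg_cong[OF euclidean_inner])
  then show ?thesis by (simp add: sum_distrib_right mult.assoc)
qed

lemma schwartz_norm_square_mult:
  fixes \<eta> :: "'a::euclidean_space \<Rightarrow> complex"
  assumes "\<eta> \<in> schwartz"
  shows "(\<lambda>x. of_real (x \<bullet> x) * \<eta> x) \<in> schwartz"
  unfolding of_real_inner_self by (intro schwartz_sum schwartz_inner_mult assms)

text \<open>The algebra of the quotient rule for \<open>\<eta> x / (x \<bullet> x) ^ n\<close>: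
  \<open>a\<close> is \<open>x \<bullet> x\<close>, \<open>p\<close> is \<open>a ^ (n - 1)\<close>,
  \<open>w\<close> is \<open>x \<bullet> v\<close>, and \<open>e\<close>, \<open>f\<close> are the
  value and the derivative of \<open>\<eta>\<close>.\<close>

lemma quotient_derivative_aux:
  fixes a p e f n w :: complex
  assumes "a \<noteq> 0" "p \<noteq> 0"
  shows "e * - (inverse (a * p) * (n * (2 * w) * p) * inverse (a * p)) + f * inverse (a * p)
    = (a * f - (2 * n) * (w * e)) / (a * (a * p))"
  using assms by (simp add: field_simps)

text \<open>The vanishing of \<open>\<eta>\<close> near the origin removes the singularity, and the
  class of such quotients is closed under derivatives: the exponent grows by one, and the new
  numerator, built from \<open>\<eta>\<close> and its derivative, vanishes on the same ball.\<close>

lemma schwartz_divide_norm_power: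
  fixes \<eta> :: "'a::euclidean_space \<Rightarrow> complex"
  assumes eta: "\<eta> \<in> schwartz" and van: "\<And>x. norm x < 1/2 \<Longrightarrow> \<eta> x = 0"
  shows "(\<lambda>x. \<eta> x / of_real (x \<bullet> x) ^ m) \<in> schwartz"
proof -
  let ?V = "{\<eta> :: 'a \<Rightarrow> complex. \<eta> \<in> schwartz \<and> (\<forall>x. norm x < 1/2 \<longrightarrow> \<eta> x = 0)}"
  define q where "q = (\<lambda>(\<eta> :: 'a \<Rightarrow> complex) m x. \<eta> x / of_real (x \<bullet> x) ^ m)"
  define V where "V = ?V"
  let ?X = "{q \<eta> m |\<eta> m. \<eta> \<in> V}"
  have hd: "((\<lambda>x. \<eta> x / of_real (x \<bullet> x) ^ m) has_derivative
      (\<lambda>v. (of_real (x \<bullet> x) * frechet_derivative \<eta> (at x) v - of_nat (2 * m) * (of_real (x \<bullet> v) * \<eta> x)) / of_real (x \<bullet> x) ^ Suc m)) (at x)"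
    if "\<eta> \<in> ?V" for \<eta> m and x :: 'a
  proof (cases "norm x < 1/2")
    case True
    have op: "open (ball (0::'a) (1/2))" and x: "x \<in> ball 0 (1/2)" using True by auto
    have z: "\<eta> y = 0" if "y \<in> ball 0 (1/2)" for y using that \<open>\<eta> \<in> ?V\<close> by auto
    have "(\<eta> has_derivative (\<lambda>v. 0)) (at x)"
      by (rule has_derivative_transform_within_open[OF _ op x]) (auto simp: z)
    then have "frechet_derivative \<eta> (at x) v = 0" for v
      by (simp add: frechet_derivative_at[symmetric])
    moreover have "((\<lambda>x. \<eta> x / of_real (x \<bullet> x) ^ m) has_derivative (\<lambda>v. 0)) (at x)"
      by (rule has_derivative_transform_within_open[OF _ op x, of "\<lambda>x. 0"]) (auto simp: z)
    ultimately show ?thesis by (simp add: z[OF x])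
  next
    case False
    then have x0: "x \<bullet> x \<noteq> 0" by auto
    have d: "(\<eta> has_derivative frechet_derivative \<eta> (at x)) (at x)"
      using that by (intro frechet_derivative_worksI schwartz_differentiable) auto
    have "((\<lambda>x. x \<bullet> x) has_derivative (\<lambda>v. 2 * (x \<bullet> v))) (at x)"
      by (auto intro!: derivative_eq_intros simp: inner_commute)
    then have "((\<lambda>x. inverse (complex_of_real (x \<bullet> x) ^ m)) has_derivative
        (\<lambda>v. - (inverse (complex_of_real (x \<bullet> x) ^ m) * (of_nat m * of_real (2 * (x \<bullet> v)) * of_real (x \<bullet> x) ^ (m - 1)) * inverse (of_real (x \<bullet> x) ^ m)))) (at x)"
      using x0 by (intro Deriv.has_derivative_inverse has_derivative_power has_derivative_of_real) auto
    from has_derivative_mult[OF d this] have "((\<lambda>x. \<eta> x * inverse (complex_of_real (x \<bullet> x) ^ m)) has_derivative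
       (\<lambda>v. \<eta> x * - (inverse (complex_of_real (x \<bullet> x) ^ m) * (of_nat m * of_real (2 * (x \<bullet> v)) * of_real (x \<bullet> x) ^ (m - 1)) * inverse (of_real (x \<bullet> x) ^ m))
          + frechet_derivative \<eta> (at x) v * inverse (of_real (x \<bullet> x) ^ m))) (at x)" .
    moreover have "\<eta> x * - (inverse (complex_of_real (x \<bullet> x) ^ m) * (of_nat m * of_real (2 * (x \<bullet> v)) * of_real (x \<bullet> x) ^ (m - 1)) * inverse (of_real (x \<bullet> x) ^ m))
          + frechet_derivative \<eta> (at x) v * inverse (of_real (x \<bullet> x) ^ m)
        = (of_real (x \<bullet> x) * frechet_derivative \<eta> (at x) v - of_nat (2 * m) * (of_real (x \<bullet> v) * \<eta> x)) / of_real (x \<bullet> x) ^ Suc m" for v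
    proof (cases m)
      case 0
      then show ?thesis using x0 by (simp del: inner_eq_zero_iff)
    next
      case (Suc k)
      have "complex_of_real (x \<bullet> x) \<noteq> 0" "complex_of_real (x \<bullet> x) ^ k \<noteq> 0" using x0 by auto
      from quotient_derivative_aux[OF this, of "\<eta> x" "of_nat (Suc k)" "of_real (x \<bullet> v)" "frechet_derivative \<eta> (at x) v"]
      show ?thesis unfolding Suc by (simp only: power_Suc diff_Suc_1 of_real_mult of_real_numeral of_nat_mult of_nat_numeral)
    qed
    ultimately show ?thesis by (simp only: divide_inverse)
  qed
  have "q \<eta> m \<in> schwartz"
  proof (rule schwartz_coinduct[where X = ?X])
    show "q \<eta> m \<in> ?X" using assms by (auto simp: V_def)
    show "g differentiable (at x)" if "g \<in> ?X" for g :: "'a \<Rightarrow> complex" and x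
    proof -
      obtain \<eta> m where "g = q \<eta> m" and V: "\<eta> \<in> V" using \<open>g \<in> ?X\<close> by blast
      then have g: "g = (\<lambda>x. \<eta> x / of_real (x \<bullet> x) ^ m)" "\<eta> \<in> ?V" by (simp_all add: q_def V_def)
      show ?thesis unfolding g(1) by (rule differentiableI[OF hd[OF g(2)]])
    qed
    show "\<exists>C. \<forall>x. (1 + norm x) ^ N * norm (g x) \<le> C" if "g \<in> ?X" for g N
    proof -
      obtain \<eta> m where "g = q \<eta> m" and V: "\<eta> \<in> V" using \<open>g \<in> ?X\<close> by blast
      then have g: "g = (\<lambda>x. \<eta> x / of_real (x \<bullet> x) ^ m)" "\<eta> \<in> ?V" by (simp_all add: q_def V_def)
      obtain C where C: "\<And>x. (1 + norm x) ^ N * norm (\<eta> x) \<le> C" using schwartz_decay[of \<eta> N] g(2) by blast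
      \<comment> \<open>Outside the ball of radius \<open>1/2\<close> the denominator is at least
        \<open>(1/4) ^ m\<close>.\<close>
      have "norm (g x) \<le> 4 ^ m * norm (\<eta> x)" for x
      proof (cases "norm x < 1/2")
        case True
        then show ?thesis using g by auto
      next
        case False
        then have "(1/2) * (1/2) \<le> norm x * norm x" by (intro mult_mono) auto
        then have xx: "1/4 \<le> x \<bullet> x" by (simp add: dot_square_norm power2_eq_square)
        then have "(1/4) ^ m \<le> (x \<bullet> x) ^ m" by (intro power_mono) auto
        then have "1 \<le> 4 ^ m * (x \<bullet> x) ^ m" by (simp add: power_one_over field_simps)
        then have "norm (\<eta> x) * 1 \<le> norm (\<eta> x) * (4 ^ m * (x \<bullet> x) ^ m)" by (intro mult_left_mono) auto
        moreover have "(x \<bullet> x) ^ m > 0" using xx by (intro zero_less_power) linarith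
        ultimately show ?thesis
          unfolding g(1) norm_divide norm_power norm_of_real by (simp add: divide_le_eq mult_ac)
      qed
      note gb = this
      have "(1 + norm x) ^ N * norm (g x) \<le> 4 ^ m * C" for x
      proof -
        have "(1 + norm x) ^ N * norm (g x) \<le> (1 + norm x) ^ N * (4 ^ m * norm (\<eta> x))"
          by (rule mult_left_mono[OF gb]) simp
        also have "\<dots> = 4 ^ m * ((1 + norm x) ^ N * norm (\<eta> x))" by simp
        also have "\<dots> \<le> 4 ^ m * C" by (rule mult_left_mono[OF C]) simp
        finally show ?thesis .
      qed
      then show ?thesis by blast
    qed
    show "dir_deriv b g \<in> ?X" if "g \<in> ?X" and b: "b \<in> Basis" for g b
    proof -
      obtain \<eta> m where "g = q \<eta> m" and V: "\<eta> \<in> V" using \<open>g \<in> ?X\<close> by blast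
      then have g: "g = (\<lambda>x. \<eta> x / of_real (x \<bullet> x) ^ m)" "\<eta> \<in> ?V" by (simp_all add: q_def V_def)
      define \<zeta> where "\<zeta> x = of_real (x \<bullet> x) * dir_deriv b \<eta> x - of_nat (2 * m) * (of_real (x \<bullet> b) * \<eta> x)" for x
      have etaS: "\<eta> \<in> schwartz" using g(2) by blast
      have "dir_deriv b g = q \<zeta> (Suc m)"
        unfolding g(1) \<zeta>_def q_def by (intro HOL.ext dir_deriv_eqI[OF hd[OF g(2)]]) (simp add: dir_deriv_def)
      moreover have "\<zeta> \<in> V"
        unfolding V_def
      proof (intro CollectI conjI allI impI)
        show "\<zeta> \<in> schwartz"
          unfolding \<zeta>_def[abs_def]
          by (rule schwartz_diff[OF schwartz_norm_square_mult[OF schwartz_dir_deriv[OF etaS b]]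
                schwartz_cmult[OF schwartz_inner_mult[OF etaS]]])
        fix x :: 'a assume x: "norm x < 1/2"
        have "iter_deriv [b] \<eta> x = 0"
          by (rule iter_deriv_eq_0_open[of "ball 0 (1/2)"]) (use g(2) x in auto)
        then show "\<zeta> x = 0" using g(2) x by (simp add: \<zeta>_def)
      qed
      ultimately show ?thesis by blast
    qed
  qed
  then show ?thesis by (simp add: q_def)
qed

lemma laplacian_fourier:
  fixes \<eta> :: "'a::euclidean_space \<Rightarrow> complex"
  assumes eta: "\<eta> \<in> schwartz"
  shows "laplacian (fourier \<eta>) = fourier (\<lambda>x. of_real (x \<bullet> x) * (- 1 * \<eta> x))"
proof
  fix \<xi>
  have s: "(\<lambda>x. of_real (x \<bullet> b) * (- \<i> * \<eta> x)) \<in> schwartz" for b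
    by (intro schwartz_inner_mult schwartz_cmult eta)
  have "laplacian (fourier \<eta>) \<xi> = (\<Sum>b\<in>Basis. fourier (\<lambda>x. of_real (x \<bullet> b) * (- \<i> * (of_real (x \<bullet> b) * (- \<i> * \<eta> x)))) \<xi>)"
    unfolding laplacian_def by (simp only: dir_deriv_fourier[OF eta] dir_deriv_fourier[OF s])
  also have "\<dots> = fourier (\<lambda>x. \<Sum>b\<in>Basis. of_real (x \<bullet> b) * (- \<i> * (of_real (x \<bullet> b) * (- \<i> * \<eta> x)))) \<xi>"
    by (intro fourier_sum[symmetric] schwartz_inner_mult[of "\<lambda>x. - \<i> * _ x"] schwartz_cmult s) auto
  also have "(\<lambda>x. \<Sum>b\<in>Basis. of_real (x \<bullet> b) * (- \<i> * (of_real (x \<bullet> b) * (- \<i> * \<eta> x)))) = (\<lambda>x. of_real (x \<bullet> x) * (- 1 * \<eta> x))"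
  proof
    fix x
    have "of_real (x \<bullet> b) * (- \<i> * (of_real (x \<bullet> b) * (- \<i> * \<eta> x))) = of_real (x \<bullet> b) * (of_real (x \<bullet> b) * (- 1 * \<eta> x))" for b
    proof -
      have "- \<i> * (- \<i> * z) = - 1 * z" for z by simp
      then show ?thesis
        by (simp only: mult.left_commute[of "- \<i>" "complex_of_real (x \<bullet> b)"])
    qed
    then show "(\<Sum>b\<in>Basis. of_real (x \<bullet> b) * (- \<i> * (of_real (x \<bullet> b) * (- \<i> * \<eta> x)))) = of_real (x \<bullet> x) * (- 1 * \<eta> x)"
      by (simp only: of_real_inner_self)
  qed
  finally show "laplacian (fourier \<eta>) \<xi> = fourier (\<lambda>x. of_real (x \<bullet> x) * (- 1 * \<eta> x)) \<xi>" .
qed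

lemma laplacian_iterate_fourier:
  fixes \<eta> :: "'a::euclidean_space \<Rightarrow> complex"
  assumes "\<eta> \<in> schwartz"
  shows "(laplacian ^^ m) (fourier \<eta>) = fourier (\<lambda>x. (- of_real (x \<bullet> x)) ^ m * \<eta> x)"
  using assms
proof (induction m arbitrary: \<eta>)
  case (Suc m)
  have "(laplacian ^^ Suc m) (fourier \<eta>) = (laplacian ^^ m) (laplacian (fourier \<eta>))"
    by (simp add: funpow_swap1)
  also have "\<dots> = fourier (\<lambda>x. (- of_real (x \<bullet> x)) ^ m * (of_real (x \<bullet> x) * (- 1 * \<eta> x)))"
    unfolding laplacian_fourier[OF Suc.prems]
    by (intro Suc.IH schwartz_norm_square_mult schwartz_cmult Suc.prems)
  also have "(\<lambda>x. (- of_real (x \<bullet> x)) ^ m * (of_real (x \<bullet> x) * (- 1 * \<eta> x))) = (\<lambda>x. (- of_real (x \<bullet> x)) ^ Suc m * \<eta> x)"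
    by (simp add: mult_ac)
  finally show ?case .
qed simp

lemma laplacian_iterate_translate:
  "\<psi> \<in> schwartz \<Longrightarrow> (laplacian ^^ m) (\<lambda>x. \<psi> (x - y)) = (\<lambda>x. (laplacian ^^ m) \<psi> (x - y))"
proof (induction m)
  case (Suc m)
  have "(laplacian ^^ m) \<psi> \<in> schwartz"
    using Suc.prems by (induction m) (auto simp: laplacian_schwartz)
  then show ?case using Suc by (simp add: laplacian_translate)
qed simp

text \<open>Dilating the symbol dilates the kernel with the factor that preserves the integral of
  its modulus, so the kernel bounds are the same at all frequencies \<open>2 ^ k\<close>.\<close>

lemma fourier_scale_L1:
  fixes \<eta> :: "'a::euclidean_space \<Rightarrow> complex"
  assumes eta: "\<eta> \<in> schwartz" and r: "r > 0"
  shows "(LINT z|lborel. norm (fourier (\<lambda>\<xi>. \<eta> (r *\<^sub>R \<xi>)) z)) = (LINT z|lborel. norm (fourier \<eta> z))"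
proof -
  have [measurable]: "fourier \<eta> \<in> borel_measurable borel"
    by (intro schwartz_measurable fourier_schwartz eta)
  have "(LINT z|lborel. norm (fourier \<eta> z)) = \<bar>inverse r\<bar> ^ DIM('a) *\<^sub>R (LINT z|lborel. norm (fourier \<eta> (0 + inverse r *\<^sub>R z)))"
    by (rule lborel_integral_affine) (use r in auto)
  also have "\<dots> = (LINT z|lborel. inverse r ^ DIM('a) * norm (fourier \<eta> (inverse r *\<^sub>R z)))"
    using r by simp
  also have "\<dots> = (LINT z|lborel. norm (fourier (\<lambda>\<xi>. \<eta> (r *\<^sub>R \<xi>)) z))"
    using r by (intro Bochner_Integration.integral_cong) (auto simp: fourier_scale[OF eta r] norm_mult norm_power norm_inverse power_inverse)
  finally show ?thesis ..
qed

text \<open>The minimum combines two bounds for the \<open>k\<close>-th kernel against the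
  \<open>j\<close>-th term: the integral of the modulus of the kernel alone, and the bound after
  moving \<open>m\<close> Laplacians from the kernel to the profile. The kernel contains these
  Laplacians because its symbol vanishes near the origin and may be divided by a power of the
  squared norm. \<open>C\<close> is fixed before the terms, their bounds \<open>a\<close> and
  \<open>k\<close>.\<close>

lemma besov_synthesis:
  fixes \<theta> :: "'a::euclidean_space \<Rightarrow> complex" and B :: "nat \<Rightarrow> real"
  assumes theta: "besov_cutoff \<theta>"
  obtains C where "C \<ge> 0" "\<And>a G g k. (\<And>j. deriv_seq (G j)) \<Longrightarrow> (\<And>j t. G j 0 (- t) = G j 0 t) \<Longrightarrow>
     (\<And>j n t. norm (G j n t) \<le> B n * 2 ^ (j * n) * a j) \<Longrightarrow> (\<And>j. 0 \<le> a j) \<Longrightarrow> summable a \<Longrightarrow>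
     (\<And>t. (\<lambda>j. G j 0 t) sums g t) \<Longrightarrow> continuous_on UNIV g \<Longrightarrow>
     Linf_norm (besov_piece \<theta> k (dist_of (\<lambda>x. g (norm x))))
       \<le> ennreal (C * (\<Sum>j. min 1 (4 ^ (m * j) / 4 ^ (m * k)) * a j))"
proof -
  let ?k = "complex_of_real ((2 * pi) powr (- real DIM('a) / 2))"
  note thS = besov_cutoff_schwartz[OF theta]
  \<comment> \<open>For \<open>k > 0\<close> every dyadic symbol is a dilate of this one. It
    vanishes for \<open>norm \<xi> < 1/2\<close>, since both terms are \<open>1\<close>
    there.\<close>
  define \<kappa> where "\<kappa> \<xi> = \<theta> \<xi> - \<theta> (2 *\<^sub>R \<xi>)" for \<xi>
  have kap: "\<kappa> \<in> schwartz"
    unfolding \<kappa>_def[abs_def] using schwartz_scale[OF thS, of 2 0] by (intro schwartz_diff thS) simp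
  have kap0: "\<kappa> x = 0" if "norm x < 1/2" for x
  proof -
    have "\<theta> x = 1" "\<theta> (2 *\<^sub>R x) = 1" using theta that unfolding besov_cutoff_def by auto
    then show ?thesis by (simp add: \<kappa>_def)
  qed
  \<comment> \<open>The \<open>m\<close>-th power of the Laplacian has the symbol
    \<open>(- (x \<bullet> x)) ^ m\<close>, so dividing by it exhibits the kernel of
    \<open>\<kappa>\<close> as such a power applied to a Schwartz kernel. At the origin both
    functions are \<open>0\<close>.\<close>
  define \<rho> where "\<rho> x = (-1) ^ m * (\<kappa> x / of_real (x \<bullet> x) ^ m)" for x
  have rho: "\<rho> \<in> schwartz"
    unfolding \<rho>_def[abs_def] by (intro schwartz_cmult schwartz_divide_norm_power kap kap0)
  have kap_rho: "\<kappa> x = (- of_real (x \<bullet> x)) ^ m * \<rho> x" for x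
  proof (cases "x = 0")
    case True
    then show ?thesis using kap0[of 0] by (simp add: \<rho>_def)
  next
    case False
    then have "of_real (x \<bullet> x) ^ m \<noteq> (0::complex)" by simp
    moreover have "(- complex_of_real (x \<bullet> x)) ^ m = (-1) ^ m * of_real (x \<bullet> x) ^ m"
      by (rule power_minus)
    moreover have "(-1) ^ m * (-1) ^ m = (1::complex)"
      by (simp flip: power_mult_distrib)
    ultimately show ?thesis
      unfolding \<rho>_def by (simp add: mult_ac del: inner_eq_zero_iff)
  qed
  have dy: "dyadic \<theta> k = (\<lambda>\<xi>. \<kappa> (inverse (2 ^ k) *\<^sub>R \<xi>))" if "k > 0" for k
  proof -
    have "2 powr (- real k) = inverse (2 ^ k)" by (simp add: powr_minus powr_realpow)
    moreover have "2 powr (- real k + 1) = 2 * inverse (2 ^ k)"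
      by (subst powr_add) (simp add: powr_minus powr_realpow)
    ultimately show ?thesis using that by (simp add: dyadic_def \<kappa>_def)
  qed
  define \<rho>' where "\<rho>' k \<xi> = \<rho> (inverse (2 ^ k) *\<^sub>R \<xi>)" for k :: nat and \<xi>
  have rho': "\<rho>' k \<in> schwartz" for k
    unfolding \<rho>'_def[abs_def] using schwartz_scale[OF rho, of "inverse (2 ^ k)" 0] by simp
  define K where "K k z = ?k * fourier (dyadic \<theta> k) z" for k z
  have K: "K k \<in> schwartz" for k
    unfolding K_def[abs_def] by (intro schwartz_cmult fourier_schwartz dyadic_schwartz theta)
  define A where "A = (LINT z|lborel. norm (?k * fourier \<theta> z)) + (LINT z|lborel. norm (?k * fourier \<kappa> z))"
  have K_L1: "(LINT z|lborel. norm (K k z)) \<le> A" for k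
  proof (cases "k = 0")
    case True
    then show ?thesis by (simp add: K_def dyadic_def A_def)
  next
    case False
    then have "(LINT z|lborel. norm (K k z)) = (LINT z|lborel. norm (?k * fourier \<kappa> z))"
      using fourier_scale_L1[OF kap, of "inverse (2 ^ k)"] by (simp add: K_def dy norm_mult)
    then show ?thesis by (simp add: A_def)
  qed
  define R where "R = (LINT z|lborel. norm (?k * fourier \<rho> z))"
  have K_lap: "K k = (\<lambda>z. inverse (4 ^ (m * k)) * (?k * (laplacian ^^ m) (fourier (\<rho>' k)) z))" if "k > 0" for k
  proof -
    have "dyadic \<theta> k = (\<lambda>\<xi>. inverse (4 ^ (m * k)) * ((- of_real (\<xi> \<bullet> \<xi>)) ^ m * \<rho>' k \<xi>))"
    proof
      fix \<xi> :: 'a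
      let ?r = "inverse (2 ^ k) :: real"
      have "(- complex_of_real ((?r *\<^sub>R \<xi>) \<bullet> (?r *\<^sub>R \<xi>))) = inverse (4 ^ k) * (- of_real (\<xi> \<bullet> \<xi>))"
        by (simp add: power_mult_distrib[symmetric] mult.assoc[symmetric] flip: inverse_mult_distrib)
      then have "(- complex_of_real ((?r *\<^sub>R \<xi>) \<bullet> (?r *\<^sub>R \<xi>))) ^ m = inverse (4 ^ (m * k)) * (- of_real (\<xi> \<bullet> \<xi>)) ^ m"
        by (simp only: power_mult_distrib power_inverse power_mult[symmetric] mult.commute)
      then show "dyadic \<theta> k \<xi> = inverse (4 ^ (m * k)) * ((- of_real (\<xi> \<bullet> \<xi>)) ^ m * \<rho>' k \<xi>)"
        by (simp only: dy[OF that] kap_rho[of "?r *\<^sub>R \<xi>"] \<rho>'_def mult.assoc)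
    qed
    note e = this
    have "K k z = inverse (4 ^ (m * k)) * (?k * fourier (\<lambda>\<xi>. (- of_real (\<xi> \<bullet> \<xi>)) ^ m * \<rho>' k \<xi>) z)" for z
      unfolding K_def e fourier_cmult[of "inverse (4 ^ (m * k))" "\<lambda>\<xi>. (- of_real (\<xi> \<bullet> \<xi>)) ^ m * \<rho>' k \<xi>" z]
      by (rule mult.left_commute)
    then show ?thesis unfolding laplacian_iterate_fourier[OF rho'] by (rule HOL.ext)
  qed
  define C where "C = max (\<bar>B 0\<bar> * A) (\<bar>real DIM('a) ^ m * B (2 * m)\<bar> * R)"
  have A0: "A \<ge> 0" and R0: "R \<ge> 0" unfolding A_def R_def by (auto intro!: add_nonneg_nonneg)
  have C0: "C \<ge> 0" unfolding C_def by (simp add: A0 le_max_iff_disj)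
  show ?thesis
  proof (rule that[OF C0])
    fix a G g k
    assume G: "\<And>j. deriv_seq (G j)" and even: "\<And>j t. G j 0 (- t) = G j 0 t"
      and bd: "\<And>j n t. norm (G j n t) \<le> B n * 2 ^ (j * n) * a j" and a0: "\<And>j. 0 \<le> a j" and sa: "summable a"
      and sums: "\<And>t. (\<lambda>j. G j 0 t) sums g t" and g: "continuous_on UNIV g"
    let ?w = "\<lambda>j. min 1 (4 ^ (m * j) / 4 ^ (m * k)) :: real"
    have w: "0 \<le> ?w j" "?w j \<le> 1" for j by auto
    define F where "F x = g (norm x)" for x :: 'a
    have Fj [measurable]: "(\<lambda>x::'a. G j 0 (norm x)) \<in> borel_measurable borel" for j
      using deriv_seq_measurable[OF G, of j 0] by measurable
    have [measurable]: "F \<in> borel_measurable borel"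
      unfolding F_def[abs_def] using borel_measurable_continuous_onI[OF g] by measurable
    have Fjb: "norm (G j 0 (norm x)) \<le> \<bar>B 0\<bar> * a j" for j and x :: 'a
      using order_trans[OF bd[of j 0 "norm x"] mult_right_mono[OF abs_ge_self a0[of j]]] by simp
    have sB: "summable (\<lambda>j. \<bar>B 0\<bar> * a j)" using sa by (rule summable_mult)
    have Fs: "(\<lambda>j. G j 0 (norm x)) sums F x" for x
      unfolding F_def by (rule sums)
    have Fb: "norm (F x) \<le> (\<Sum>j. \<bar>B 0\<bar> * a j)" for x
    proof -
      have "summable (\<lambda>j. norm (G j 0 (norm x)))"
        by (rule summable_comparison_test'[OF sB]) (simp add: Fjb)
      then have "norm (\<Sum>j. G j 0 (norm x)) \<le> (\<Sum>j. \<bar>B 0\<bar> * a j)"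
        by (intro order_trans[OF summable_norm] suminf_le sB Fjb)
      then show ?thesis using Fs[of x] by (simp add: sums_iff)
    qed
    have summand: "norm (LINT x|lborel. G j 0 (norm x) * K k (x - y)) \<le> C * (?w j * a j)" for j y
    proof -
      have trivial: "norm (LINT x|lborel. G j 0 (norm x) * K k (x - y)) \<le> C * a j"
      proof -
        have "norm (corr (\<lambda>x. G j 0 (norm x)) (K k) y) \<le> (\<bar>B 0\<bar> * a j) * (LINT z|lborel. norm (K k z))"
          by (rule corr_bound[OF Fj Fjb K])
        also have "\<dots> \<le> (\<bar>B 0\<bar> * a j) * A"
          by (intro mult_left_mono K_L1 mult_nonneg_nonneg a0) auto
        also have "\<dots> \<le> C * a j"
          using mult_right_mono[OF max.cobounded1[of "\<bar>B 0\<bar> * A" "\<bar>real DIM('a) ^ m * B (2 * m)\<bar> * R"] a0[of j]]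
          by (simp add: C_def mult_ac)
        finally show ?thesis by (simp add: corr_def)
      qed
      show ?thesis
      \<comment> \<open>For \<open>k = 0\<close> the symbol is \<open>\<theta>\<close> itself, which
        does not vanish near the origin; but then the minimum is \<open>1\<close> and the trivial
        bound suffices.\<close>
      proof (cases "k = 0 \<or> ?w j = 1")
        case True
        then have "?w j = 1" by auto
        then show ?thesis using trivial by simp
      next
        case False
        then have k: "k > 0" and wj: "?w j = 4 ^ (m * j) / 4 ^ (m * k)" by (auto simp: min_def split: if_splits)
        have S: "(\<lambda>x. fourier (\<rho>' k) (x - y)) \<in> schwartz"
          by (intro schwartz_translate fourier_schwartz rho')
        let ?H = "(radial_laplacian DIM('a) ^^ m) (G j)"
        have Gb: "norm (G j n t) \<le> B n * 2 ^ (j * n) * a j" for n t by (rule bd)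
        have D1: "DIM('a) \<ge> 1" using DIM_positive[where 'a = 'a] by (simp add: Suc_leI)
        have H: "deriv_seq ?H" "norm (?H n t) \<le> real DIM('a) ^ m * (B (n + 2 * m) * 2 ^ (j * (n + 2 * m)) * a j)" for n t
          using radial_laplacian_iterate[OF G even Gb D1, of m] by auto
        have Hm: "(\<lambda>x::'a. ?H 0 (norm x)) \<in> borel_measurable borel"
          using deriv_seq_measurable[OF H(1), of 0] by measurable
        \<comment> \<open>The \<open>2 * m\<close> derivatives of the term cost a factor
          \<open>2 ^ j\<close> each.\<close>
        have pow: "(2::real) ^ (j * (2 * m)) = 4 ^ (m * j)"
          using power_mult[of "2::real" 2 "m * j"] by (simp add: mult_ac)
        have Hb: "norm (?H 0 (norm x)) \<le> \<bar>real DIM('a) ^ m * B (2 * m)\<bar> * 4 ^ (m * j) * a j" for x :: 'a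
        proof -
          have "norm (?H 0 (norm x)) \<le> (real DIM('a) ^ m * B (2 * m)) * (4 ^ (m * j) * a j)"
            using H(2)[of 0 "norm x"] by (simp add: pow mult.assoc)
          also have "\<dots> \<le> \<bar>real DIM('a) ^ m * B (2 * m)\<bar> * (4 ^ (m * j) * a j)"
            by (rule mult_right_mono[OF abs_ge_self]) (simp add: a0)
          finally show ?thesis by (simp only: mult.assoc)
        qed
        have "(LINT x|lborel. G j 0 (norm x) * K k (x - y))
            = (LINT x|lborel. (inverse (4 ^ (m * k)) * ?k) * (G j 0 (norm x) * (laplacian ^^ m) (\<lambda>x. fourier (\<rho>' k) (x - y)) x))"
          unfolding laplacian_iterate_translate[OF fourier_schwartz[OF rho']] K_lap[OF k]
          by (intro Bochner_Integration.integral_cong) auto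
        also have "\<dots> = (inverse (4 ^ (m * k)) * ?k) * (LINT x|lborel. G j 0 (norm x) * (laplacian ^^ m) (\<lambda>x. fourier (\<rho>' k) (x - y)) x)"
          by (rule integral_mult_right_zero)
        also have "(LINT x|lborel. G j 0 (norm x) * (laplacian ^^ m) (\<lambda>x. fourier (\<rho>' k) (x - y)) x)
            = (LINT x|lborel. ?H 0 (norm x) * fourier (\<rho>' k) (x - y))"
          by (rule radial_weak_laplacian_iterate[OF G even Gb S])
        also have "(inverse (4 ^ (m * k)) * ?k) * \<dots> = inverse (4 ^ (m * k)) * (?k * (LINT x|lborel. ?H 0 (norm x) * fourier (\<rho>' k) (x - y)))"
          by (rule mult.assoc)
        also have "?k * (LINT x|lborel. ?H 0 (norm x) * fourier (\<rho>' k) (x - y)) = corr (\<lambda>x. ?H 0 (norm x)) (\<lambda>z. ?k * fourier (\<rho>' k) z) y"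
          unfolding corr_def by (subst integral_mult_right_zero[symmetric]) (simp only: mult.left_commute)
        finally have "norm (LINT x|lborel. G j 0 (norm x) * K k (x - y))
            = inverse (4 ^ (m * k)) * norm (corr (\<lambda>x. ?H 0 (norm x)) (\<lambda>z. ?k * fourier (\<rho>' k) z) y)"
          by (simp add: norm_mult norm_inverse norm_power)
        also have "\<dots> \<le> inverse (4 ^ (m * k)) * ((\<bar>real DIM('a) ^ m * B (2 * m)\<bar> * 4 ^ (m * j) * a j) * R)"
        proof (rule mult_left_mono)
          have "norm (corr (\<lambda>x. ?H 0 (norm x)) (\<lambda>z. ?k * fourier (\<rho>' k) z) y)
              \<le> (\<bar>real DIM('a) ^ m * B (2 * m)\<bar> * 4 ^ (m * j) * a j) * (LINT z|lborel. norm (?k * fourier (\<rho>' k) z))"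
            by (intro corr_bound Hm Hb schwartz_cmult fourier_schwartz rho')
          also have "(LINT z|lborel. norm (?k * fourier (\<rho>' k) z)) = R"
            using fourier_scale_L1[OF rho, of "inverse (2 ^ k)"] by (simp add: R_def norm_mult \<rho>'_def[abs_def])
          finally show "norm (corr (\<lambda>x. ?H 0 (norm x)) (\<lambda>z. ?k * fourier (\<rho>' k) z) y)
              \<le> (\<bar>real DIM('a) ^ m * B (2 * m)\<bar> * 4 ^ (m * j) * a j) * R" .
        qed simp
        also have "\<dots> = (\<bar>real DIM('a) ^ m * B (2 * m)\<bar> * R) * (?w j * a j)"
          unfolding wj by (simp add: divide_inverse mult_ac)
        also have "\<dots> \<le> C * (?w j * a j)"
          unfolding C_def by (intro mult_right_mono max.cobounded2 mult_nonneg_nonneg w a0)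
        finally show ?thesis .
      qed
    qed
    have swa: "summable (\<lambda>j. ?w j * a j)"
      by (rule summable_comparison_test'[OF sa]) (use w a0 in \<open>auto simp: abs_mult intro!: mult_left_le_one_le\<close>)
    have corr_b: "norm (corr F (K k) y) \<le> C * (\<Sum>j. ?w j * a j)" for y
    proof -
      have s1: "(\<lambda>j. LINT x|lborel. G j 0 (norm x) * K k (x - y)) sums (LINT x|lborel. F x * K k (x - y))"
        by (rule sums_integral_schwartz[OF Fj Fjb sB Fs]) (intro schwartz_translate K)
      have "summable (\<lambda>j. norm (LINT x|lborel. G j 0 (norm x) * K k (x - y)))"
        by (rule summable_comparison_test'[OF summable_mult[OF swa, of C]]) (simp add: summand)
      then have "norm (\<Sum>j. LINT x|lborel. G j 0 (norm x) * K k (x - y)) \<le> (\<Sum>j. C * (?w j * a j))"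
        by (intro order_trans[OF summable_norm] suminf_le summand summable_mult swa)
      also have "(\<Sum>j. C * (?w j * a j)) = C * (\<Sum>j. ?w j * a j)"
        by (rule suminf_mult[OF swa])
      finally show ?thesis using s1 by (simp add: corr_def sums_iff)
    qed
    have "besov_piece \<theta> k (dist_of F) = dist_of (corr F (K k))"
    proof
      fix \<psi>
      show "besov_piece \<theta> k (dist_of F) \<psi> = dist_of (corr F (K k)) \<psi>"
      proof (cases "\<psi> \<in> schwartz")
        case psi: True
        have "fourier (\<lambda>\<xi>. dyadic \<theta> k \<xi> * inv_fourier \<psi> \<xi>) \<in> schwartz"
          by (intro fourier_schwartz schwartz_mult dyadic_schwartz theta inv_fourier_schwartz psi)
        then have "besov_piece \<theta> k (dist_of F) \<psi> = (LINT x|lborel. F x * (LINT y|lborel. \<psi> y * K k (x - y)))"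
          by (simp add: besov_piece_eq[OF theta psi] dist_of_def K_def fourier_mult_inv_fourier[OF dyadic_schwartz[OF theta] psi])
        also have "\<dots> = (LINT y|lborel. corr F (K k) y * \<psi> y)"
          by (rule fubini_corr[OF _ Fb psi K]) measurable
        finally show ?thesis using psi by (simp add: dist_of_def)
      qed (simp add: besov_piece_notin dist_of_def)
    qed
    moreover have "Linf_norm (dist_of (corr F (K k))) \<le> ennreal (C * (\<Sum>j. ?w j * a j))"
    proof (rule Linf_norm_dist_of_le[OF _ corr_b])
      show "corr F (K k) \<in> borel_measurable borel"
        by (rule borel_measurable_continuous_onI[OF corr_continuous[OF _ Fb K]]) measurable
    qed
    ultimately show "Linf_norm (besov_piece \<theta> k (dist_of (\<lambda>x. g (norm x))))
       \<le> ennreal (C * (\<Sum>j. ?w j * a j))"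
      by (simp add: F_def[abs_def])
  qed
qed

section \<open>The discrete convolution estimate\<close>

text \<open>Subtraction on \<open>nat\<close> truncates, so at least one of the two summands is
  \<open>0\<close> and the sum is the distance of \<open>j\<close> and \<open>k\<close>.\<close>

definition nat_dist :: "nat \<Rightarrow> nat \<Rightarrow> nat" where
  "nat_dist j k = (j - k) + (k - j)"

lemma nat_dist_commute: "nat_dist j k = nat_dist k j"
  by (simp add: nat_dist_def)

text \<open>The terms with \<open>j \<ge> k\<close> form a full geometric series and those with
  \<open>j < k\<close> a part of another one, so the bound does not depend on
  \<open>k\<close>.\<close>

lemma power_nat_dist_sums:
  fixes e :: real
  assumes e: "0 < e" "e < 1"
  shows "summable (\<lambda>j. e ^ nat_dist j k)" "(\<Sum>j. e ^ nat_dist j k) \<le> 2 / (1 - e)"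
proof -
  have g: "summable (\<lambda>i. e ^ i)" "(\<Sum>i. e ^ i) = 1 / (1 - e)"
    using e summable_geometric[of e] suminf_geometric[of e] by auto
  have "summable (\<lambda>j. e ^ nat_dist j k) \<and> (\<Sum>j. e ^ nat_dist j k) = (\<Sum>i<k. e ^ Suc i) + 1 / (1 - e)"
  proof (induction k)
    case 0
    then show ?case using g by (simp add: nat_dist_def)
  next
    case (Suc k)
    have sh: "nat_dist (Suc j) (Suc k) = nat_dist j k" for j by (simp add: nat_dist_def)
    have s: "summable (\<lambda>j. e ^ nat_dist j (Suc k))"
      by (subst summable_Suc_iff[symmetric]) (simp add: sh Suc)
    have "(\<Sum>j. e ^ nat_dist j (Suc k)) = (\<Sum>j. e ^ nat_dist (Suc j) (Suc k)) + e ^ nat_dist 0 (Suc k)"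
      using suminf_split_head[OF s] by simp
    then show ?case using s Suc by (simp add: sh nat_dist_def)
  qed
  moreover have "(\<Sum>i<k. e ^ Suc i) \<le> (\<Sum>i<k. e ^ i)"
    using e by (intro sum_mono) (simp add: mult_left_le_one_le)
  moreover have "(\<Sum>i<k. e ^ i) \<le> 1 / (1 - e)"
    using g e sum_le_suminf[OF g(1), of "{..<k}"] by simp
  ultimately show "summable (\<lambda>j. e ^ nat_dist j k)" "(\<Sum>j. e ^ nat_dist j k) \<le> 2 / (1 - e)"
    by (auto simp: add_divide_distrib[symmetric])
qed

lemma ennreal_powr_ennreal: "x \<ge> 0 \<Longrightarrow> ennreal_powr (ennreal x) p = ennreal (x powr p)"
  by (simp add: ennreal_powr_def)

lemma ennreal_powr_mono:
  assumes "p > 0" "x \<le> y" shows "ennreal_powr x p \<le> ennreal_powr y p"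
proof (cases "y = \<infinity>")
  case False
  then have "y < \<infinity>" by (simp add: less_top[symmetric])
  then have "x < \<infinity>" using assms(2) by (rule le_less_trans[rotated])
  then obtain a b where "x = ennreal a" "a \<ge> 0" "y = ennreal b" "b \<ge> 0"
    using \<open>y < \<infinity>\<close> by (metis ennreal_cases infinity_ennreal_def less_irrefl)
  then show ?thesis using assms
    by (auto simp: ennreal_powr_ennreal intro!: ennreal_leI powr_mono2)
qed (simp add: ennreal_powr_def)

lemma ennreal_powr_top [simp]: "ennreal_powr top p = top"
  by (simp add: ennreal_powr_def)

lemma lq_norm_ge:
  assumes q: "q > 0"
  shows "A j \<le> lq_norm q A"
proof (cases "q = \<infinity>")
  case True
  then show ?thesis by (simp add: lq_norm_def SUP_upper)
next
  case False
  define p where "p = enn2real q"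
  have p: "p > 0" using q False by (simp add: p_def enn2real_positive_iff less_top[symmetric])
  have "A j = ennreal_powr (ennreal_powr (A j) p) (1 / p)"
  proof (cases "A j" rule: ennreal_cases)
    case (real r)
    then show ?thesis using p by (simp add: ennreal_powr_ennreal powr_powr)
  qed simp
  also have "\<dots> \<le> ennreal_powr (\<Sum>j. ennreal_powr (A j) p) (1 / p)"
  proof (rule ennreal_powr_mono)
    show "ennreal_powr (A j) p \<le> (\<Sum>j. ennreal_powr (A j) p)"
      using sum_le_suminf[of "\<lambda>j. ennreal_powr (A j) p" "{j}"] by simp
  qed (use p in simp)
  finally show ?thesis using False by (simp add: lq_norm_def p_def)
qed

lemma ennreal_suminf_swap:
  fixes f :: "nat \<Rightarrow> nat \<Rightarrow> ennreal"
  shows "(\<Sum>i. \<Sum>j. f i j) = (\<Sum>j. \<Sum>i. f i j)"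
proof -
  have "(\<Sum>i. \<Sum>j. f i j) = (\<Sum>i. \<integral>\<^sup>+ j. f i j \<partial>count_space UNIV)"
    by (simp add: nn_integral_count_space_nat)
  also have "\<dots> = (\<integral>\<^sup>+ j. (\<Sum>i. f i j) \<partial>count_space UNIV)"
    by (rule nn_integral_suminf[symmetric]) simp
  finally show ?thesis by (simp add: nn_integral_count_space_nat)
qed

text \<open>Of the weights \<open>e\<^sup>2\<^sup>|\<^sup>j\<^sup>-\<^sup>k\<^sup>|\<close>, one factor \<open>e\<^sup>|\<^sup>j\<^sup>-\<^sup>k\<^sup>|\<close> pays for replacing the sum over \<open>j\<close> by a
  supremum, which is dominated by the \<open>\<ell>\<^sub>q\<close> sum with the other factor; so \<open>q < 1\<close> needs no separate treatment.\<close>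

lemma lq_norm_convolution:
  fixes e C :: real
  assumes e: "0 < e" "e < 1" and q: "q > 0" and C: "C \<ge> 0"
  obtains D :: real where "D \<ge> 0"
    "\<And>A B. (\<And>j. 0 \<le> A j) \<Longrightarrow> lq_norm q (\<lambda>j. ennreal (A j)) < \<infinity> \<Longrightarrow>
      (\<And>k. B k \<le> ennreal (C * (\<Sum>j. (e ^ nat_dist j k)\<^sup>2 * A j))) \<Longrightarrow>
      lq_norm q B \<le> ennreal D * lq_norm q (\<lambda>j. ennreal (A j))"
proof -
  define L where "L = 2 / (1 - e)"
  have L: "L \<ge> 0" using e by (simp add: L_def)
  have key: "summable (\<lambda>j. (e ^ nat_dist j k)\<^sup>2 * A j) \<and> (\<Sum>j. (e ^ nat_dist j k)\<^sup>2 * A j) \<le> L * U"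
    if A: "\<And>j. 0 \<le> A j" and U: "\<And>j. e ^ nat_dist j k * A j \<le> U" for A U k
  proof -
    have U0: "U \<ge> 0" using order_trans[OF _ U[of 0]] A e by simp
    have le: "(e ^ nat_dist j k)\<^sup>2 * A j \<le> e ^ nat_dist j k * U" for j
      unfolding power2_eq_square mult.assoc using e by (intro mult_left_mono U) auto
    have s: "summable (\<lambda>j. e ^ nat_dist j k * U)"
      by (intro summable_mult2 power_nat_dist_sums e)
    have s': "summable (\<lambda>j. (e ^ nat_dist j k)\<^sup>2 * A j)"
      by (rule summable_comparison_test'[OF s, of 0]) (use le A in auto)
    have "(\<Sum>j. (e ^ nat_dist j k)\<^sup>2 * A j) \<le> (\<Sum>j. e ^ nat_dist j k * U)"
      by (intro suminf_le le s s')
    also have "\<dots> = (\<Sum>j. e ^ nat_dist j k) * U"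
      by (rule suminf_mult2[symmetric]) (intro power_nat_dist_sums e)
    also have "\<dots> \<le> L * U"
      unfolding L_def by (intro mult_right_mono power_nat_dist_sums e U0)
    finally show ?thesis using s' by simp
  qed
  show ?thesis
  proof (cases "q = \<infinity>")
    case True
    show ?thesis
    proof (rule that[of "C * L"])
      fix A :: "nat \<Rightarrow> real" and B
      assume A: "\<And>j. 0 \<le> A j" and fin: "lq_norm q (\<lambda>j. ennreal (A j)) < \<infinity>"
        and B: "\<And>k. B k \<le> ennreal (C * (\<Sum>j. (e ^ nat_dist j k)\<^sup>2 * A j))"
      obtain U where U: "lq_norm q (\<lambda>j. ennreal (A j)) = ennreal U" "U \<ge> 0"
        using fin by (metis ennreal_cases infinity_ennreal_def less_irrefl)
      have AU: "A j \<le> U" for j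
        using lq_norm_ge[OF q, of "\<lambda>j. ennreal (A j)" j] U by simp
      have "e ^ nat_dist j k * A j \<le> U" for j k
        using mult_mono[OF power_le_one[of e "nat_dist j k"] AU[of j]] A[of j] e by simp
      then have "C * (\<Sum>j. (e ^ nat_dist j k)\<^sup>2 * A j) \<le> C * (L * U)" for k
        using key[where A = A and k = k and U = U, OF A] C by (intro mult_left_mono) auto
      then have "B k \<le> ennreal (C * L * U)" for k
        using order_trans[OF B ennreal_leI] by (simp add: mult.assoc)
      then show "lq_norm q B \<le> ennreal (C * L) * lq_norm q (\<lambda>j. ennreal (A j))"
        using True U C L by (subst U(1)) (auto simp: lq_norm_def ennreal_mult intro!: SUP_least)
    qed (use C L in simp)
  next
    case False
    define p where "p = enn2real q"
    have p: "p > 0" using q False by (simp add: p_def enn2real_positive_iff less_top[symmetric])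
    have "e powr p < 1 powr p" using e p by (intro powr_less_mono2) auto
    then have ep: "0 < e powr p" "e powr p < 1" using e(1) by simp_all
    define L' where "L' = 2 / (1 - e powr p)"
    have L': "L' \<ge> 0" using ep by (simp add: L'_def)
    define D where "D = ((C * L) powr p * L') powr (1 / p)"
    show ?thesis
    proof (rule that[of D])
      fix A :: "nat \<Rightarrow> real" and B
      assume A: "\<And>j. 0 \<le> A j" and fin: "lq_norm q (\<lambda>j. ennreal (A j)) < \<infinity>"
        and B: "\<And>k. B k \<le> ennreal (C * (\<Sum>j. (e ^ nat_dist j k)\<^sup>2 * A j))"
      have lqA: "lq_norm q (\<lambda>j. ennreal (A j)) = ennreal_powr (\<Sum>j. ennreal (A j powr p)) (1 / p)"
        unfolding lq_norm_def p_def using False A by (simp add: ennreal_powr_ennreal)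
      have "(\<Sum>j. ennreal (A j powr p)) \<noteq> top"
      proof
        assume "(\<Sum>j. ennreal (A j powr p)) = top"
        then have "lq_norm q (\<lambda>j. ennreal (A j)) = top" unfolding lqA by (simp only: ennreal_powr_top)
        then show False using fin by (simp only: infinity_ennreal_def less_irrefl)
      qed
      then obtain S where S: "(\<Sum>j. ennreal (A j powr p)) = ennreal S" "S \<ge> 0"
        by (metis ennreal_cases)
      have sA: "summable (\<lambda>j. A j powr p)"
        using S by (intro summable_suminf_not_top) auto
      \<comment> \<open>This sum replaces the supremum over \<open>j\<close> of
        \<open>(e ^ nat_dist j k * A j) powr p\<close>; being linear in the numbers
        \<open>A j powr p\<close>, it can be summed over \<open>k\<close>.\<close>
      define U where "U k = (\<Sum>j. (e powr p) ^ nat_dist j k * A j powr p)" for k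
      have sU: "summable (\<lambda>j. (e powr p) ^ nat_dist j k * A j powr p)" for k
        by (rule summable_comparison_test'[OF sA, of 0])
          (use ep in \<open>auto simp: abs_mult intro!: mult_left_le_one_le power_le_one\<close>)
      have U0: "U k \<ge> 0" for k
        unfolding U_def using ep by (intro suminf_nonneg sU) auto
      have "e ^ nat_dist j k * A j \<le> U k powr (1 / p)" for j k
      proof -
        have "(e powr p) ^ nat_dist j k * A j powr p \<le> U k"
          unfolding U_def using sum_le_suminf[OF sU, of "{j}" k] ep by simp
        moreover have "(e powr p) ^ nat_dist j k = (e ^ nat_dist j k) powr p"
          unfolding powr_realpow[OF ep(1), symmetric] powr_realpow[OF e(1), symmetric] powr_powr
          by (simp only: mult.commute)
        then have "(e powr p) ^ nat_dist j k * A j powr p = (e ^ nat_dist j k * A j) powr p"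
          using e A[of j] by (simp only: powr_mult)
        ultimately have "((e ^ nat_dist j k * A j) powr p) powr (1 / p) \<le> U k powr (1 / p)"
          using p by (intro powr_mono2) auto
        then show ?thesis using p e A[of j] by (simp add: powr_powr)
      qed
      then have "C * (\<Sum>j. (e ^ nat_dist j k)\<^sup>2 * A j) \<le> C * (L * U k powr (1 / p))" for k
        using key[where A = A and k = k and U = "U k powr (1 / p)", OF A] C by (intro mult_left_mono) auto
      then have Bk: "B k \<le> ennreal (C * L * U k powr (1 / p))" for k
        using order_trans[OF B ennreal_leI] by (simp add: mult.assoc)
      have "ennreal_powr (B k) p \<le> ennreal ((C * L) powr p * U k)" for k
      proof -
        have "ennreal_powr (B k) p \<le> ennreal_powr (ennreal (C * L * U k powr (1 / p))) p"
          by (rule ennreal_powr_mono[OF p Bk])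
        also have "\<dots> = ennreal ((C * L) powr p * U k)"
          using C L U0[of k] p by (simp add: ennreal_powr_ennreal powr_mult powr_powr)
        finally show ?thesis .
      qed
      then have "(\<Sum>k. ennreal_powr (B k) p) \<le> (\<Sum>k. ennreal ((C * L) powr p) * ennreal (U k))"
        by (intro suminf_le) (auto simp: ennreal_mult U0)
      also have "\<dots> = ennreal ((C * L) powr p) * (\<Sum>k. ennreal (U k))"
        by simp
      finally have 1: "(\<Sum>k. ennreal_powr (B k) p) \<le> ennreal ((C * L) powr p) * (\<Sum>k. ennreal (U k))" .
      have "(\<Sum>k. ennreal (U k)) = (\<Sum>k. \<Sum>j. ennreal ((e powr p) ^ nat_dist j k * A j powr p))"
        unfolding U_def using sU ep by (subst suminf_ennreal2) auto
      \<comment> \<open>After the exchange the inner sum runs over the weights alone and is at most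
        \<open>L'\<close>.\<close>
      also have "\<dots> = (\<Sum>j. \<Sum>k. ennreal ((e powr p) ^ nat_dist j k * A j powr p))"
        by (rule ennreal_suminf_swap)
      also have "\<dots> = (\<Sum>j. (\<Sum>k. ennreal ((e powr p) ^ nat_dist k j)) * ennreal (A j powr p))"
      proof -
        have "ennreal ((e powr p) ^ nat_dist j k * A j powr p) = ennreal ((e powr p) ^ nat_dist k j) * ennreal (A j powr p)" for j k
          using ep by (subst nat_dist_commute) (simp add: ennreal_mult)
        then show ?thesis by simp
      qed
      also have "\<dots> \<le> (\<Sum>j. ennreal L' * ennreal (A j powr p))"
      proof (intro suminf_le mult_right_mono)
        fix j
        have "(\<Sum>k. ennreal ((e powr p) ^ nat_dist k j)) = ennreal (\<Sum>k. (e powr p) ^ nat_dist k j)"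
          using ep power_nat_dist_sums[OF ep] by (subst suminf_ennreal2) auto
        also have "\<dots> \<le> ennreal L'"
          unfolding L'_def by (intro ennreal_leI power_nat_dist_sums ep)
        finally show "(\<Sum>k. ennreal ((e powr p) ^ nat_dist k j)) \<le> ennreal L'" .
      qed auto
      also have "\<dots> = ennreal L' * ennreal S" using S by simp
      finally have "ennreal ((C * L) powr p) * (\<Sum>k. ennreal (U k)) \<le> ennreal ((C * L) powr p) * (ennreal L' * ennreal S)"
        by (rule mult_left_mono) simp
      also have "\<dots> = ennreal ((C * L) powr p * L' * S)"
        using L' S by (simp add: ennreal_mult mult.assoc)
      finally have "(\<Sum>k. ennreal_powr (B k) p) \<le> ennreal ((C * L) powr p * L' * S)"
        by (rule order_trans[OF 1])
      then have "ennreal_powr (\<Sum>k. ennreal_powr (B k) p) (1 / p) \<le> ennreal_powr (ennreal ((C * L) powr p * L' * S)) (1 / p)"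
        by (rule ennreal_powr_mono[rotated]) (use p in simp)
      also have "\<dots> = ennreal D * ennreal (S powr (1 / p))"
      proof -
        have "((C * L) powr p * L' * S) powr (1 / p) = D * S powr (1 / p)"
          unfolding D_def using L' S by (simp only: powr_mult)
        moreover have "D \<ge> 0" by (simp add: D_def)
        moreover have "(C * L) powr p * L' * S \<ge> 0" using L' S by simp
        ultimately show ?thesis by (simp only: ennreal_powr_ennreal ennreal_mult powr_ge_zero)
      qed
      also have "ennreal (S powr (1 / p)) = lq_norm q (\<lambda>j. ennreal (A j))"
        unfolding lqA S(1) using S(2) by (simp add: ennreal_powr_ennreal)
      finally show "lq_norm q B \<le> ennreal D * lq_norm q (\<lambda>j. ennreal (A j))"
        using False by (simp add: lq_norm_def p_def)
    qed (simp add: D_def)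
  qed
qed

section \<open>Invariance of Lebesgue measure under orthogonal maps\<close>

lemma nn_integral_lborel_reflect:
  fixes g :: "'a::euclidean_space \<Rightarrow> ennreal"
  assumes [measurable]: "g \<in> borel_measurable borel"
  shows "(\<integral>\<^sup>+ y. g (a - y) \<partial>lborel) = (\<integral>\<^sup>+ y. g y \<partial>lborel)"
  by (subst (2) lborel_affine[of "-1" a]) (simp_all add: nn_integral_density nn_integral_distr one_ennreal_def[symmetric])

lemma nn_integral_lborel_translate:
  fixes g :: "'a::euclidean_space \<Rightarrow> ennreal"
  assumes [measurable]: "g \<in> borel_measurable borel"
  shows "(\<integral>\<^sup>+ y. g (y + a) \<partial>lborel) = (\<integral>\<^sup>+ y. g y \<partial>lborel)"
  by (subst (2) lborel_distr_plus[of a, symmetric]) (simp add: nn_integral_distr add.commute)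

text \<open>Both \<open>g \<mapsto> \<integral> g\<close> and \<open>g \<mapsto> \<integral> g \<circ> R\<close> are translation invariant, hence proportional, and
  they agree on radial functions.\<close>

lemma nn_integral_orthogonal:
  fixes g :: "'a::euclidean_space \<Rightarrow> ennreal" and R :: "'a \<Rightarrow> 'a"
  assumes [measurable]: "g \<in> borel_measurable borel" and R: "orthogonal_transformation R"
  shows "(\<integral>\<^sup>+ x. g (R x) \<partial>lborel) = (\<integral>\<^sup>+ x. g x \<partial>lborel)"
proof -
  have lin: "linear R" using R by (rule orthogonal_transformation_linear)
  then have [measurable]: "R \<in> borel_measurable borel"
    by (intro borel_measurable_continuous_onI linear_continuous_on) (simp add: linear_conv_bounded_linear)
  define S where "S = inv R"
  have RS: "R (S y) = y" for y
    unfolding S_def using orthogonal_transformation_surj[OF R] by (simp add: surj_f_inv_f)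
  \<comment> \<open>A radial function with finite positive integral; its integral is a factor that
    is cancelled at the end.\<close>
  define h where "h x = ennreal (1 / (1 + norm x) ^ (2 * DIM('a)))" for x :: 'a
  have [measurable]: "h \<in> borel_measurable borel" unfolding h_def[abs_def] by measurable
  have hR: "h (R x) = h x" for x by (simp add: h_def orthogonal_transformation_norm[OF R])
  let ?I = "\<integral>\<^sup>+ x. h x \<partial>lborel"
  have I_fin: "?I < \<infinity>"
    using integrable_inverse_power_norm[where 'a = 'a] unfolding integrable_iff_bounded h_def by simp
  have I_pos: "?I \<noteq> 0"
  proof
    assume "?I = 0"
    then have "AE x in lborel. h x = 0" by (subst (asm) nn_integral_0_iff_AE) auto
    then have "AE x in lborel :: 'a measure. False"
      by eventually_elim (simp add: h_def)
    then show False by (simp add: AE_iff_measurable[OF _ refl])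
  qed
  have "(\<integral>\<^sup>+ x. g (R x) \<partial>lborel) * ?I = (\<integral>\<^sup>+ x. g (R x) * (\<integral>\<^sup>+ y. h y \<partial>lborel) \<partial>lborel)"
    by (simp add: nn_integral_multc)
  also have "\<dots> = (\<integral>\<^sup>+ x. (\<integral>\<^sup>+ y. g (R x) * h (y + R x) \<partial>lborel) \<partial>lborel)"
    by (simp add: nn_integral_cmult nn_integral_lborel_translate)
  also have "\<dots> = (\<integral>\<^sup>+ y. (\<integral>\<^sup>+ x. g (R x) * h (y + R x) \<partial>lborel) \<partial>lborel)"
    by (rule lborel_pair.Fubini'[symmetric]) measurable
  \<comment> \<open>A translation by \<open>S y\<close> in the variable \<open>x\<close> moves
    \<open>R x\<close> by \<open>y\<close>, which shifts the increment from \<open>h\<close> to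
    \<open>g\<close>.\<close>
  also have "\<dots> = (\<integral>\<^sup>+ y. (\<integral>\<^sup>+ x. g (R x - y) * h (R x) \<partial>lborel) \<partial>lborel)"
  proof (rule nn_integral_cong)
    fix y :: 'a
    have "(\<integral>\<^sup>+ x. g (R x - y) * h (R x) \<partial>lborel) = (\<integral>\<^sup>+ x. g (R (x + S y) - y) * h (R (x + S y)) \<partial>lborel)"
      by (rule nn_integral_lborel_translate[symmetric]) measurable
    then show "(\<integral>\<^sup>+ x. g (R x) * h (y + R x) \<partial>lborel) = (\<integral>\<^sup>+ x. g (R x - y) * h (R x) \<partial>lborel)"
      by (simp add: linear_add[OF lin] RS add.commute)
  qed
  also have "\<dots> = (\<integral>\<^sup>+ x. (\<integral>\<^sup>+ y. g (R x - y) * h (R x) \<partial>lborel) \<partial>lborel)"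
    by (rule lborel_pair.Fubini') measurable
  also have "\<dots> = (\<integral>\<^sup>+ x. (\<integral>\<^sup>+ y. g y \<partial>lborel) * h x \<partial>lborel)"
    by (simp add: nn_integral_multc nn_integral_lborel_reflect hR)
  also have "\<dots> = (\<integral>\<^sup>+ y. g y \<partial>lborel) * ?I"
    by (simp add: nn_integral_cmult)
  finally show ?thesis using I_fin I_pos by (simp add: mult.commute[of _ ?I] ennreal_mult_cancel_left less_top[symmetric])
qed

lemma lborel_distr_orthogonal:
  fixes R :: "'a::euclidean_space \<Rightarrow> 'a"
  assumes R: "orthogonal_transformation R"
  shows "distr lborel borel R = lborel"
proof (rule measure_eqI)
  have [measurable]: "R \<in> borel_measurable borel"
    using orthogonal_transformation_linear[OF R]
    by (intro borel_measurable_continuous_onI linear_continuous_on) (simp add: linear_conv_bounded_linear)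
  fix A assume "A \<in> sets (distr lborel borel R)"
  then have [measurable]: "A \<in> sets borel" by simp
  have "emeasure (distr lborel borel R) A = (\<integral>\<^sup>+ x. indicator A x \<partial>distr lborel borel R)"
    by simp
  also have "\<dots> = (\<integral>\<^sup>+ x. indicator A (R x) \<partial>lborel)"
    by (subst nn_integral_distr) auto
  also have "\<dots> = emeasure lborel A"
    by (subst nn_integral_orthogonal[OF _ R]) auto
  finally show "emeasure (distr lborel borel R) A = emeasure lborel A" .
qed simp

lemma integral_orthogonal:
  fixes f :: "'a::euclidean_space \<Rightarrow> complex" and R :: "'a \<Rightarrow> 'a"
  assumes R: "orthogonal_transformation R" and [measurable]: "f \<in> borel_measurable borel"
  shows "(LINT x|lborel. f (R x)) = (LINT x|lborel. f x)"
proof -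
  have [measurable]: "R \<in> borel_measurable borel"
    using orthogonal_transformation_linear[OF R]
    by (intro borel_measurable_continuous_onI linear_continuous_on) (simp add: linear_conv_bounded_linear)
  show ?thesis
    by (subst (2) lborel_distr_orthogonal[OF R, symmetric]) (simp add: integral_distr)
qed

lemma schwartz_orthogonal:
  fixes \<psi> :: "'a::euclidean_space \<Rightarrow> complex"
  assumes "\<psi> \<in> schwartz" "orthogonal_transformation R"
  shows "(\<lambda>x. \<psi> (R x)) \<in> schwartz"
  using schwartz_comp_affine[OF assms(1) orthogonal_transformation_linear[OF assms(2)], of 1 0]
  by (simp add: orthogonal_transformation_norm[OF assms(2)])

text \<open>The composition of \<open>f\<close> with \<open>R\<close> represents \<open>T\<close> as
  well, by invariance of Lebesgue measure and of \<open>T\<close>; uniqueness of continuous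
  representatives then turns invariance in the sense of distributions into pointwise
  invariance.\<close>

lemma radial_cont_rep:
  fixes f \<kappa> :: "'a::euclidean_space \<Rightarrow> complex"
  assumes kap: "\<kappa> \<in> schwartz" "\<kappa> 0 = 1"
    and f: "is_cont_rep T f" and T: "radial_dist T" and R: "orthogonal_transformation R"
  shows "f (R x) = f x"
proof -
  define S where "S = inv R"
  have S: "orthogonal_transformation S" unfolding S_def using R by (rule orthogonal_transformation_inv)
  have RS: "R (S y) = y" for y
    unfolding S_def using orthogonal_transformation_surj[OF R] by (simp add: surj_f_inv_f)
  have c: "continuous_on UNIV f" and bd: "bounded (range f)" and Tf: "T = dist_of f"
    using f by (auto simp: is_cont_rep_def)
  have contR: "continuous_on UNIV R"
    using orthogonal_transformation_linear[OF R] by (simp add: linear_continuous_on linear_conv_bounded_linear)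
  have c': "continuous_on UNIV (\<lambda>x. f (R x))"
    using continuous_on_compose2[OF c contR] by simp
  note [measurable] = borel_measurable_continuous_onI[OF c'] borel_measurable_continuous_onI[OF c]
  have "T = dist_of (\<lambda>x. f (R x))"
  proof
    fix \<psi> show "T \<psi> = dist_of (\<lambda>x. f (R x)) \<psi>"
    proof (cases "\<psi> \<in> schwartz")
      case True
      note [measurable] = schwartz_measurable[OF True]
      have "dist_of (\<lambda>x. f (R x)) \<psi> = (LINT x|lborel. f (R (S x)) * \<psi> (S x))"
        using True by (simp add: dist_of_def integral_orthogonal[OF S, of "\<lambda>x. f (R x) * \<psi> x"])
      also have "\<dots> = T (\<lambda>x. \<psi> (S x))"
        using schwartz_orthogonal[OF True S] by (simp add: RS Tf dist_of_def)
      also have "\<dots> = T \<psi>" using T S True by (simp add: radial_dist_def)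
      finally show ?thesis ..
    qed (simp add: Tf dist_of_def)
  qed
  moreover have "bounded (range (\<lambda>x. f (R x)))"
    using bd by (rule bounded_subset) auto
  ultimately have "is_cont_rep T (\<lambda>x. f (R x))"
    using c' by (simp add: is_cont_rep_def)
  from cont_rep_unique[OF kap this f] show ?thesis by (rule fun_cong)
qed

lemma radial_dist_of:
  fixes F :: "'a::euclidean_space \<Rightarrow> complex"
  assumes [measurable]: "F \<in> borel_measurable borel"
    and F: "\<And>R x. orthogonal_transformation R \<Longrightarrow> F (R x) = F x"
  shows "radial_dist (dist_of F)"
  unfolding radial_dist_def
proof (intro allI impI ballI)
  fix R :: "'a \<Rightarrow> 'a" and \<psi> :: "'a \<Rightarrow> complex"
  assume R: "orthogonal_transformation R" and psi: "\<psi> \<in> schwartz"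
  note [measurable] = schwartz_measurable[OF psi]
  have "dist_of F (\<lambda>x. \<psi> (R x)) = (LINT x|lborel. F (R x) * \<psi> (R x))"
    using schwartz_orthogonal[OF psi R] by (simp add: dist_of_def F[OF R])
  also have "\<dots> = dist_of F \<psi>"
    using psi by (simp add: dist_of_def integral_orthogonal[OF R, of "\<lambda>x. F x * \<psi> x"])
  finally show "dist_of F (\<lambda>x. \<psi> (R x)) = dist_of F \<psi>" .
qed

section \<open>Transfer of radial profiles\<close>

lemma besov_norm_eq: "besov_norm \<phi> s q T = lq_norm q (\<lambda>j. ennreal (2 powr (real j * s)) * Linf_norm (besov_piece \<phi> j T))"
  by (simp add: besov_norm_def besov_piece_def)

lemma power_powr: "(2 powr a) ^ n = (2::real) powr (a * real n)"
  using powr_realpow[of "2 powr a" n] by (simp add: powr_powr)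

text \<open>The quasi-norm dominates every weighted term, so the norms of the pieces are at most a
  multiple of \<open>2 powr (- s * j)\<close>, which is summable because
  \<open>s > 0\<close>.\<close>

lemma besov_pieces_finite:
  fixes \<phi> :: "'a::euclidean_space \<Rightarrow> complex"
  assumes T: "T \<in> besov \<phi> s q" and s: "s > 0" and q: "q > 0"
  shows "Linf_norm (besov_piece \<phi> j T) < \<infinity>"
    "summable (\<lambda>j. enn2real (Linf_norm (besov_piece \<phi> j T)))"
proof -
  have fin: "besov_norm \<phi> s q T < \<infinity>" using T by (simp add: besov_def)
  have le: "ennreal (2 powr (real j * s)) * Linf_norm (besov_piece \<phi> j T) \<le> besov_norm \<phi> s q T" for j
    unfolding besov_norm_eq using lq_norm_ge[OF q] .
  have f: "Linf_norm (besov_piece \<phi> j T) < \<infinity>" for j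
  proof (rule ccontr)
    assume "\<not> Linf_norm (besov_piece \<phi> j T) < \<infinity>"
    then have "Linf_norm (besov_piece \<phi> j T) = top" by (simp add: less_top[symmetric])
    then have "ennreal (2 powr (real j * s)) * Linf_norm (besov_piece \<phi> j T) = top"
      by (simp add: ennreal_mult_top)
    then show False using le[of j] fin by (simp add: top_unique)
  qed
  show "Linf_norm (besov_piece \<phi> j T) < \<infinity>" by (rule f)
  obtain N where N: "besov_norm \<phi> s q T = ennreal N" "N \<ge> 0"
    using fin by (metis ennreal_cases infinity_ennreal_def less_irrefl)
  define e where "e = 2 powr (- s)"
  have e: "0 < e" "e < 1" using s powr_less_mono[of "- s" 0 2] by (simp_all add: e_def)
  have "enn2real (Linf_norm (besov_piece \<phi> j T)) \<le> N * e ^ j" for j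
  proof -
    define l where "l = enn2real (Linf_norm (besov_piece \<phi> j T))"
    have "Linf_norm (besov_piece \<phi> j T) = ennreal l" "l \<ge> 0"
      using f[of j] by (simp_all add: l_def)
    then have "2 powr (real j * s) * l \<le> N"
      using le[of j] N by (simp add: ennreal_mult[symmetric])
    moreover have "2 powr (real j * s) * e ^ j = 1"
      unfolding e_def power_powr powr_add[symmetric] by simp
    ultimately have "(2 powr (real j * s) * l) * e ^ j \<le> N * e ^ j"
      using e by (intro mult_right_mono) auto
    also have "(2 powr (real j * s) * l) * e ^ j = (2 powr (real j * s) * e ^ j) * l"
      by (simp only: mult_ac)
    also have "\<dots> = l" unfolding \<open>2 powr (real j * s) * e ^ j = 1\<close> by simp
    finally show ?thesis unfolding l_def .
  qed
  moreover have "summable (\<lambda>j. N * e ^ j)"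
    using e by (intro summable_mult summable_geometric) auto
  ultimately show "summable (\<lambda>j. enn2real (Linf_norm (besov_piece \<phi> j T)))"
    by (rule_tac summable_comparison_test'[where g = "\<lambda>j. N * e ^ j" and N = 0]) auto
qed

text \<open>For \<open>k \<le> j\<close> the minimum is bounded by \<open>1\<close> and the decay
  comes from \<open>d \<le> s\<close>; for \<open>j < k\<close> it is bounded by the quotient and
  the decay comes from \<open>d \<le> 2 * m - s\<close>. The square on the right matches the
  two-factor splitting in the convolution estimate.\<close>

lemma weight_le:
  fixes s :: real
  assumes d: "0 \<le> d" "d \<le> s" "d \<le> 2 * real m - s"
  shows "2 powr (real k * s) * min 1 (4 ^ (m * j) / 4 ^ (m * k))
    \<le> ((2 powr (- (d / 2))) ^ nat_dist j k)\<^sup>2 * 2 powr (real j * s)"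
proof -
  have eq: "((2 powr (- (d / 2))) ^ nat_dist j k)\<^sup>2 = 2 powr (- d * real (nat_dist j k))"
    unfolding power_powr power2_eq_square powr_add[symmetric] by simp
  show ?thesis
  proof (cases "k \<le> j")
    case True
    have "2 powr (real k * s) * min 1 (4 ^ (m * j) / 4 ^ (m * k)) \<le> 2 powr (real k * s) * 1"
      by (intro mult_left_mono) auto
    also have "\<dots> \<le> 2 powr (- d * real (nat_dist j k) + real j * s)"
    proof -
      have "d * (real j - real k) \<le> s * (real j - real k)"
        using True d by (intro mult_right_mono) auto
      then show ?thesis using True
        by (simp add: nat_dist_def of_nat_diff algebra_simps)
    qed
    finally show ?thesis unfolding eq by (simp only: powr_add)
  next
    case False
    have 4: "(4::real) ^ n = 2 powr (2 * real n)" for n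
    proof -
      have "(4::real) ^ n = (2 powr 2) ^ n" by simp
      then show ?thesis unfolding power_powr .
    qed
    have "2 powr (real k * s) * min 1 (4 ^ (m * j) / 4 ^ (m * k)) \<le> 2 powr (real k * s) * (4 ^ (m * j) / 4 ^ (m * k))"
      by (intro mult_left_mono) auto
    also have "\<dots> = 2 powr (real k * s + (2 * real (m * j) - 2 * real (m * k)))"
      unfolding 4 by (simp add: powr_add powr_diff)
    also have "\<dots> \<le> 2 powr (- d * real (nat_dist j k) + real j * s)"
    proof -
      have "d * (real k - real j) \<le> (2 * real m - s) * (real k - real j)"
        using False d by (intro mult_right_mono) auto
      then show ?thesis using False
        by (simp add: nat_dist_def of_nat_diff algebra_simps)
    qed
    finally show ?thesis unfolding eq by (simp only: powr_add)
  qed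
qed

text \<open>The trace is the case where \<open>\<theta>\<close> lives on the line, the extension the one where \<open>\<phi>\<close> does.\<close>

lemma besov_transfer:
  fixes \<phi> :: "'a::euclidean_space \<Rightarrow> complex" and \<theta> :: "'b::euclidean_space \<Rightarrow> complex"
  assumes phi: "besov_cutoff \<phi>" and theta: "besov_cutoff \<theta>" and b: "b \<in> Basis"
    and s: "s > 0" and q: "q > 0"
  obtains D :: real where "\<And>T. T \<in> besov \<phi> s q \<Longrightarrow> \<exists>f. is_cont_rep T f \<and>
    ((\<forall>x. f (- x) = f x) \<longrightarrow>
      is_cont_rep (dist_of (\<lambda>x::'b. f (norm x *\<^sub>R b))) (\<lambda>x. f (norm x *\<^sub>R b)) \<and>
      dist_of (\<lambda>x::'b. f (norm x *\<^sub>R b)) \<in> besov \<theta> s q \<and>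
      besov_norm \<theta> s q (dist_of (\<lambda>x::'b. f (norm x *\<^sub>R b))) \<le> ennreal D * besov_norm \<phi> s q T)"
proof -
  obtain m :: nat where "s / 2 < real m"
    using reals_Archimedean2 by blast
  then have m: "s < 2 * real m" by simp
  \<comment> \<open>The rate of decay away from the diagonal is at least \<open>s\<close> on one
    side and \<open>2 * m - s\<close> on the other; half of their minimum goes into each of the two
    factors \<open>e ^ nat_dist j k\<close>.\<close>
  define d where "d = min s (2 * real m - s)"
  have d: "0 < d" "d \<le> s" "d \<le> 2 * real m - s" using s m by (auto simp: d_def)
  define e where "e = 2 powr (- (d / 2))"
  have e: "0 < e" "e < 1" using d(1) powr_less_mono[of "- (d / 2)" 0 2] by (simp_all add: e_def)
  obtain B where ana: "\<And>T. T \<in> tempered \<Longrightarrow> (\<And>j. Linf_norm (besov_piece \<phi> j T) < \<infinity>) \<Longrightarrow>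
      summable (\<lambda>j. enn2real (Linf_norm (besov_piece \<phi> j T))) \<Longrightarrow>
      \<exists>f G. is_cont_rep T f \<and> (\<forall>j n t. (G j n has_vector_derivative G j (Suc n) t) (at t)) \<and>
        (\<forall>j n t. norm (G j n t) \<le> B n * 2 ^ (j * n) * enn2real (Linf_norm (besov_piece \<phi> j T))) \<and>
        (\<forall>t. (\<lambda>j. G j 0 t) sums f (t *\<^sub>R b))"
    using besov_analysis[OF phi b] by blast
  obtain C where C: "C \<ge> 0" and syn: "\<And>a G g k. (\<And>j. deriv_seq (G j)) \<Longrightarrow> (\<And>j t. G j 0 (- t) = G j 0 t) \<Longrightarrow>
     (\<And>j n t. norm (G j n t) \<le> B n * 2 ^ (j * n) * a j) \<Longrightarrow> (\<And>j. 0 \<le> a j) \<Longrightarrow> summable a \<Longrightarrow>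
     (\<And>t. (\<lambda>j. G j 0 t) sums g t) \<Longrightarrow> continuous_on UNIV g \<Longrightarrow>
     Linf_norm (besov_piece \<theta> k (dist_of (\<lambda>x. g (norm x))))
       \<le> ennreal (C * (\<Sum>j. min 1 (4 ^ (m * j) / 4 ^ (m * k)) * a j))"
    using besov_synthesis[OF theta, of B m] by blast
  obtain D where D: "D \<ge> 0"
    "\<And>A B. (\<And>j. 0 \<le> A j) \<Longrightarrow> lq_norm q (\<lambda>j. ennreal (A j)) < \<infinity> \<Longrightarrow>
      (\<And>k. B k \<le> ennreal (C * (\<Sum>j. (e ^ nat_dist j k)\<^sup>2 * A j))) \<Longrightarrow>
      lq_norm q B \<le> ennreal D * lq_norm q (\<lambda>j. ennreal (A j))"
    using lq_norm_convolution[OF e q C] by blast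
  show ?thesis
  proof (rule that[of D])
    fix T assume T: "T \<in> besov \<phi> s q"
    note fin = besov_pieces_finite[OF T s q]
    have Tt: "T \<in> tempered" using T by (simp add: besov_def)
    define a where "a j = enn2real (Linf_norm (besov_piece \<phi> j T))" for j
    have a0: "0 \<le> a j" for j by (simp add: a_def)
    have La: "Linf_norm (besov_piece \<phi> j T) = ennreal (a j)" for j
      using fin(1)[of j] by (simp add: a_def)
    have sa: "summable a" using fin(2) by (simp add: a_def[abs_def])
    obtain f G where f: "is_cont_rep T f" and G: "\<And>j n t. (G j n has_vector_derivative G j (Suc n) t) (at t)"
      and Gb: "\<And>j n t. norm (G j n t) \<le> B n * 2 ^ (j * n) * a j"
      and Gs: "\<And>t. (\<lambda>j. G j 0 t) sums f (t *\<^sub>R b)"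
      using ana[OF Tt fin] unfolding a_def by blast
    show "\<exists>f. is_cont_rep T f \<and>
    ((\<forall>x. f (- x) = f x) \<longrightarrow>
      is_cont_rep (dist_of (\<lambda>x::'b. f (norm x *\<^sub>R b))) (\<lambda>x. f (norm x *\<^sub>R b)) \<and>
      dist_of (\<lambda>x::'b. f (norm x *\<^sub>R b)) \<in> besov \<theta> s q \<and>
      besov_norm \<theta> s q (dist_of (\<lambda>x::'b. f (norm x *\<^sub>R b))) \<le> ennreal D * besov_norm \<phi> s q T)"
    proof (intro exI[of _ f] conjI f impI)
      assume ev: "\<forall>x. f (- x) = f x"
      let ?F = "\<lambda>x::'b. f (norm x *\<^sub>R b)"
      have fc: "continuous_on UNIV f" and fb: "bounded (range f)" using f by (auto simp: is_cont_rep_def)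
      have gc: "continuous_on UNIV (\<lambda>t. f (t *\<^sub>R b))"
        by (intro continuous_on_compose2[OF fc] continuous_intros) auto
      have Fc: "continuous_on UNIV ?F"
        by (intro continuous_on_compose2[OF fc] continuous_intros) auto
      have Fbd: "bounded (range ?F)" using fb by (rule bounded_subset) auto
      show "is_cont_rep (dist_of ?F) ?F" using Fc Fbd by (simp add: is_cont_rep_def)
      \<comment> \<open>The even part of a term: \<open>\<phi>\<close> need not be even, so the
        terms need not be even although their sum is. The sign comes from differentiating
        \<open>G j 0 (- t)\<close> in \<open>t\<close>.\<close>
      define H where "H j n t = (G j n t + (-1) ^ n * G j n (- t)) / 2" for j n t
      have H: "deriv_seq (H j)" for j
        unfolding deriv_seq_def
      proof (intro allI)
        fix n t
        have "((\<lambda>t. - t) has_vector_derivative - 1) (at t)"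
          by (auto intro!: derivative_eq_intros)
        from vector_diff_chain_at[OF this G[of j n "- t"]]
        have "((\<lambda>t. G j n (- t)) has_vector_derivative - G j (Suc n) (- t)) (at t)"
          by (simp add: o_def)
        then have "((\<lambda>t. (1/2) * (G j n t + (-1) ^ n * G j n (- t))) has_vector_derivative
            (1/2) * (G j (Suc n) t + (-1) ^ n * (- G j (Suc n) (- t)))) (at t)"
          by (intro has_vector_derivative_mult_right has_vector_derivative_add G)
        then show "(H j n has_vector_derivative H j (Suc n) t) (at t)"
          by (simp add: H_def[abs_def])
      qed
      have Hev: "H j 0 (- t) = H j 0 t" for j t by (simp add: H_def add.commute)
      have Hb: "norm (H j n t) \<le> B n * 2 ^ (j * n) * a j" for j n t
      proof -
        have "norm (H j n t) \<le> (norm (G j n t) + norm (G j n (- t))) / 2"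
          unfolding H_def norm_divide using norm_triangle_ineq[of "G j n t" "(-1) ^ n * G j n (- t)"]
          by (simp add: norm_mult norm_power)
        also have "\<dots> \<le> (B n * 2 ^ (j * n) * a j + B n * 2 ^ (j * n) * a j) / 2"
          by (intro divide_right_mono add_mono Gb) simp
        finally show ?thesis by (simp add: mult_ac)
      qed
      \<comment> \<open>Evenness of \<open>f\<close> enters here: the even parts have the same sum
        on the line.\<close>
      have Hs: "(\<lambda>j. H j 0 t) sums f (t *\<^sub>R b)" for t
      proof -
        have "(\<lambda>j. (G j 0 t + G j 0 (- t)) / 2) sums ((f (t *\<^sub>R b) + f (- t *\<^sub>R b)) / 2)"
          by (intro sums_divide sums_add Gs)
        then show ?thesis using ev by (simp add: H_def)
      qed
      note pk = syn[of H a "\<lambda>t. f (t *\<^sub>R b)", OF H Hev Hb a0 sa Hs gc]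
      define A where "A j = 2 powr (real j * s) * a j" for j
      have A0: "0 \<le> A j" for j by (simp add: A_def a0)
      have nT: "besov_norm \<phi> s q T = lq_norm q (\<lambda>j. ennreal (A j))"
        by (simp add: besov_norm_eq La A_def ennreal_mult a0)
      have lq: "lq_norm q (\<lambda>j. ennreal (A j)) < \<infinity>"
        using T by (simp add: besov_def flip: nT)
      have bound: "ennreal (2 powr (real k * s)) * Linf_norm (besov_piece \<theta> k (dist_of ?F))
          \<le> ennreal (C * (\<Sum>j. (e ^ nat_dist j k)\<^sup>2 * A j))" for k
      proof -
        let ?w = "\<lambda>j. min 1 (4 ^ (m * j) / 4 ^ (m * k)) :: real"
        have w: "0 \<le> ?w j" "?w j \<le> 1" for j by auto
        have swa: "summable (\<lambda>j. ?w j * a j)"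
          by (rule summable_comparison_test'[OF sa, of 0]) (use w a0 in \<open>auto simp: abs_mult intro!: mult_left_le_one_le\<close>)
        have A_bd: "A j \<le> enn2real (besov_norm \<phi> s q T)" for j
        proof -
          have "ennreal (A j) \<le> besov_norm \<phi> s q T"
            unfolding nT using lq_norm_ge[OF q, of "\<lambda>j. ennreal (A j)" j] .
          then have "enn2real (ennreal (A j)) \<le> enn2real (besov_norm \<phi> s q T)"
            using lq unfolding nT by (intro enn2real_mono) (simp_all only: infinity_ennreal_def)
          then show ?thesis by (simp only: enn2real_ennreal[OF A0])
        qed
        \<comment> \<open>Only boundedness of \<open>A\<close> is used; summability comes from one
          of the two geometric factors.\<close>
        have sA: "summable (\<lambda>j. (e ^ nat_dist j k)\<^sup>2 * A j)"
        proof (rule summable_comparison_test'[of "\<lambda>j. e ^ nat_dist j k * enn2real (besov_norm \<phi> s q T)" 0])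
          show "summable (\<lambda>j. e ^ nat_dist j k * enn2real (besov_norm \<phi> s q T))"
            by (intro summable_mult2 power_nat_dist_sums e)
          fix j
          have "e ^ nat_dist j k * A j \<le> 1 * enn2real (besov_norm \<phi> s q T)"
            using e by (intro mult_mono power_le_one A_bd A0) auto
          then have "e ^ nat_dist j k * (e ^ nat_dist j k * A j) \<le> e ^ nat_dist j k * enn2real (besov_norm \<phi> s q T)"
            unfolding mult_1 by (rule mult_left_mono) (rule zero_le_power[OF less_imp_le[OF e(1)]])
          then have "(e ^ nat_dist j k)\<^sup>2 * A j \<le> e ^ nat_dist j k * enn2real (besov_norm \<phi> s q T)"
            by (simp only: power2_eq_square mult.assoc)
          moreover have "norm ((e ^ nat_dist j k)\<^sup>2 * A j) = (e ^ nat_dist j k)\<^sup>2 * A j"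
            unfolding real_norm_def by (rule abs_of_nonneg[OF mult_nonneg_nonneg[OF zero_le_power2 A0]])
          ultimately show "norm ((e ^ nat_dist j k)\<^sup>2 * A j) \<le> e ^ nat_dist j k * enn2real (besov_norm \<phi> s q T)"
            by (simp only:)
        qed
        have "2 powr (real k * s) * (\<Sum>j. ?w j * a j) = (\<Sum>j. 2 powr (real k * s) * (?w j * a j))"
          by (rule suminf_mult[OF swa, symmetric])
        also have "\<dots> \<le> (\<Sum>j. (e ^ nat_dist j k)\<^sup>2 * A j)"
        proof (rule suminf_le[OF _ summable_mult[OF swa] sA])
          fix j
          have "(2 powr (real k * s) * ?w j) * a j \<le> ((e ^ nat_dist j k)\<^sup>2 * 2 powr (real j * s)) * a j"
            unfolding e_def using d by (intro mult_right_mono weight_le a0) auto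
          then show "2 powr (real k * s) * (?w j * a j) \<le> (e ^ nat_dist j k)\<^sup>2 * A j"
            by (simp only: A_def mult.assoc)
        qed
        finally have le: "C * (2 powr (real k * s) * (\<Sum>j. ?w j * a j)) \<le> C * (\<Sum>j. (e ^ nat_dist j k)\<^sup>2 * A j)"
          by (rule mult_left_mono) (rule C)
        have "(\<Sum>j. ?w j * a j) \<ge> 0"
          by (rule suminf_nonneg[OF swa]) (rule mult_nonneg_nonneg[OF w(1) a0])
        then have nn: "C * (\<Sum>j. ?w j * a j) \<ge> 0" using C by (rule mult_nonneg_nonneg[rotated])
        have "ennreal (2 powr (real k * s)) * Linf_norm (besov_piece \<theta> k (dist_of ?F))
            \<le> ennreal (2 powr (real k * s)) * ennreal (C * (\<Sum>j. ?w j * a j))"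
          by (rule mult_left_mono[OF pk]) simp
        also have "\<dots> = ennreal (2 powr (real k * s) * (C * (\<Sum>j. ?w j * a j)))"
          by (rule ennreal_mult[OF powr_ge_zero nn, symmetric])
        also have "\<dots> \<le> ennreal (C * (\<Sum>j. (e ^ nat_dist j k)\<^sup>2 * A j))"
          using le by (intro ennreal_leI) (simp only: mult.left_commute)
        finally show ?thesis .
      qed
      show nb: "besov_norm \<theta> s q (dist_of ?F) \<le> ennreal D * besov_norm \<phi> s q T"
        unfolding besov_norm_eq[of \<theta>] nT by (rule D(2)[OF A0 lq bound])
      have "ennreal D * besov_norm \<phi> s q T < \<infinity>"
        using lq unfolding nT by (simp add: ennreal_mult_less_top)
      moreover have "dist_of ?F \<in> tempered"
        using Fbd by (auto simp: bounded_iff intro!: dist_of_tempered borel_measurable_continuous_onI Fc)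
      ultimately show "dist_of ?F \<in> besov \<theta> s q"
        using nb by (auto simp: besov_def intro: le_less_trans)
    qed
  qed
qed

section \<open>Continuous representatives and the isomorphism\<close>

lemma cont_rep_eq:
  fixes \<kappa> :: "'a::euclidean_space \<Rightarrow> complex" and T :: "('a \<Rightarrow> complex) \<Rightarrow> complex"
  assumes "besov_cutoff \<kappa>" "is_cont_rep T f"
  shows "cont_rep T = f"
  unfolding cont_rep_def
  by (rule the_equality[where P = "is_cont_rep T"])
    (use assms cont_rep_unique[OF besov_cutoff_schwartz[OF assms(1)] besov_cutoff_0[OF assms(1)]] in auto)

lemma is_cont_rep_linear:
  fixes S T :: "('a::euclidean_space \<Rightarrow> complex) \<Rightarrow> complex"
  assumes f: "is_cont_rep S f" and g: "is_cont_rep T g"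
  shows "is_cont_rep (\<lambda>\<psi>. a * S \<psi> + b * T \<psi>) (\<lambda>x. a * f x + b * g x)"
proof -
  have fc: "continuous_on UNIV f" "bounded (range f)" "S = dist_of f"
    and gc: "continuous_on UNIV g" "bounded (range g)" "T = dist_of g"
    using f g by (auto simp: is_cont_rep_def)
  obtain B where B: "\<And>x. norm (f x) \<le> B" using fc(2) by (auto simp: bounded_iff)
  obtain C where C: "\<And>x. norm (g x) \<le> C" using gc(2) by (auto simp: bounded_iff)
  have "norm (a * f x + b * g x) \<le> norm a * B + norm b * C" for x
    by (rule order_trans[OF norm_triangle_ineq]) (auto simp: norm_mult intro!: add_mono mult_left_mono B C)
  then have "bounded (range (\<lambda>x. a * f x + b * g x))" by (auto simp: bounded_iff)
  moreover have "(\<lambda>\<psi>. a * S \<psi> + b * T \<psi>) = dist_of (\<lambda>x. a * f x + b * g x)"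
  proof
    fix \<psi> show "a * S \<psi> + b * T \<psi> = dist_of (\<lambda>x. a * f x + b * g x) \<psi>"
    proof (cases "\<psi> \<in> schwartz")
      case True
      have "integrable lborel (\<lambda>x. f x * \<psi> x)" "integrable lborel (\<lambda>x. g x * \<psi> x)"
        using integrable_schwartz_mult[OF borel_measurable_continuous_onI[OF fc(1)] B True]
          integrable_schwartz_mult[OF borel_measurable_continuous_onI[OF gc(1)] C True] by auto
      moreover have "(LINT x|lborel. (a * f x + b * g x) * \<psi> x) = (LINT x|lborel. a * (f x * \<psi> x) + b * (g x * \<psi> x))"
        by (intro Bochner_Integration.integral_cong) (auto simp: algebra_simps)
      ultimately show ?thesis using True by (simp add: fc gc dist_of_def)
    qed (simp add: fc gc dist_of_def)
  qed
  ultimately show ?thesis using fc gc by (auto simp: is_cont_rep_def intro!: continuous_intros)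
qed

lemma orthogonal_transformation_uminus: "orthogonal_transformation (\<lambda>x::'a::euclidean_space. - x)"
  by (simp add: orthogonal_transformation_neg orthogonal_transformation_id[unfolded id_def])

lemma radial_dist_of_norm:
  fixes F :: "'a::euclidean_space \<Rightarrow> complex"
  assumes F: "is_cont_rep (dist_of F) F" and rad: "\<And>x y. norm x = norm y \<Longrightarrow> F x = F y"
  shows "radial_dist (dist_of F)"
proof (rule radial_dist_of)
  show "F \<in> borel_measurable borel"
    using F by (intro borel_measurable_continuous_onI) (simp add: is_cont_rep_def)
  show "F (R x) = F x" if "orthogonal_transformation R" for R x
    by (rule rad) (rule orthogonal_transformation_norm[OF that])
qed

text \<open>Boundedness in both directions comes from the transfer of profiles with the two spaces
  exchanged. That the maps are mutually inverse is read off from the continuous representatives,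
  since a radial function is determined by its values on the axis \<open>i\<close>.\<close>

theorem theorem2:
  fixes \<phi> :: "real^'d::finite \<Rightarrow> complex"
    and \<theta> :: "real \<Rightarrow> complex"
    and s :: real and q :: ennreal and i :: 'd
  assumes "besov_cutoff \<phi>" and "besov_cutoff \<theta>"
    and "CARD('d) \<ge> 2" and "s > 0" and "q > 0"
  shows "(\<forall>T \<in> radial_besov \<phi> s q. \<exists>!f. is_cont_rep T f) \<and>
    (\<forall>T \<in> radial_besov \<theta> s q. \<exists>!g. is_cont_rep T g) \<and>
    linear_isomorphism (radial_besov \<phi> s q) (besov_norm \<phi> s q)
      (radial_besov \<theta> s q) (besov_norm \<theta> s q) (tr i) \<and>
    (\<forall>T \<in> radial_besov \<theta> s q. inv_into (radial_besov \<phi> s q) (tr i) T = ext T)"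
proof -
  let ?e = "axis i 1 :: real^'d"
  let ?X = "radial_besov \<phi> s q" and ?Y = "radial_besov \<theta> s q"
  have eB: "?e \<in> Basis" by (simp add: axis_in_Basis_iff)
  have ne: "norm ?e = 1" using eB by simp
  have nax: "norm (axis i t :: real^'d) = \<bar>t\<bar>" for t
  proof -
    have "axis i t = t *\<^sub>R ?e" by (simp add: axis_def vec_eq_iff)
    then show ?thesis by (simp only: norm_scaleR ne mult_1_right)
  qed
  note phiS = besov_cutoff_schwartz[OF assms(1)] besov_cutoff_0[OF assms(1)]
  note thS = besov_cutoff_schwartz[OF assms(2)] besov_cutoff_0[OF assms(2)]
  obtain D where D: "\<And>T. T \<in> besov \<phi> s q \<Longrightarrow> \<exists>f. is_cont_rep T f \<and>
    ((\<forall>x. f (- x) = f x) \<longrightarrow>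
      is_cont_rep (dist_of (\<lambda>x::real. f (norm x *\<^sub>R ?e))) (\<lambda>x. f (norm x *\<^sub>R ?e)) \<and>
      dist_of (\<lambda>x::real. f (norm x *\<^sub>R ?e)) \<in> besov \<theta> s q \<and>
      besov_norm \<theta> s q (dist_of (\<lambda>x::real. f (norm x *\<^sub>R ?e))) \<le> ennreal D * besov_norm \<phi> s q T)"
    by (rule besov_transfer[OF assms(1,2) eB assms(4,5)]) (rule that)
  have oneB: "(1::real) \<in> Basis" by simp
  obtain E where E: "\<And>T. T \<in> besov \<theta> s q \<Longrightarrow> \<exists>f. is_cont_rep T f \<and>
    ((\<forall>x. f (- x) = f x) \<longrightarrow>
      is_cont_rep (dist_of (\<lambda>x::real^'d. f (norm x *\<^sub>R (1::real)))) (\<lambda>x. f (norm x *\<^sub>R 1)) \<and>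
      dist_of (\<lambda>x::real^'d. f (norm x *\<^sub>R (1::real))) \<in> besov \<phi> s q \<and>
      besov_norm \<phi> s q (dist_of (\<lambda>x::real^'d. f (norm x *\<^sub>R (1::real)))) \<le> ennreal E * besov_norm \<theta> s q T)"
    by (rule besov_transfer[OF assms(2,1) oneB assms(4,5)]) (rule that)
  \<comment> \<open>The transfer yields a representative only existentially, so all facts about one
    element are bundled around the same \<open>f\<close>.\<close>
  have X: "\<exists>f. is_cont_rep T f \<and> cont_rep T = f \<and> (\<forall>x y. norm x = norm y \<longrightarrow> f x = f y) \<and>
      is_cont_rep (tr i T) (\<lambda>t. f (\<bar>t\<bar> *\<^sub>R ?e)) \<and> tr i T \<in> ?Y \<and>
      besov_norm \<theta> s q (tr i T) \<le> ennreal D * besov_norm \<phi> s q T" if T: "T \<in> ?X" for T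
  proof -
    have Tb: "T \<in> besov \<phi> s q" "radial_dist T" using T unfolding radial_besov_def by blast+
    obtain f where r: "is_cont_rep T f \<and>
      ((\<forall>x. f (- x) = f x) \<longrightarrow>
      is_cont_rep (dist_of (\<lambda>x::real. f (norm x *\<^sub>R ?e))) (\<lambda>x. f (norm x *\<^sub>R ?e)) \<and>
      dist_of (\<lambda>x::real. f (norm x *\<^sub>R ?e)) \<in> besov \<theta> s q \<and>
      besov_norm \<theta> s q (dist_of (\<lambda>x::real. f (norm x *\<^sub>R ?e))) \<le> ennreal D * besov_norm \<phi> s q T)"
      using D[OF Tb(1)] ..
    note f = r[THEN conjunct1] and f2 = r[THEN conjunct2]
    \<comment> \<open>Orthogonal transformations act transitively on spheres.\<close>
    have rad: "f x = f y" if n: "norm x = norm y" for x y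
    proof -
      obtain R where "orthogonal_transformation R" "R y = x"
        by (rule orthogonal_transformation_exists[OF n[symmetric]]) (rule that)
      then show ?thesis using radial_cont_rep[OF phiS f Tb(2), of R y] by simp
    qed
    have cr: "cont_rep T = f" by (rule cont_rep_eq[OF assms(1) f])
    have trT: "tr i T = dist_of (\<lambda>t::real. f (norm t *\<^sub>R ?e))"
    proof -
      \<comment> \<open>For \<open>t < 0\<close> the two arguments are opposite points of the axis,
        so radiality of \<open>f\<close> is needed.\<close>
      have "(\<lambda>t. f (axis i t)) = (\<lambda>t::real. f (norm t *\<^sub>R ?e))"
        by (rule HOL.ext, rule rad) (simp add: nax)
      then show ?thesis unfolding tr_def cr by (rule arg_cong)
    qed
    have ev: "\<forall>x. f (- x) = f x" by (intro allI rad) simp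
    note f3 = f2[THEN mp, OF ev]
    have g: "is_cont_rep (tr i T) (\<lambda>t. f (\<bar>t\<bar> *\<^sub>R ?e))" "tr i T \<in> besov \<theta> s q"
      "besov_norm \<theta> s q (tr i T) \<le> ennreal D * besov_norm \<phi> s q T"
      unfolding trT using f3 by (simp_all only: real_norm_def)
    have "radial_dist (tr i T)"
      unfolding trT by (rule radial_dist_of_norm) (use f3 in simp_all)
    then have mem: "tr i T \<in> ?Y"
      unfolding radial_besov_def using g(2) by (intro CollectI conjI)
    show ?thesis
      by (intro exI[of _ f] conjI allI impI f cr g(1) mem g(3)) (rule rad)
  qed
  have Y: "\<exists>g. is_cont_rep T g \<and> cont_rep T = g \<and> (\<forall>t. g (- t) = g t) \<and>
      is_cont_rep (ext T) (\<lambda>x::real^'d. g (norm x)) \<and> ext T \<in> ?X \<and>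
      besov_norm \<phi> s q (ext T) \<le> ennreal E * besov_norm \<theta> s q T" if T: "T \<in> ?Y" for T
  proof -
    have Tb: "T \<in> besov \<theta> s q" "radial_dist T" using T unfolding radial_besov_def by blast+
    obtain g where r: "is_cont_rep T g \<and>
      ((\<forall>x. g (- x) = g x) \<longrightarrow>
      is_cont_rep (dist_of (\<lambda>x::real^'d. g (norm x *\<^sub>R (1::real)))) (\<lambda>x. g (norm x *\<^sub>R 1)) \<and>
      dist_of (\<lambda>x::real^'d. g (norm x *\<^sub>R (1::real))) \<in> besov \<phi> s q \<and>
      besov_norm \<phi> s q (dist_of (\<lambda>x::real^'d. g (norm x *\<^sub>R (1::real)))) \<le> ennreal E * besov_norm \<theta> s q T)"
      using E[OF Tb(1)] ..
    note g = r[THEN conjunct1] and g2 = r[THEN conjunct2]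
    have ev: "g (- t) = g t" for t
      using radial_cont_rep[OF thS g Tb(2), OF orthogonal_transformation_uminus, of t] .
    have cr: "cont_rep T = g" by (rule cont_rep_eq[OF assms(2) g])
    have extT: "ext T = dist_of (\<lambda>x::real^'d. g (norm x))"
      unfolding ext_def cr ..
    have "\<forall>t. g (- t) = g t" using ev by blast
    note g3 = g2[THEN mp, OF this]
    have h: "is_cont_rep (ext T) (\<lambda>x::real^'d. g (norm x))" "ext T \<in> besov \<phi> s q"
      "besov_norm \<phi> s q (ext T) \<le> ennreal E * besov_norm \<theta> s q T"
      unfolding extT using g3 by (simp_all only: real_scaleR_def mult_1_right)
    have "radial_dist (ext T :: (real^'d \<Rightarrow> complex) \<Rightarrow> complex)"
      unfolding extT by (rule radial_dist_of_norm) (use h(1) in \<open>simp_all add: extT\<close>)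
    then have mem: "ext T \<in> ?X"
      unfolding radial_besov_def using h(2) by (intro CollectI conjI)
    show ?thesis
      by (intro exI[of _ g] conjI allI g cr ev h(1) mem h(3))
  qed
  have et: "ext (tr i T) = T" if T: "T \<in> ?X" for T
  proof -
    obtain f where f: "is_cont_rep T f" "\<forall>x y. norm x = norm y \<longrightarrow> f x = f y"
      "is_cont_rep (tr i T) (\<lambda>t. f (\<bar>t\<bar> *\<^sub>R ?e))"
      using X[OF T] by blast
    have "ext (tr i T) = dist_of (\<lambda>x. f (\<bar>norm x\<bar> *\<^sub>R ?e))"
      unfolding ext_def cont_rep_eq[OF assms(2) f(3)] ..
    \<comment> \<open>The point \<open>norm x *\<^sub>R ?e\<close> lies on the same sphere as
      \<open>x\<close>.\<close>
    also have "(\<lambda>x. f (\<bar>norm x\<bar> *\<^sub>R ?e)) = f"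
      by (rule HOL.ext, rule f(2)[rule_format]) (simp add: ne)
    finally show ?thesis using f(1) by (simp add: is_cont_rep_def)
  qed
  have te: "tr i (ext T) = T" if T: "T \<in> ?Y" for T
  proof -
    obtain g where g: "is_cont_rep T g" "\<forall>t. g (- t) = g t" "is_cont_rep (ext T) (\<lambda>x::real^'d. g (norm x))"
      using Y[OF T] by blast
    have "tr i (ext T) = dist_of (\<lambda>t. g (norm (axis i t :: real^'d)))"
      unfolding tr_def cont_rep_eq[OF assms(1) g(3)] ..
    also have "(\<lambda>t. g (norm (axis i t :: real^'d))) = g"
      using g(2) by (intro HOL.ext) (simp add: nax abs_if)
    finally show ?thesis using g(1) by (simp add: is_cont_rep_def)
  qed
  have trX: "tr i T \<in> ?Y" if "T \<in> ?X" for T using X[OF that] by blast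
  have extY: "ext T \<in> ?X" if "T \<in> ?Y" for T using Y[OF that] by blast
  have bij: "bij_betw (tr i) ?X ?Y"
    by (rule bij_betw_byWitness[where f' = ext]) (use et te trX extY in auto)
  have inv: "inv_into ?X (tr i) T = ext T" if "T \<in> ?Y" for T
    using bij_betw_imp_inj_on[OF bij] extY[OF that] te[OF that] by (metis inv_into_f_f)
  have lin: "linear_map_on ?X (tr i)"
    unfolding linear_map_on_def
  proof (intro ballI allI)
    fix S T a b assume S: "S \<in> ?X" and T: "T \<in> ?X"
    obtain f where f: "is_cont_rep S f" "cont_rep S = f" "is_cont_rep (tr i S) (\<lambda>t. f (\<bar>t\<bar> *\<^sub>R ?e))"
      and fr: "\<forall>x y. norm x = norm y \<longrightarrow> f x = f y"
      using X[OF S] by blast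
    obtain g where g: "is_cont_rep T g" "cont_rep T = g" "is_cont_rep (tr i T) (\<lambda>t. g (\<bar>t\<bar> *\<^sub>R ?e))"
      and gr: "\<forall>x y. norm x = norm y \<longrightarrow> g x = g y"
      using X[OF T] by blast
    have "tr i (\<lambda>\<psi>. a * S \<psi> + b * T \<psi>) = dist_of (\<lambda>t. a * f (axis i t) + b * g (axis i t))"
      unfolding tr_def cont_rep_eq[OF assms(1) is_cont_rep_linear[OF f(1) g(1)]] ..
    also have "(\<lambda>t. a * f (axis i t) + b * g (axis i t)) = (\<lambda>t. a * f (\<bar>t\<bar> *\<^sub>R ?e) + b * g (\<bar>t\<bar> *\<^sub>R ?e))"
    proof
      fix t
      have "norm (axis i t :: real^'d) = norm (\<bar>t\<bar> *\<^sub>R ?e)" by (simp add: nax)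
      then have "f (axis i t) = f (\<bar>t\<bar> *\<^sub>R ?e)" "g (axis i t) = g (\<bar>t\<bar> *\<^sub>R ?e)"
        using fr gr by blast+
      then show "a * f (axis i t) + b * g (axis i t) = a * f (\<bar>t\<bar> *\<^sub>R ?e) + b * g (\<bar>t\<bar> *\<^sub>R ?e)" by simp
    qed
    also have "dist_of \<dots> = (\<lambda>\<psi>. a * tr i S \<psi> + b * tr i T \<psi>)"
      using is_cont_rep_linear[OF f(3) g(3), of a b] by (simp add: is_cont_rep_def)
    finally show "tr i (\<lambda>\<psi>. a * S \<psi> + b * T \<psi>) = (\<lambda>\<psi>. a * tr i S \<psi> + b * tr i T \<psi>)" .
  qed
  have "linear_isomorphism ?X (besov_norm \<phi> s q) ?Y (besov_norm \<theta> s q) (tr i)"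
    unfolding linear_isomorphism_def bounded_map_on_def
  proof (intro conjI bij lin)
    show "\<exists>C::real. \<forall>T\<in>?X. besov_norm \<theta> s q (tr i T) \<le> ennreal C * besov_norm \<phi> s q T"
      using X by (intro exI[of _ D]) blast
    show "\<exists>C::real. \<forall>T\<in>?Y. besov_norm \<phi> s q (inv_into ?X (tr i) T) \<le> ennreal C * besov_norm \<theta> s q T"
      using Y by (intro exI[of _ E]) (auto simp: inv)
  qed
  moreover have "\<exists>!f. is_cont_rep T f" if "T \<in> ?X" for T
    using X[OF that] cont_rep_unique[OF phiS] by metis
  moreover have "\<exists>!g. is_cont_rep T g" if "T \<in> ?Y" for T
    using Y[OF that] cont_rep_unique[OF thS] by metis
  ultimately show ?thesis using inv by blast
qed

end
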